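(* Let $\mu$ be a $\rhd$-infinitely divisible probability measure on $\mathbb R$, and for $n\in\mathbb N$ let $\mu_{1/n}$ denote an $n$-th root of $\mu$ with respect to $\rhd$. Then: (1) The family of probability measures $\{\mu_{1/2^n}: n\in\mathbb N\}$ can be uniquely extended to a weak*-continuous semigroup $\{\mu_t: t\ge0\}$ with respect to monotonic additive convolution. (2) The $n$-th root of $\mu$ with respect to $\rhd$ is unique for all $n\in\mathbb N$.
   Context: For a Borel probability measure $\mu$ on $\mathbb R$ let $F_\mu(z)=\left(\int_{\mathbb R}\frac{d\mu(t)}{z-t}\right)^{-1}$, $z\in\mathbb C^+=\{\Im z>0\}$. The monotonic additive convolution $\mu\rhd\nu$ of two Borel probability measures on $\mathbb R$ is the probability measure on $\mathbb R$ determined by $F_{\mu\rhd\nu}(z)=F_\mu(F_\nu(z))$, $z\in\mathbb C^+$. (This operation is associative but not commutative.) A probability measure $\mu$ on $\mathbb R$ is $\rhd$-infinitely divisible if for every $n\in\mathbb N$ there exists a probability measure $\mu_{1/n}$ on $\mathbb R$, called an $n$-th root of $\mu$, with $\mu=\mu_{1/n}\rhd\cdots\rhd\mu_{1/n}$ ($n$ factors). A semigroup $\{\mu_t:t\ge0\}$ with respect to $\rhd$ is a family of probability measures on $\mathbb R$ with $\mu_0=\delta_0$ and $\mu_{s+t}=\mu_s\rhd\mu_t$ for all $s,t\ge0$; here $\mu_1=\mu$. *)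

theory Defs
  imports "HOL-Probability.Probability"
begin

text \<open>Borel probability measures on the real line are the measures satisfying the library locale
  predicate \<^locale>\<open>real_distribution\<close>.\<close>

definition upper_half_plane :: "complex set" where
  "upper_half_plane = {z. Im z > 0}"

definition F_transform :: "real measure \<Rightarrow> complex \<Rightarrow> complex" where
  "F_transform \<mu> z = inverse (\<integral>t. 1 / (z - complex_of_real t) \<partial>\<mu>)"

text \<open>The description below is meaningful because, for Borel probability measures on the line,
  \<open>F_transform \<mu> \<circ> F_transform \<nu>\<close> is again an F-transform on the upper half-plane, and an F-transform
  determines its measure. For other arguments the value is unspecified.\<close>

definition mono_conv :: "real measure \<Rightarrow> real measure \<Rightarrow> real measure" (infixr "\<rhd>" 70) where
  "\<mu> \<rhd> \<nu> = (THE \<rho>. real_distribution \<rho> \<and>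
      (\<forall>z\<in>upper_half_plane. F_transform \<rho> z = F_transform \<mu> (F_transform \<nu> z)))"

text \<open>The iterate is \<open>\<nu> \<rhd> (\<nu> \<rhd> \<dots> \<rhd> \<nu>)\<close> with exactly \<open>n\<close> factors.\<close>

definition mono_root :: "nat \<Rightarrow> real measure \<Rightarrow> real measure \<Rightarrow> bool" where
  "mono_root n \<mu> \<nu> \<longleftrightarrow> n \<ge> 1 \<and> real_distribution \<nu> \<and> \<mu> = (((\<rhd>) \<nu>) ^^ (n - 1)) \<nu>"

definition mono_infinitely_divisible :: "real measure \<Rightarrow> bool" where
  "mono_infinitely_divisible \<mu> \<longleftrightarrow> real_distribution \<mu> \<and> (\<forall>n\<ge>1. \<exists>\<nu>. mono_root n \<mu> \<nu>)"

text \<open>Families indexed by \<open>t \<ge> 0\<close> are total functions whose values at negative times are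
  irrelevant.\<close>

definition mono_semigroup :: "(real \<Rightarrow> real measure) \<Rightarrow> bool" where
  "mono_semigroup M \<longleftrightarrow> (\<forall>t\<ge>0. real_distribution (M t)) \<and> M 0 = return borel 0 \<and>
      (\<forall>s\<ge>0. \<forall>t\<ge>0. M (s + t) = M s \<rhd> M t)"

text \<open>The test functions are the bounded continuous ones; on probability measures they induce the same
  topology as the continuous functions vanishing at infinity.\<close>

definition weak_star_continuous :: "(real \<Rightarrow> real measure) \<Rightarrow> bool" where
  "weak_star_continuous M \<longleftrightarrow>
      (\<forall>f :: real \<Rightarrow> real. continuous_on UNIV f \<longrightarrow> bounded (range f) \<longrightarrow>
        continuous_on {0..} (\<lambda>t. \<integral>x. f x \<partial>M t))"

end

theory Submission
  imports Defs "HOL-Complex_Analysis.Complex_Analysis"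
begin

text \<open>The reciprocal Cauchy transforms of probability measures are exactly the holomorphic self-maps
  \<open>f\<close> of the upper half-plane with \<open>Im z \<le> Im (f z)\<close> and \<open>f (\<i> y) / (\<i> y) \<longlonglongrightarrow> 1\<close>, so the statement is
  about fractional iterates of such a map \<open>F\<close>. Let \<open>f\<^sub>k\<close> be a \<open>k\<close>-th compositional root of \<open>F\<close>. The
  Schwarz--Pick lemma bounds the generators \<open>k (f\<^sub>k - id)\<close> locally, uniformly in \<open>k\<close>; by Montel's
  theorem a subsequence converges to some \<open>A\<close>, which has no zeros unless \<open>F = id\<close>. A primitive \<open>h\<close> of
  \<open>1 / A\<close> is injective, since the derivative has values in a half-plane, and it satisfies
  \<open>h \<circ> F = h + 1\<close>; the semigroup is \<open>h\<^sup>-\<^sup>1 (h + t)\<close>. If \<open>f\<close> is any \<open>n\<close>-th root, then \<open>h \<circ> f - h\<close> is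
  invariant under \<open>F\<close>, and its value \<open>1 / n\<close> can be read off far along an orbit of \<open>F\<close>, because
  \<open>F (\<i> y) / (\<i> y) \<longlonglongrightarrow> 1\<close> rules out exponential growth of imaginary parts. Hence
  \<open>f = h\<^sup>-\<^sup>1 (h + 1 / n)\<close>, which is uniqueness of roots.\<close>

section \<open>The Schwarz--Pick inequality in the half-plane\<close>

text \<open>The roots of different orders are chosen independently, so no relation between them is
  available until each is seen to be a translation in the coordinate \<open>h\<close>. A bound on
  \<open>k (f\<^sub>k - id)\<close> must therefore come from \<open>F\<close> alone and be uniform
  in \<open>k\<close>, yet \<open>z\<close> and \<open>F z\<close> do not obviously control the
  intermediate points of an orbit of \<open>f\<^sub>k\<close>. What helps is that
  \<open>f\<^sub>k - id\<close> has nonnegative imaginary part: along the orbit the imaginary parts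
  of the generator have a known sum, and Schwarz--Pick bounds its fluctuations in terms of them.
  This argument closes up where \<open>Im (F z) - Im z \<le> Im z / 2\<close>. Such points exist
  high on the imaginary axis, and Schwarz--Pick carries the bounds from there to the whole
  half-plane. The same smallness, made arbitrarily strong along an orbit of \<open>F\<close>,
  identifies the roots.\<close>

lemma UHP_open: "open upper_half_plane"
  unfolding upper_half_plane_def by (rule open_halfspace_Im_gt)

lemma UHP_convex: "convex upper_half_plane"
  unfolding upper_half_plane_def by (rule convex_halfspace_Im_gt)

lemma UHP_iff [simp]: "z \<in> upper_half_plane \<longleftrightarrow> Im z > 0"
  by (simp add: upper_half_plane_def)

text \<open>This identity shows that the Cayley quotient \<open>(z - w) / (z - cnj w)\<close> has
  modulus below 1, and it eliminates the mirrored points from the Schwarz--Pick inequality.\<close>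

lemma cmod_diff_cnj_sq: "(cmod (z - cnj w))\<^sup>2 = (cmod (z - w))\<^sup>2 + 4 * Im z * Im w"
  unfolding cmod_power2 by (simp add: power2_eq_square algebra_simps)

text \<open>The Schwarz lemma in Cayley coordinates: \<open>\<tau>\<close> maps the disc to the
  half-plane with \<open>0\<close> going to \<open>w\<close>, and the Cayley map centred at
  \<open>H w\<close> leads back, so \<open>\<phi>\<close> is a self-map of the disc fixing
  \<open>0\<close>. After squaring, the term \<open>|H z - H w|^2 |z - w|^2\<close> occurs on both
  sides and cancels.\<close>

lemma Schwarz_Pick_strict:
  assumes hol: "H holomorphic_on upper_half_plane"
    and pos: "\<And>z. Im z > 0 \<Longrightarrow> Im (H z) > 0"
    and z: "Im z > 0" and w: "Im w > 0"
  shows "(cmod (H z - H w))\<^sup>2 * (Im z * Im w) \<le> Im (H z) * Im (H w) * (cmod (z - w))\<^sup>2"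
proof -
  define \<tau> where "\<tau> \<zeta> = (w - cnj w * \<zeta>) / (1 - \<zeta>)" for \<zeta>
  define \<phi> where "\<phi> \<zeta> = (H (\<tau> \<zeta>) - H w) / (H (\<tau> \<zeta>) - cnj (H w))" for \<zeta>
  have \<tau>: "Im (\<tau> \<zeta>) > 0" if "norm \<zeta> < 1" for \<zeta>
  proof -
    have n1: "1 - \<zeta> \<noteq> 0" using that by auto
    have "Im (\<tau> \<zeta>) = Im ((w - cnj w * \<zeta>) * cnj (1 - \<zeta>)) / (cmod (1 - \<zeta>))\<^sup>2"
      unfolding \<tau>_def by (subst complex_div_cnj) (simp add: Im_divide_of_real flip: of_real_power)
    also have "Im ((w - cnj w * \<zeta>) * cnj (1 - \<zeta>)) = Im w * (1 - (cmod \<zeta>)\<^sup>2)"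
      unfolding cmod_power2 by (simp add: power2_eq_square algebra_simps)
    finally show ?thesis
      using n1 w that by (simp add: power_less_one_iff abs_square_less_1)
  qed
  have ne: "H u - cnj (H v) \<noteq> 0" if "Im u > 0" "Im v > 0" for u v
    using pos[OF that(1)] pos[OF that(2)] by (auto simp: complex_eq_iff)
  have lt1: "norm (\<phi> \<zeta>) < 1" if "norm \<zeta> < 1" for \<zeta>
  proof -
    have "(cmod (H (\<tau> \<zeta>) - H w))\<^sup>2 < (cmod (H (\<tau> \<zeta>) - cnj (H w)))\<^sup>2"
      using pos[OF \<tau>[OF that]] pos[OF w] by (simp add: cmod_diff_cnj_sq)
    then show ?thesis
      using ne[OF \<tau>[OF that] w] unfolding \<phi>_def norm_divide
      by (simp add: power2_less_imp_less divide_less_eq)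
  qed
  have hol\<tau>: "\<tau> holomorphic_on ball 0 1"
    unfolding \<tau>_def by (intro holomorphic_intros) auto
  have "(H \<circ> \<tau>) holomorphic_on ball 0 1"
    by (rule holomorphic_on_compose_gen[OF hol\<tau> hol]) (use \<tau> in auto)
  then have hol\<phi>: "\<phi> holomorphic_on ball 0 1"
    unfolding \<phi>_def o_def by (intro holomorphic_intros) (use ne \<tau> w in auto)
  have \<phi>0: "\<phi> 0 = 0" by (simp add: \<phi>_def \<tau>_def)
  define \<zeta> where "\<zeta> = (z - w) / (z - cnj w)"
  have nz: "z - cnj w \<noteq> 0" using z w by (auto simp: complex_eq_iff)
  have \<zeta>1: "norm \<zeta> < 1"
  proof -
    have "(cmod (z - w))\<^sup>2 < (cmod (z - cnj w))\<^sup>2"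
      using z w by (simp add: cmod_diff_cnj_sq)
    then show ?thesis
      using nz unfolding \<zeta>_def norm_divide by (simp add: power2_less_imp_less divide_less_eq)
  qed
  have "\<tau> \<zeta> = z"
  proof -
    have "w - cnj w \<noteq> 0" using w by (auto simp: complex_eq_iff)
    moreover have "1 - \<zeta> = (w - cnj w) / (z - cnj w)" using nz by (simp add: \<zeta>_def field_simps)
    moreover have "w - cnj w * \<zeta> = z * (w - cnj w) / (z - cnj w)"
      using nz by (simp add: \<zeta>_def field_simps)
    ultimately show ?thesis unfolding \<tau>_def using nz by simp
  qed
  then have "norm (\<phi> \<zeta>) = cmod (H z - H w) / cmod (H z - cnj (H w))"
    by (simp add: \<phi>_def norm_divide)
  with Schwarz_Lemma(1)[OF hol\<phi> \<phi>0 lt1 \<zeta>1]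
  have "cmod (H z - H w) / cmod (H z - cnj (H w)) \<le> cmod (z - w) / cmod (z - cnj w)"
    by (simp add: \<zeta>_def norm_divide)
  then have "cmod (H z - H w) * cmod (z - cnj w) \<le> cmod (z - w) * cmod (H z - cnj (H w))"
    using nz ne[OF z w] by (simp add: field_simps)
  then have "(cmod (H z - H w))\<^sup>2 * (cmod (z - cnj w))\<^sup>2 \<le> (cmod (z - w))\<^sup>2 * (cmod (H z - cnj (H w)))\<^sup>2"
    by (metis norm_ge_zero mult_nonneg_nonneg power_mono power_mult_distrib)
  then show ?thesis
    unfolding cmod_diff_cnj_sq by (simp add: algebra_simps)
qed

text \<open>Displacements and limits may take real values, so \<open>H\<close> is shifted up by
  \<open>e > 0\<close> and \<open>e\<close> tends to \<open>0\<close>. In this closed form a zero of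
  the imaginary part at one point forces \<open>H\<close> to be constant, a consequence used
  repeatedly.\<close>

theorem Schwarz_Pick_half_plane:
  assumes hol: "H holomorphic_on upper_half_plane"
    and pos: "\<And>z. Im z > 0 \<Longrightarrow> Im (H z) \<ge> 0"
    and z: "Im z > 0" and w: "Im w > 0"
  shows "(cmod (H z - H w))\<^sup>2 * (Im z * Im w) \<le> Im (H z) * Im (H w) * (cmod (z - w))\<^sup>2"
proof (rule tendsto_lowerbound)
  let ?R = "\<lambda>e. (Im (H z) + e) * (Im (H w) + e) * (cmod (z - w))\<^sup>2"
  show "(?R \<longlongrightarrow> Im (H z) * Im (H w) * (cmod (z - w))\<^sup>2) (at_right 0)"
    by (auto intro!: tendsto_eq_intros)
  show "\<forall>\<^sub>F e in at_right 0. (cmod (H z - H w))\<^sup>2 * (Im z * Im w) \<le> ?R e"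
  proof (rule eventually_at_rightI[of 0 1])
    fix e :: real assume "e \<in> {0<..<1}"
    then have e: "e > 0" by simp
    have "(\<lambda>z. H z + \<i> * e) holomorphic_on upper_half_plane"
      by (intro holomorphic_intros hol)
    from Schwarz_Pick_strict[OF this _ z w]
    show "(cmod (H z - H w))\<^sup>2 * (Im z * Im w) \<le> ?R e"
      using e pos by (simp add: add_nonneg_pos)
  qed simp
qed simp

text \<open>The Schwarz--Pick inequality is used through \<open>\<kappa> = |z - w| / sqrt (Im z * Im w)\<close>, which is
  \<open>2 sinh (d / 2)\<close> for the hyperbolic distance \<open>d\<close>.\<close>

lemma half_plane_Harnack:
  assumes hol: "H holomorphic_on upper_half_plane"
    and pos: "\<And>z. Im z > 0 \<Longrightarrow> Im (H z) \<ge> 0"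
    and z: "Im z > 0" and w: "Im w > 0"
    and k: "(cmod (z - w))\<^sup>2 \<le> \<kappa>\<^sup>2 * (Im z * Im w)" "\<kappa> \<ge> 0"
  shows "sqrt (Im (H w)) \<le> (1 + \<kappa>) * sqrt (Im (H z))"
    and "cmod (H w - H z) \<le> \<kappa> * (sqrt (Im (H z)) * sqrt (Im (H w)))"
    and "cmod (H w - H z) \<le> \<kappa> * (1 + \<kappa>) * Im (H z)"
    and "Im (H w) \<le> (1 + \<kappa>)\<^sup>2 * Im (H z)"
proof -
  define a where "a = sqrt (Im (H z))"
  define b where "b = sqrt (Im (H w))"
  have ab: "a \<ge> 0" "b \<ge> 0" "Im (H z) = a\<^sup>2" "Im (H w) = b\<^sup>2"
    using pos[OF z] pos[OF w] by (auto simp: a_def b_def)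
  have zw: "Im z * Im w > 0" using z w by simp
  have "(cmod (H z - H w))\<^sup>2 * (Im z * Im w) \<le> a\<^sup>2 * b\<^sup>2 * (cmod (z - w))\<^sup>2"
    using Schwarz_Pick_half_plane[OF hol pos z w] ab by simp
  also have "\<dots> \<le> a\<^sup>2 * b\<^sup>2 * (\<kappa>\<^sup>2 * (Im z * Im w))"
    by (intro mult_left_mono k) auto
  finally have "(cmod (H z - H w))\<^sup>2 \<le> (\<kappa> * (a * b))\<^sup>2"
    using mult_le_cancel_right_pos[OF zw, of "(cmod (H z - H w))\<^sup>2" "(\<kappa> * (a * b))\<^sup>2"]
    by (simp add: power_mult_distrib mult_ac)
  then have d: "cmod (H w - H z) \<le> \<kappa> * (a * b)"
    using ab k by (subst norm_minus_commute) (auto intro: power2_le_imp_le)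
  show "cmod (H w - H z) \<le> \<kappa> * (sqrt (Im (H z)) * sqrt (Im (H w)))"
    using d by (simp add: a_def b_def)
  \<comment> \<open>A quadratic inequality for \<open>b / a\<close>; its larger root
    \<open>(\<kappa> + sqrt (\<kappa>^2 + 4)) / 2\<close> is at most
    \<open>1 + \<kappa>\<close>.\<close>
  have "b\<^sup>2 - a\<^sup>2 \<le> \<kappa> * (a * b)"
    using d abs_Im_le_cmod[of "H w - H z"] ab by simp
  have le: "b \<le> (1 + \<kappa>) * a"
  proof (rule ccontr)
    assume "\<not> b \<le> (1 + \<kappa>) * a"
    then have c: "b - \<kappa> * a > a" by (simp add: algebra_simps)
    then have "b > a" using k(2) ab(1) by (smt (verit) mult_nonneg_nonneg)
    then have "b * (b - \<kappa> * a) > a * a"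
      using c ab by (smt (verit) mult_strict_mono mult_less_cancel_left_pos mult_mono)
    with \<open>b\<^sup>2 - a\<^sup>2 \<le> \<kappa> * (a * b)\<close> show False
      by (simp add: power2_eq_square algebra_simps)
  qed
  then show "sqrt (Im (H w)) \<le> (1 + \<kappa>) * sqrt (Im (H z))" by (simp add: a_def b_def)
  have "\<kappa> * (a * b) \<le> \<kappa> * (a * ((1 + \<kappa>) * a))"
    using le ab k by (intro mult_left_mono) auto
  with d show "cmod (H w - H z) \<le> \<kappa> * (1 + \<kappa>) * Im (H z)"
    using ab by (simp add: power2_eq_square mult_ac)
  have "b\<^sup>2 \<le> ((1 + \<kappa>) * a)\<^sup>2" using le ab by (intro power_mono)
  then show "Im (H w) \<le> (1 + \<kappa>)\<^sup>2 * Im (H z)"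
    using ab by (simp add: power_mult_distrib)
qed

section \<open>Orbits of maps increasing the imaginary part\<close>

definition Im_increasing :: "(complex \<Rightarrow> complex) \<Rightarrow> bool" where
  "Im_increasing f \<longleftrightarrow> f holomorphic_on upper_half_plane \<and> (\<forall>z. Im z > 0 \<longrightarrow> Im z \<le> Im (f z))"

lemma Im_increasingD:
  assumes "Im_increasing f"
  shows "f holomorphic_on upper_half_plane" "Im z > 0 \<Longrightarrow> Im z \<le> Im (f z)" "Im z > 0 \<Longrightarrow> Im (f z) > 0"
  using assms by (auto simp: Im_increasing_def intro: less_le_trans)

lemma Im_increasing_id: "Im_increasing (\<lambda>z. z)"
  by (auto simp: Im_increasing_def)

lemma Im_increasing_comp:
  assumes f: "Im_increasing f" and g: "Im_increasing g"
  shows "Im_increasing (\<lambda>z. f (g z))"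
proof -
  have "(f \<circ> g) holomorphic_on upper_half_plane"
    using Im_increasingD[OF f] Im_increasingD[OF g]
    by (intro holomorphic_on_compose_gen) auto
  moreover have "Im z \<le> Im (f (g z))" if "Im z > 0" for z
    using Im_increasingD[OF f] Im_increasingD[OF g] that by (meson order_trans)
  ultimately show ?thesis by (auto simp: Im_increasing_def o_def)
qed

lemma Im_increasing_funpow:
  assumes "Im_increasing f" shows "Im_increasing (f ^^ n)"
proof (induction n)
  case 0 then show ?case using Im_increasing_id by (simp add: id_def)
next
  case (Suc n) then show ?case using Im_increasing_comp[OF assms Suc] by (simp add: o_def)
qed

text \<open>Schwarz--Pick for \<open>f\<close> itself only gives contraction. The displacement is
  again a map into the closed half-plane, and applying the inequality to its multiples compares a
  generator at different points.\<close>

lemma Im_increasing_displacement: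
  assumes "Im_increasing f"
  shows "(\<lambda>z. f z - z) holomorphic_on upper_half_plane" "Im z > 0 \<Longrightarrow> Im (f z - z) \<ge> 0"
  using Im_increasingD[OF assms] by (auto intro!: holomorphic_intros)

lemma Im_increasing_contraction:
  assumes f: "Im_increasing f" and z: "Im z > 0" and w: "Im w > 0"
  shows "(cmod (f z - f w))\<^sup>2 * (Im z * Im w) \<le> Im (f z) * Im (f w) * (cmod (z - w))\<^sup>2"
  using Im_increasingD[OF f] by (intro Schwarz_Pick_half_plane z w) (auto intro: less_imp_le)

lemma funpow_Im_mono:
  assumes f: "Im_increasing f" and z: "Im z > 0" and ij: "i \<le> j"
  shows "Im ((f ^^ i) z) \<le> Im ((f ^^ j) z)" "Im ((f ^^ i) z) > 0"
proof -
  have pos: "Im ((f ^^ i) z) > 0" for i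
    using Im_increasingD(3)[OF Im_increasing_funpow[OF f] z] .
  then show "Im ((f ^^ i) z) > 0" .
  have "(f ^^ j) z = (f ^^ (j - i)) ((f ^^ i) z)"
    using ij by (simp flip: funpow_add[THEN fun_cong, unfolded o_def])
  then show "Im ((f ^^ i) z) \<le> Im ((f ^^ j) z)"
    using Im_increasingD(2)[OF Im_increasing_funpow[OF f] pos] by simp
qed

text \<open>Averaging the Schwarz--Pick inequality for \<open>B = n (f - id)\<close> over all pairs of orbit points bounds
  the fluctuation of \<open>B\<close> along the orbit by its mean imaginary part \<open>V\<close>. When \<open>V\<close> is small compared
  with \<open>Im z\<close>, an orbit from \<open>z\<close> to \<open>(f ^^ n) z\<close> cannot make detours, however large \<open>n\<close> is.\<close>

lemma orbit_estimates:
  fixes n :: nat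
  assumes f: "Im_increasing f" and z: "Im z > 0" and n: "n \<ge> 1"
  defines "V \<equiv> Im ((f ^^ n) z) - Im z" and "l \<equiv> cmod ((f ^^ n) z - z)"
  defines "\<kappa> \<equiv> 2 * l / Im z"
  assumes V: "V \<le> Im z / 2"
  shows "\<And>i j. i \<le> n \<Longrightarrow> j \<le> n \<Longrightarrow> cmod ((f ^^ i) z - (f ^^ j) z) \<le> 2 * l"
    and "cmod (of_nat n * (f z - z) - ((f ^^ n) z - z)) \<le> \<kappa> * (1 + \<kappa>) * V"
    and "Im (of_nat n * (f z - z)) \<le> (1 + \<kappa>)\<^sup>2 * V"
proof -
  define u where "u j = (f ^^ j) z" for j
  define B where "B w = of_nat n * (f w - w)" for w
  define b where "b j = sqrt (Im (B (u j)))" for j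
  \<comment> \<open>The diameter of the orbit. The aim is
    \<open>\<Lambda> \<le> l + \<Lambda> / 2\<close>, which absorbs the detours.\<close>
  define \<Lambda> where "\<Lambda> = Max ((\<lambda>(i, j). cmod (u i - u j)) ` ({..n} \<times> {..n}))"
  have n0: "real n > 0" using n by simp
  have u0: "u 0 = z" and uS: "f (u j) = u (Suc j)" for j by (simp_all add: u_def)
  have yu: "Im z \<le> Im (u j)" "Im (u j) > 0" for j
    using funpow_Im_mono[OF f z, of 0 j] funpow_Im_mono[OF f z, of j j] by (simp_all add: u_def)
  have \<Lambda>: "cmod (u i - u j) \<le> \<Lambda>" if "i \<le> n" "j \<le> n" for i j
    unfolding \<Lambda>_def using that by (intro Max_ge) auto
  have \<Lambda>0: "\<Lambda> \<ge> 0" using \<Lambda>[of 0 0] by simp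
  have holB: "B holomorphic_on upper_half_plane"
    unfolding B_def by (intro holomorphic_on_mult holomorphic_on_const Im_increasing_displacement(1)[OF f])
  have ImB: "Im (B w) \<ge> 0" if "Im w > 0" for w
    using Im_increasing_displacement(2)[OF f that] by (simp add: B_def)
  have b2: "(b j)\<^sup>2 = Im (B (u j))" and b0: "b j \<ge> 0" for j
    using ImB[OF yu(2)] by (simp_all add: b_def)
  \<comment> \<open>Telescoping: the mean of \<open>B\<close> over the orbit is the total
    displacement, hence the mean of \<open>(b j)^2\<close> is \<open>V\<close>.\<close>
  have sumB: "(\<Sum>j<m. B (u j)) = of_nat n * (u m - z)" for m
    unfolding B_def uS sum_distrib_left[symmetric] sum_lessThan_telescope u0 ..
  have sumb2: "(\<Sum>j<n. (b j)\<^sup>2) = n * V"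
    using arg_cong[OF sumB[of n], of Im] by (simp add: b2 V_def u_def)
  have dist: "(cmod (u i - u j))\<^sup>2 \<le> (L / Im z)\<^sup>2 * (Im (u i) * Im (u j))"
    if "cmod (u i - u j) \<le> L" for i j L
  proof -
    have "(cmod (u i - u j))\<^sup>2 \<le> L\<^sup>2" using that by (intro power_mono) auto
    also have "\<dots> = (L / Im z)\<^sup>2 * (Im z * Im z)"
      using z by (simp add: power2_eq_square)
    also have "\<dots> \<le> (L / Im z)\<^sup>2 * (Im (u i) * Im (u j))"
      using z yu by (intro mult_left_mono mult_mono) (auto intro: less_imp_le)
    finally show ?thesis .
  qed
  have har: "cmod (B (u j) - B (u i)) \<le> L / Im z * (b i * b j)" "b j \<le> (1 + L / Im z) * b i"
    if "cmod (u i - u j) \<le> L" for i j L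
  proof -
    have L: "L / Im z \<ge> 0" using z that norm_ge_zero[of "u i - u j"] by (smt (verit) divide_nonneg_pos)
    show "cmod (B (u j) - B (u i)) \<le> L / Im z * (b i * b j)"
      using half_plane_Harnack(2)[OF holB ImB yu(2) yu(2) dist[OF that] L] by (simp add: b_def)
    show "b j \<le> (1 + L / Im z) * b i"
      using half_plane_Harnack(1)[OF holB ImB yu(2) yu(2) dist[OF that] L] by (simp add: b_def)
  qed
  define S where "S = (\<Sum>j<n. cmod (B (u j)))"
  \<comment> \<open>\<open>n * B (u j)\<close> is the telescoping sum plus the deviations of
    \<open>B (u j)\<close> from the other values. Each deviation is at most
    \<open>\<Lambda> / Im z * (b i * b j)\<close>, so their double sum is a square, and
    Cauchy--Schwarz bounds it through \<open>V\<close>.\<close>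
  have S: "S \<le> n * (l + \<Lambda> / 2)"
  proof -
    have "n * S = (\<Sum>j<n. cmod (of_nat n * B (u j)))"
      by (simp add: S_def sum_distrib_left norm_mult)
    also have "\<dots> \<le> (\<Sum>j<n. n * l + (\<Sum>i<n. \<Lambda> / Im z * (b i * b j)))"
    proof (rule sum_mono)
      fix j assume j: "j \<in> {..<n}"
      have "of_nat n * B (u j) = (\<Sum>i<n. B (u i)) + (\<Sum>i<n. B (u j) - B (u i))"
        by (simp add: sum_subtractf)
      also have "cmod \<dots> \<le> cmod (\<Sum>i<n. B (u i)) + (\<Sum>i<n. cmod (B (u j) - B (u i)))"
        by (rule order_trans[OF norm_triangle_ineq add_left_mono[OF norm_sum]])
      also have "cmod (\<Sum>i<n. B (u i)) = n * l"
        unfolding sumB by (simp add: norm_mult l_def u_def)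
      also have "(\<Sum>i<n. cmod (B (u j) - B (u i))) \<le> (\<Sum>i<n. \<Lambda> / Im z * (b i * b j))"
        using j by (intro sum_mono har \<Lambda>) auto
      finally show "cmod (of_nat n * B (u j)) \<le> n * l + (\<Sum>i<n. \<Lambda> / Im z * (b i * b j))" by simp
    qed
    also have "\<dots> = n * n * l + \<Lambda> / Im z * (\<Sum>j<n. b j)\<^sup>2"
      by (simp add: sum.distrib power2_eq_square sum_product sum_distrib_left mult_ac)
    also have "(\<Sum>j<n. b j)\<^sup>2 \<le> n * (n * V)"
      using sum_squared_le_sum_of_squares[of b "{..<n}"] sumb2 by (simp add: mult_ac)
    then have "n * n * l + \<Lambda> / Im z * (\<Sum>j<n. b j)\<^sup>2 \<le> n * n * l + \<Lambda> / Im z * (n * (n * V))"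
      using \<Lambda>0 z by (intro add_left_mono mult_left_mono) auto
    also have "\<dots> = n * (n * (l + \<Lambda> * (V / Im z)))"
      by (simp add: algebra_simps)
    \<comment> \<open>Here \<open>V \<le> Im z / 2\<close> enters: it makes the factor of
      \<open>\<Lambda>\<close> small enough for absorption.\<close>
    also have "\<dots> \<le> n * (n * (l + \<Lambda> * (1/2)))"
      using \<Lambda>0 V z by (intro mult_left_mono add_left_mono) (auto simp: field_simps)
    finally show ?thesis using n0 by simp
  qed
  have step: "cmod (u q - u p) \<le> S / n" if "p \<le> q" "q \<le> n" for p q
  proof -
    have "of_nat n * (u q - u p) = (\<Sum>j=p..<q. B (u j))"
      unfolding B_def uS sum_distrib_left[symmetric] sum_Suc_diff'[OF that(1), of u] ..
    then have "n * cmod (u q - u p) \<le> (\<Sum>j=p..<q. cmod (B (u j)))"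
      by (metis norm_mult norm_of_nat norm_sum)
    also have "\<dots> \<le> S" unfolding S_def using that by (intro sum_mono2) auto
    finally show ?thesis using n0 by (simp add: field_simps)
  qed
  have "\<Lambda> \<in> (\<lambda>(i, j). cmod (u i - u j)) ` ({..n} \<times> {..n})"
    unfolding \<Lambda>_def by (intro Max_in) auto
  then obtain p q where "p \<le> n" "q \<le> n" "\<Lambda> = cmod (u p - u q)" by auto
  then have "\<Lambda> \<le> S / n"
    using step[of p q] step[of q p] by (cases "p \<le> q") (auto simp: norm_minus_commute)
  also have "\<dots> \<le> l + \<Lambda> / 2" using S n0 by (simp add: field_simps)
  finally have \<Lambda>l: "\<Lambda> \<le> 2 * l" by simp
  show "cmod ((f ^^ i) z - (f ^^ j) z) \<le> 2 * l" if "i \<le> n" "j \<le> n" for i j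
    using \<Lambda>[OF that] \<Lambda>l by (simp add: u_def)
  have ul: "cmod (u i - u 0) \<le> 2 * l" if "i < n" for i
    using \<Lambda>[of i 0] \<Lambda>l that by simp
  have \<kappa>0: "\<kappa> \<ge> 0" using z by (simp add: \<kappa>_def l_def)
  have b0i: "b 0 \<le> (1 + \<kappa>) * b i" if "i < n" for i
    using har(2)[OF ul[OF that]] by (simp add: \<kappa>_def)
  \<comment> \<open>The averaging is repeated with \<open>z\<close> in place of \<open>u j\<close>.
    With the diameter known, \<open>b 0\<close> is at most \<open>(1 + \<kappa>) * b i\<close>, so
    the deviations average to a multiple of \<open>V\<close>.\<close>
  have "of_nat n * (B z - (u n - z)) = (\<Sum>i<n. B (u 0) - B (u i))"
    by (simp add: sum_subtractf sumB u0 algebra_simps)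
  then have "n * cmod (B z - (u n - z)) \<le> (\<Sum>i<n. cmod (B (u 0) - B (u i)))"
    by (metis norm_mult norm_of_nat norm_sum)
  also have "\<dots> \<le> (\<Sum>i<n. \<kappa> * ((1 + \<kappa>) * (b i)\<^sup>2))"
  proof (rule sum_mono)
    fix i assume i: "i \<in> {..<n}"
    have "cmod (B (u 0) - B (u i)) \<le> \<kappa> * (b i * b 0)"
      using har(1)[OF ul] i by (simp add: \<kappa>_def)
    also have "\<dots> \<le> \<kappa> * (b i * ((1 + \<kappa>) * b i))"
      using b0i i \<kappa>0 b0 by (intro mult_left_mono) auto
    finally show "cmod (B (u 0) - B (u i)) \<le> \<kappa> * ((1 + \<kappa>) * (b i)\<^sup>2)"
      by (simp add: power2_eq_square mult_ac)
  qed
  also have "\<dots> = n * (\<kappa> * (1 + \<kappa>) * V)"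
    unfolding sum_distrib_left[symmetric] sumb2 by simp
  finally show "cmod (of_nat n * (f z - z) - ((f ^^ n) z - z)) \<le> \<kappa> * (1 + \<kappa>) * V"
    using n0 by (simp add: B_def u_def)
  have "n * (b 0)\<^sup>2 \<le> (\<Sum>i<n. (1 + \<kappa>)\<^sup>2 * (b i)\<^sup>2)"
  proof -
    have "(b 0)\<^sup>2 \<le> (1 + \<kappa>)\<^sup>2 * (b i)\<^sup>2" if "i < n" for i
      using power_mono[OF b0i[OF that] b0, of 2] by (simp add: power_mult_distrib)
    then have "(\<Sum>i<n. (b 0)\<^sup>2) \<le> (\<Sum>i<n. (1 + \<kappa>)\<^sup>2 * (b i)\<^sup>2)" by (intro sum_mono) auto
    then show ?thesis by simp
  qed
  also have "\<dots> = n * ((1 + \<kappa>)\<^sup>2 * V)"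
    unfolding sum_distrib_left[symmetric] sumb2 by simp
  finally show "Im (of_nat n * (f z - z)) \<le> (1 + \<kappa>)\<^sup>2 * V"
    using n0 b2[of 0] by (simp add: B_def u0)
qed

section \<open>Maps normalised at infinity, and bounds uniform over their roots\<close>

definition F_class :: "(complex \<Rightarrow> complex) \<Rightarrow> bool" where
  "F_class f \<longleftrightarrow> Im_increasing f \<and>
     ((\<lambda>y. (f (\<i> * complex_of_real y) - \<i> * complex_of_real y) / complex_of_real y) \<longlongrightarrow> 0) at_top"

definition iter_root :: "nat \<Rightarrow> (complex \<Rightarrow> complex) \<Rightarrow> (complex \<Rightarrow> complex) \<Rightarrow> bool" where
  "iter_root n F f \<longleftrightarrow> n \<ge> 1 \<and> Im_increasing f \<and> (\<forall>z. Im z > 0 \<longrightarrow> (f ^^ n) z = F z)"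

lemma F_classD: "F_class f \<Longrightarrow> Im_increasing f"
  by (simp add: F_class_def)

lemma F_class_small:
  assumes "F_class f" "e > 0"
  obtains Y where "Y > 0" "\<And>y. y \<ge> Y \<Longrightarrow> cmod (f (\<i> * complex_of_real y) - \<i> * complex_of_real y) \<le> e * y"
proof -
  have "\<forall>\<^sub>F y in at_top. norm ((f (\<i> * complex_of_real y) - \<i> * complex_of_real y) / complex_of_real y) < e"
    using assms unfolding F_class_def tendsto_iff dist_norm by auto
  then obtain Y where Y: "\<And>y. y \<ge> Y \<Longrightarrow> norm ((f (\<i> * complex_of_real y) - \<i> * complex_of_real y) / complex_of_real y) < e"
    unfolding eventually_at_top_linorder by blast
  have "cmod (f (\<i> * complex_of_real y) - \<i> * complex_of_real y) \<le> e * y" if "y \<ge> max Y 1" for y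
    using Y[of y] that by (simp add: norm_divide divide_less_eq split: if_splits)
  then show thesis using that[of "max Y 1"] by auto
qed

lemma F_classI:
  assumes "Im_increasing f"
    and "\<And>e. e > 0 \<Longrightarrow> \<exists>Y>0. \<forall>y\<ge>Y. cmod (f (\<i> * complex_of_real y) - \<i> * complex_of_real y) \<le> e * y"
  shows "F_class f"
  unfolding F_class_def tendsto_iff dist_norm
proof (intro conjI allI impI assms)
  fix e :: real assume "e > 0"
  then obtain Y where Y: "Y > 0" "\<And>y. y \<ge> Y \<Longrightarrow> cmod (f (\<i> * complex_of_real y) - \<i> * complex_of_real y) \<le> e / 2 * y"
    using assms(2)[of "e / 2"] by auto
  show "\<forall>\<^sub>F y in at_top. norm ((f (\<i> * complex_of_real y) - \<i> * complex_of_real y) / complex_of_real y - 0) < e"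
    unfolding eventually_at_top_linorder
  proof (intro exI allI impI)
    fix y assume "Y \<le> y"
    then have "cmod (f (\<i> * complex_of_real y) - \<i> * complex_of_real y) \<le> e / 2 * y" "y > 0"
      using Y by auto
    moreover have "e / 2 * y < e * y" using \<open>e > 0\<close> \<open>y > 0\<close> by simp
    ultimately show "norm ((f (\<i> * complex_of_real y) - \<i> * complex_of_real y) / complex_of_real y - 0) < e"
      by (simp add: norm_divide divide_less_eq)
  qed
qed

lemma F_class_cong:
  assumes "F_class f" "\<And>z. Im z > 0 \<Longrightarrow> g z = f z"
  shows "F_class g"
proof (rule F_classI)
  have "g holomorphic_on upper_half_plane"
    using Im_increasingD(1)[OF F_classD[OF assms(1)]] assms(2)
    by (subst holomorphic_cong[OF refl, of _ g f]) auto
  then show "Im_increasing g"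
    using Im_increasingD(2)[OF F_classD[OF assms(1)]] assms(2) by (auto simp: Im_increasing_def)
  show "\<exists>Y>0. \<forall>y\<ge>Y. cmod (g (\<i> * complex_of_real y) - \<i> * complex_of_real y) \<le> e * y" if e: "e > 0" for e
  proof -
    obtain Y where "Y > 0" "\<And>y. y \<ge> Y \<Longrightarrow> cmod (f (\<i> * complex_of_real y) - \<i> * complex_of_real y) \<le> e * y"
      using F_class_small[OF assms(1) e] by blast
    then show ?thesis using assms(2) by (intro exI[of _ Y]) auto
  qed
qed

lemma F_class_id: "F_class (\<lambda>z. z)"
  by (rule F_classI[OF Im_increasing_id]) (auto intro!: exI[of _ 1])

text \<open>The point \<open>g (\<i> y)\<close> may leave the imaginary axis, but it lies within
  distance \<open>y\<close> of \<open>\<i> y\<close>, which is the case \<open>\<kappa> = 1\<close>.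
  So the displacement of \<open>f\<close> there differs from that at \<open>\<i> y\<close> by at
  most twice the imaginary part of the latter. The shares of \<open>e\<close> are
  \<open>2/4 + 1/4 + 1/4\<close>.\<close>

lemma F_class_comp:
  assumes f: "F_class f" and g: "F_class g"
  shows "F_class (\<lambda>z. f (g z))"
proof (rule F_classI)
  note f' = F_classD[OF f] and g' = F_classD[OF g]
  show "Im_increasing (\<lambda>z. f (g z))" by (rule Im_increasing_comp[OF f' g'])
  fix e :: real assume e: "e > 0"
  let ?z = "\<lambda>y::real. \<i> * complex_of_real y"
  obtain Yf where Yf: "Yf > 0" "\<And>y. y \<ge> Yf \<Longrightarrow> cmod (f (?z y) - ?z y) \<le> e / 4 * y"
    using F_class_small[OF f, of "e / 4"] e by auto
  obtain Yg where Yg: "Yg > 0" "\<And>y. y \<ge> Yg \<Longrightarrow> cmod (g (?z y) - ?z y) \<le> min 1 (e / 4) * y"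
    using F_class_small[OF g, of "min 1 (e / 4)"] e by auto
  show "\<exists>Y>0. \<forall>y\<ge>Y. cmod (f (g (?z y)) - ?z y) \<le> e * y"
  proof (intro exI[of _ "max Yf Yg"] conjI allI impI)
    show "max Yf Yg > 0" using Yf by simp
    fix y assume y: "max Yf Yg \<le> y"
    then have y0: "y > 0" using Yf by simp
    have fy: "cmod (f (?z y) - ?z y) \<le> e / 4 * y" using Yf y by simp
    have gy: "cmod (g (?z y) - ?z y) \<le> y" "cmod (g (?z y) - ?z y) \<le> e / 4 * y"
      using Yg(2)[of y] y y0 mult_right_mono[of "min 1 (e / 4)" 1 y] mult_right_mono[of "min 1 (e / 4)" "e / 4" y]
      by linarith+
    have ig: "Im (g (?z y)) \<ge> y" using Im_increasingD(2)[OF g', of "?z y"] y0 by simp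
    have "(cmod (?z y - g (?z y)))\<^sup>2 \<le> y\<^sup>2"
      using gy(1) by (intro power_mono) (auto simp: norm_minus_commute)
    also have "\<dots> \<le> 1\<^sup>2 * (Im (?z y) * Im (g (?z y)))"
      using ig y0 by (simp add: power2_eq_square)
    finally have "cmod ((f (g (?z y)) - g (?z y)) - (f (?z y) - ?z y)) \<le> 1 * (1 + 1) * Im (f (?z y) - ?z y)"
      using half_plane_Harnack(3)[OF Im_increasing_displacement[OF f'], of "?z y" "g (?z y)" 1] y0 ig by auto
    also have "\<dots> \<le> 2 * (e / 4 * y)"
      using order_trans[OF order_trans[OF abs_ge_self abs_Im_le_cmod] fy] by simp
    finally have "cmod ((f (g (?z y)) - g (?z y)) - (f (?z y) - ?z y)) \<le> e / 2 * y" by simp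
    then have "cmod ((f (g (?z y)) - g (?z y)) - (f (?z y) - ?z y)) + (cmod (f (?z y) - ?z y) + cmod (g (?z y) - ?z y)) \<le> e * y"
      using fy gy(2) by (simp add: field_simps)
    moreover have "f (g (?z y)) - ?z y = ((f (g (?z y)) - g (?z y)) - (f (?z y) - ?z y)) + ((f (?z y) - ?z y) + (g (?z y) - ?z y))"
      by simp
    ultimately show "cmod (f (g (?z y)) - ?z y) \<le> e * y"
      using order_trans[OF norm_triangle_ineq add_left_mono[OF norm_triangle_ineq]] by (metis order_trans)
  qed
qed

text \<open>Supplies the points where \<open>F\<close> is close to the identity relative to the
  height, so that \<open>orbit_estimates\<close> applies to every root.\<close>

lemma F_class_base:
  assumes "F_class F" "e > 0"
  obtains z where "Im z > 0" "cmod (F z - z) \<le> e * Im z"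
proof -
  obtain Y where "Y > 0" "\<And>y. y \<ge> Y \<Longrightarrow> cmod (F (\<i> * complex_of_real y) - \<i> * complex_of_real y) \<le> e * y"
    using F_class_small[OF assms] by blast
  then show thesis using that[of "\<i> * complex_of_real Y"] by simp
qed

text \<open>At a point \<open>z\<close> high on the imaginary axis the orbit stays within
  \<open>2 |F z - z|\<close> of \<open>z\<close>. Schwarz--Pick for the \<open>j\<close>-th iterate
  transfers this to \<open>w\<close>; the heights involved are at most those of \<open>F w\<close>
  and \<open>F z\<close>, because imaginary parts increase along orbits. Hence the radius depends on
  \<open>F\<close> and \<open>w\<close> only.\<close>

lemma root_orbit_bounded:
  assumes F: "F_class F" and w: "Im w > 0"
  obtains R where "\<And>n f j. iter_root n F f \<Longrightarrow> j \<le> n \<Longrightarrow> cmod ((f ^^ j) w) \<le> R"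
proof -
  obtain z where z: "Im z > 0" "cmod (F z - z) \<le> 1 / 2 * Im z"
    using F_class_base[OF F, of "1/2"] by auto
  define R where "R = cmod z + 2 * cmod (F z - z) + sqrt (Im (F w) * Im (F z) * (cmod (w - z))\<^sup>2 / (Im w * Im z))"
  have "cmod ((f ^^ j) w) \<le> R" if r: "iter_root n F f" and j: "j \<le> n" for n f j
  proof -
    have f: "Im_increasing f" and n: "n \<ge> 1" and fn: "\<And>z. Im z > 0 \<Longrightarrow> (f ^^ n) z = F z"
      using r by (auto simp: iter_root_def)
    have "Im (F z) - Im z \<le> Im z / 2" using z abs_Im_le_cmod[of "F z - z"] by simp
    then have 1: "cmod ((f ^^ j) z - z) \<le> 2 * cmod (F z - z)"
      using orbit_estimates(1)[OF f z(1) n, of j 0] fn z j by simp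
    have "(cmod ((f ^^ j) w - (f ^^ j) z))\<^sup>2 * (Im w * Im z)
        \<le> Im ((f ^^ j) w) * Im ((f ^^ j) z) * (cmod (w - z))\<^sup>2"
      by (rule Im_increasing_contraction[OF Im_increasing_funpow[OF f] w z(1)])
    also have "\<dots> \<le> Im (F w) * Im (F z) * (cmod (w - z))\<^sup>2"
      using funpow_Im_mono(1)[OF f w j] funpow_Im_mono(1)[OF f z(1) j] funpow_Im_mono(2)[OF f w order.refl, of n]
        funpow_Im_mono(2)[OF f z(1) order.refl, of j] fn[OF w] fn[OF z(1)]
      by (intro mult_right_mono mult_mono) auto
    finally have "(cmod ((f ^^ j) w - (f ^^ j) z))\<^sup>2 \<le> Im (F w) * Im (F z) * (cmod (w - z))\<^sup>2 / (Im w * Im z)"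
      using w z by (simp add: field_simps)
    from real_le_rsqrt[OF this]
    have "cmod ((f ^^ j) w - (f ^^ j) z) \<le> sqrt (Im (F w) * Im (F z) * (cmod (w - z))\<^sup>2 / (Im w * Im z))"
      .
    then show ?thesis
      using 1 norm_triangle_sub[of "(f ^^ j) w" "(f ^^ j) z"] norm_triangle_sub[of "(f ^^ j) z" z]
      unfolding R_def by linarith
  qed
  then show thesis using that by blast
qed

text \<open>At one base point the generator stays within a fixed distance of \<open>F z - z\<close>;
  the Harnack inequality spreads this over \<open>K\<close>, with \<open>m\<close> bounding the
  parameter \<open>\<kappa>\<close> between \<open>z\<close> and the points of
  \<open>K\<close>.\<close>

lemma root_generators_bounded:
  assumes F: "F_class F" and K: "compact K" "K \<subseteq> upper_half_plane"
  shows "\<exists>B. \<forall>n f. iter_root n F f \<longrightarrow> (\<forall>w\<in>K. cmod (of_nat n * (f w - w)) \<le> B)"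
proof -
  obtain z where z: "Im z > 0" "cmod (F z - z) \<le> 1 / 2 * Im z"
    using F_class_base[OF F, of "1/2"] by auto
  define \<kappa> where "\<kappa> = 2 * cmod (F z - z) / Im z"
  define C where "C = cmod (F z - z) + \<kappa> * (1 + \<kappa>) * Im z"
  have \<kappa>0: "\<kappa> \<ge> 0" using z by (simp add: \<kappa>_def)
  have "continuous_on K (\<lambda>w. cmod (z - w) / sqrt (Im z * Im w))"
    using K(2) z by (intro continuous_intros) auto
  from compact_imp_bounded[OF compact_continuous_image[OF this K(1)]]
  obtain k where "\<forall>x\<in>(\<lambda>w. cmod (z - w) / sqrt (Im z * Im w)) ` K. \<bar>x\<bar> \<le> k"
    unfolding bounded_real by blast
  then have k: "cmod (z - w) / sqrt (Im z * Im w) \<le> k" if "w \<in> K" for w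
    using that by (meson abs_le_D1 imageI)
  define m where "m = max k 0"
  have "cmod (of_nat n * (f w - w)) \<le> C + m * (1 + m) * C" if r: "iter_root n F f" and w: "w \<in> K" for n f w
  proof -
    have f: "Im_increasing f" and n: "n \<ge> 1" and fn: "\<And>z. Im z > 0 \<Longrightarrow> (f ^^ n) z = F z"
      using r by (auto simp: iter_root_def)
    define B where "B w = of_nat n * (f w - w)" for w
    have w0: "Im w > 0" using w K by auto
    have holB: "B holomorphic_on upper_half_plane"
      unfolding B_def by (intro holomorphic_on_mult holomorphic_on_const Im_increasing_displacement(1)[OF f])
    have ImB: "Im (B w) \<ge> 0" if "Im w > 0" for w
      using Im_increasing_displacement(2)[OF f that] by (simp add: B_def)
    have V: "Im (F z) - Im z \<le> Im z / 2" using z abs_Im_le_cmod[of "F z - z"] by simp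
    have "cmod (B z - (F z - z)) \<le> \<kappa> * (1 + \<kappa>) * (Im (F z) - Im z)"
      using orbit_estimates(2)[OF f z(1) n] fn[OF z(1)] V by (simp add: \<kappa>_def B_def)
    also have "\<dots> \<le> \<kappa> * (1 + \<kappa>) * Im z"
      using V z \<kappa>0 by (intro mult_left_mono) auto
    finally have Bz: "cmod (B z) \<le> C"
      using norm_triangle_ineq[of "B z - (F z - z)" "F z - z"] by (simp add: C_def)
    have m: "m \<ge> 0" "cmod (z - w) / sqrt (Im z * Im w) \<le> m" using k[OF w] by (auto simp: m_def)
    then have "cmod (z - w) \<le> m * sqrt (Im z * Im w)"
      using z w0 by (simp add: field_simps)
    then have "(cmod (z - w))\<^sup>2 \<le> m\<^sup>2 * (Im z * Im w)"
      using z w0 power_mono[of "cmod (z - w)" "m * sqrt (Im z * Im w)" 2] by (simp add: power_mult_distrib)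
    from half_plane_Harnack(3)[OF holB ImB z(1) w0 this m(1)]
    have "cmod (B w - B z) \<le> m * (1 + m) * Im (B z)" .
    also have "\<dots> \<le> m * (1 + m) * C"
      using m Bz abs_Im_le_cmod[of "B z"] by (intro mult_left_mono) auto
    finally show ?thesis
      using norm_triangle_ineq[of "B w - B z" "B z"] Bz by (simp add: B_def)
  qed
  then show ?thesis by blast
qed

lemma root_generator_limit:
  fixes f :: "nat \<Rightarrow> complex \<Rightarrow> complex"
  assumes F: "F_class F" and f: "\<And>n. iter_root (Suc n) F (f n)"
  obtains A r where "A holomorphic_on upper_half_plane" "strict_mono r"
    "\<And>z. Im z > 0 \<Longrightarrow> (\<lambda>n. of_nat (Suc (r n)) * (f (r n) z - z)) \<longlonglongrightarrow> A z"
    "\<And>K. compact K \<Longrightarrow> K \<subseteq> upper_half_plane \<Longrightarrow>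
       uniform_limit K (\<lambda>n z. of_nat (Suc (r n)) * (f (r n) z - z)) A sequentially"
proof -
  define G where "G n z = of_nat (Suc n) * (f n z - z)" for n z
  have hol: "G n holomorphic_on upper_half_plane" for n
    unfolding G_def using f[of n]
    by (intro holomorphic_on_mult holomorphic_on_const Im_increasing_displacement(1)) (auto simp: iter_root_def)
  have bd: "\<exists>B. \<forall>h \<in> range G. \<forall>z \<in> K. norm (h z) \<le> B" if "compact K" "K \<subseteq> upper_half_plane" for K
    using root_generators_bounded[OF F that] f unfolding G_def by blast
  show thesis
  proof (rule Montel[OF UHP_open _ bd order.refl])
    fix A r assume "A holomorphic_on upper_half_plane" "strict_mono r"
      and lim: "\<And>x. x \<in> upper_half_plane \<Longrightarrow> (\<lambda>n. G (r n) x) \<longlonglongrightarrow> A x"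
      and unif: "\<And>K. \<lbrakk>compact K; K \<subseteq> upper_half_plane\<rbrakk> \<Longrightarrow> uniform_limit K (G \<circ> r) A sequentially"
    then show thesis
      using that[of A r] lim[unfolded G_def] unif[unfolded G_def o_def]
      by (simp del: of_nat_Suc)
  qed (use hol in auto)
qed

section \<open>The Koenigs function\<close>

text \<open>The mean value inequality for \<open>h x - c * x\<close>. With \<open>c\<close> the
  derivative at an end point it compares an increment with its linear part; with
  \<open>c = 0\<close> it is a plain length estimate.\<close>

lemma segment_derivative_estimate:
  fixes h :: "complex \<Rightarrow> complex"
  assumes "\<And>x. x \<in> closed_segment a b \<Longrightarrow> (h has_field_derivative q x) (at x)"
    and "\<And>x. x \<in> closed_segment a b \<Longrightarrow> cmod (q x - c) \<le> e"
  shows "cmod (h b - h a - c * (b - a)) \<le> e * cmod (b - a)"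
proof -
  have "cmod ((h b - c * b) - (h a - c * a)) \<le> e * cmod (b - a)"
  proof (rule field_differentiable_bound[of "closed_segment a b" "\<lambda>x. h x - c * x" "\<lambda>x. q x - c"])
    fix x assume "x \<in> closed_segment a b"
    note has_field_derivative_at_within[OF assms(1)[OF this]]
    then show "((\<lambda>x. h x - c * x) has_field_derivative q x - c) (at x within closed_segment a b)"
      by (auto intro!: derivative_eq_intros)
  qed (use assms(2) in auto)
  then show ?thesis by (simp add: algebra_simps)
qed

lemma inj_on_reciprocal_primitive:
  assumes hol: "A holomorphic_on upper_half_plane"
    and pos: "\<And>z. Im z > 0 \<Longrightarrow> Im (A z) \<ge> 0" and nz: "\<And>z. Im z > 0 \<Longrightarrow> A z \<noteq> 0"
    and h: "\<And>z. Im z > 0 \<Longrightarrow> (h has_field_derivative inverse (A z)) (at z)"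
  shows "inj_on h upper_half_plane"
proof (rule inj_onI, rule ccontr)
  fix a b assume ab: "a \<in> upper_half_plane" "b \<in> upper_half_plane" "h a = h b" "a \<noteq> b"
  \<comment> \<open>A rotation that keeps the real part of the derivative away from
    \<open>0\<close>: if \<open>Im (A z) = 0\<close> somewhere, then \<open>A\<close> is a real
    nonzero constant; otherwise \<open>Im (A z) > 0\<close> everywhere and \<open>\<i> / A\<close>
    has positive real part.\<close>
  define s where "s = (if \<exists>z. Im z > 0 \<and> Im (A z) = 0 then 1 else \<i>)"
  have Re_ne: "Re (s * inverse (A z)) \<noteq> 0" if "Im z > 0" for z
  proof (cases "\<exists>z. Im z > 0 \<and> Im (A z) = 0")
    case True
    then obtain c where c: "Im c > 0" "Im (A c) = 0" by blast
    have "A z = A c"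
      using Schwarz_Pick_half_plane[OF hol pos that c(1)] c that by (simp add: mult_le_0_iff)
    then show ?thesis
      using c nz[OF c(1)] True by (auto simp: s_def complex_eq_iff Re_divide power2_eq_square)
  next
    case False
    then have "Im (A z) > 0" using that pos[OF that] by (metis order_le_less)
    then show ?thesis using False by (auto simp: s_def complex_eq_iff)
  qed
  have seg: "Im z > 0" if "z \<in> closed_segment a b" for z
    using closed_segment_subset[OF ab(1,2) UHP_convex] that by auto
  \<comment> \<open>Dividing by \<open>b - a\<close> cancels the direction of the segment, so the
    mean value theorem produces exactly the real part of \<open>s / A u\<close>.\<close>
  have "((\<lambda>z. s * h z / (b - a)) has_field_derivative s * inverse (A z) / (b - a)) (at z)"
    if "z \<in> closed_segment a b" for z
    by (intro DERIV_cdivide DERIV_cmult h seg that)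
  from complex_mvt_line[OF this] obtain u where u: "u \<in> closed_segment a b"
    and "Re (s * h b / (b - a)) - Re (s * h a / (b - a)) = Re (s * inverse (A u) / (b - a) * (b - a))"
    by blast
  with Re_ne[OF seg[OF u]] ab show False by simp
qed

lemma funpow_commute: "(f ^^ n) (f x) = f ((f ^^ n) x)"
  by (simp add: funpow_swap1)

text \<open>The Koenigs function \<open>h\<close> linearizes \<open>F\<close>; its derivative is the reciprocal of the limit \<open>A\<close> of
  the generators \<open>k (f\<^sub>k - id)\<close>.\<close>

lemma koenigs_function:
  fixes f :: "nat \<Rightarrow> complex \<Rightarrow> complex"
  assumes F: "F_class F" and f: "\<And>n. iter_root (Suc n) F (f n)"
    and nid: "\<exists>z. Im z > 0 \<and> F z \<noteq> z"
  obtains A h where "A holomorphic_on upper_half_plane"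
    "\<And>z. Im z > 0 \<Longrightarrow> Im (A z) \<ge> 0" "\<And>z. Im z > 0 \<Longrightarrow> A z \<noteq> 0"
    "\<And>z. Im z > 0 \<Longrightarrow> (h has_field_derivative inverse (A z)) (at z)"
    "\<And>z. Im z > 0 \<Longrightarrow> h (F z) = h z + 1"
    "\<And>z t. Im z > 0 \<Longrightarrow> 0 \<le> t \<Longrightarrow> t \<le> 1 \<Longrightarrow> \<exists>\<zeta>. Im z \<le> Im \<zeta> \<and> h \<zeta> = h z + complex_of_real t \<and>
       (Im (F z) - Im z \<le> Im z / 2 \<longrightarrow> cmod (\<zeta> - z) \<le> 2 * cmod (F z - z))"
    "\<And>z. Im z > 0 \<Longrightarrow> Im (F z) - Im z \<le> Im z / 2 \<Longrightarrow>
       cmod (A z - (F z - z)) \<le> 2 * cmod (F z - z) / Im z * (1 + 2 * cmod (F z - z) / Im z) * (Im (F z) - Im z)"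
    "\<And>z. Im z > 0 \<Longrightarrow> Im (F z) - Im z \<le> Im z / 2 \<Longrightarrow>
       Im (A z) \<le> (1 + 2 * cmod (F z - z) / Im z)\<^sup>2 * (Im (F z) - Im z)"
proof -
  obtain A r where holA: "A holomorphic_on upper_half_plane" and r: "strict_mono r"
    and lim: "\<And>z. Im z > 0 \<Longrightarrow> (\<lambda>n. of_nat (Suc (r n)) * (f (r n) z - z)) \<longlonglongrightarrow> A z"
    and unif: "\<And>K. compact K \<Longrightarrow> K \<subseteq> upper_half_plane \<Longrightarrow>
       uniform_limit K (\<lambda>n z. of_nat (Suc (r n)) * (f (r n) z - z)) A sequentially"
    using root_generator_limit[OF F f] by blast
  define g where "g n = f (r n)" for n
  define k where "k n = Suc (r n)" for n
  define G where "G n z = of_nat (k n) * (g n z - z)" for n z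
  have k1: "k n \<ge> 1" "real (k n) > 0" for n by (simp_all add: k_def)
  have ginc: "Im_increasing (g n)" and gF: "Im z > 0 \<Longrightarrow> (g n ^^ k n) z = F z"
    and groot: "iter_root (k n) F (g n)" for n z
    using f[of "r n"] unfolding iter_root_def g_def k_def by auto
  have klim: "LIM n sequentially. real (k n) :> at_top"
  proof (rule filterlim_at_top_mono[OF filterlim_real_sequentially])
    show "\<forall>\<^sub>F n in sequentially. real n \<le> real (k n)"
      unfolding k_def of_nat_le_iff by (intro always_eventually allI le_SucI seq_suble[OF r])
  qed
  have limG: "(\<lambda>n. G n z) \<longlonglongrightarrow> A z" if "Im z > 0" for z
    using lim[OF that] unfolding G_def g_def k_def .
  have unifG: "uniform_limit K G A sequentially" if "compact K" "K \<subseteq> upper_half_plane" for K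
    using unif[OF that] unfolding G_def g_def k_def .
  have ImG: "Im (G n z) \<ge> 0" if "Im z > 0" for n z
    using Im_increasing_displacement(2)[OF ginc that] by (simp add: G_def)
  have ImA: "Im (A z) \<ge> 0" if "Im z > 0" for z
    using tendsto_lowerbound[OF tendsto_Im[OF limG[OF that]]] ImG[OF that] by simp
  have est: "cmod (G n z - (F z - z)) \<le> 2 * cmod (F z - z) / Im z * (1 + 2 * cmod (F z - z) / Im z) * (Im (F z) - Im z)"
    "Im (G n z) \<le> (1 + 2 * cmod (F z - z) / Im z)\<^sup>2 * (Im (F z) - Im z)"
    if "Im z > 0" "Im (F z) - Im z \<le> Im z / 2" for n z
    using orbit_estimates(2,3)[OF ginc that(1) k1(1), of n n] that(2) unfolding gF[OF that(1)] G_def by auto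
  have estA: "cmod (A z - (F z - z)) \<le> 2 * cmod (F z - z) / Im z * (1 + 2 * cmod (F z - z) / Im z) * (Im (F z) - Im z)"
    if "Im z > 0" "Im (F z) - Im z \<le> Im z / 2" for z
    using tendsto_upperbound[OF tendsto_norm[OF tendsto_diff[OF limG[OF that(1)] tendsto_const]]] est(1)[OF that] by simp
  have estA': "Im (A z) \<le> (1 + 2 * cmod (F z - z) / Im z)\<^sup>2 * (Im (F z) - Im z)"
    if "Im z > 0" "Im (F z) - Im z \<le> Im z / 2" for z
    using tendsto_upperbound[OF tendsto_Im[OF limG[OF that(1)]]] est(2)[OF that] by simp
  define K where "K R w = cball 0 R \<inter> {z. Im w \<le> Im z}" for R w
  have Kc: "compact (K R w)" and Kconv: "convex (K R w)" for R w
    unfolding K_def by (auto intro!: compact_Int_closed closed_halfspace_Im_ge convex_Int convex_halfspace_Im_ge)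
  have KU: "K R w \<subseteq> upper_half_plane" if "Im w > 0" for R w using that by (auto simp: K_def)
  \<comment> \<open>For all \<open>n\<close> at once the orbits stay in one compact convex set,
    inside the half-plane because imaginary parts never drop below \<open>Im w\<close>. Convexity
    also keeps the segments between orbit points there.\<close>
  have orb: "\<exists>R. \<forall>n j. j \<le> k n \<longrightarrow> (g n ^^ j) w \<in> K R w" if w: "Im w > 0" for w
  proof -
    obtain R where "\<And>n f j. iter_root n F f \<Longrightarrow> j \<le> n \<Longrightarrow> cmod ((f ^^ j) w) \<le> R"
      using root_orbit_bounded[OF F w] by blast
    then show ?thesis
      using groot funpow_Im_mono(1)[OF ginc w, of 0] by (intro exI[of _ R]) (auto simp: K_def)
  qed
  \<comment> \<open>A single zero makes \<open>A\<close> vanish identically by Schwarz--Pick. Then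
    the generators become small on the whole orbit of \<open>w\<close>, and their mean
    \<open>F w - w\<close> would be at most half its own modulus.\<close>
  have nz: "A z \<noteq> 0" if z: "Im z > 0" for z
  proof
    assume A0: "A z = 0"
    have Aw: "A w = 0" if "Im w > 0" for w
      using Schwarz_Pick_half_plane[OF holA ImA that z] A0 that z by (simp add: mult_le_0_iff)
    obtain w where w: "Im w > 0" "F w \<noteq> w" using nid by blast
    obtain R where R: "\<And>n j. j \<le> k n \<Longrightarrow> (g n ^^ j) w \<in> K R w" using orb[OF w(1)] by blast
    define e where "e = cmod (F w - w) / 2"
    have e: "e > 0" using w by (simp add: e_def)
    have "\<forall>\<^sub>F n in sequentially. \<forall>z\<in>K R w. dist (G n z) (A z) < e"
      using unifG[OF Kc KU[OF w(1)]] e unfolding uniform_limit_iff by blast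
    then obtain n where n: "\<And>z. z \<in> K R w \<Longrightarrow> dist (G n z) (A z) < e"
      unfolding eventually_sequentially by blast
    have "(\<Sum>j<k n. G n ((g n ^^ j) w)) = of_nat (k n) * (\<Sum>j<k n. (g n ^^ Suc j) w - (g n ^^ j) w)"
      by (simp add: G_def sum_distrib_left)
    also have "\<dots> = of_nat (k n) * (F w - w)"
      using sum_lessThan_telescope[of "\<lambda>j. (g n ^^ j) w" "k n"] gF[OF w(1)] by simp
    finally have "k n * cmod (F w - w) = cmod (\<Sum>j<k n. G n ((g n ^^ j) w))"
      by (simp add: norm_mult)
    also have "\<dots> \<le> (\<Sum>j<k n. e)"
    proof (rule order_trans[OF norm_sum sum_mono])
      fix j assume "j \<in> {..<k n}"
      then have "(g n ^^ j) w \<in> K R w" using R by simp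
      with n[OF this] Aw KU[OF w(1)] show "cmod (G n ((g n ^^ j) w)) \<le> e" by (auto simp: dist_norm subset_iff)
    qed
    finally show False using k1(2)[of n] e by (simp add: e_def)
  qed
  have holq: "(\<lambda>z. inverse (A z)) holomorphic_on upper_half_plane"
    using nz by (intro holomorphic_intros holA) auto
  obtain h where h0: "\<And>z. z \<in> upper_half_plane \<Longrightarrow> (h has_field_derivative inverse (A z)) (at z within upper_half_plane)"
    using holomorphic_convex_primitive'[OF UHP_convex UHP_open holq] by blast
  then have h: "(h has_field_derivative inverse (A z)) (at z)" if "Im z > 0" for z
    using that h0[of z] at_within_open[OF _ UHP_open, of z] by simp
  \<comment> \<open>Iterating \<open>g n = id + G n / k n\<close> is an Euler scheme for the flow of
    \<open>A\<close>, and \<open>h\<close> measures time along this flow: a step raises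
    \<open>h\<close> by \<open>1 / k n\<close> up to an error \<open>e / k n\<close>, and at most
    \<open>k n\<close> steps are taken.\<close>
  have key: "\<exists>N. \<forall>n\<ge>N. \<forall>j\<le>k n. cmod (h ((g n ^^ j) w) - h w - of_real (j / k n)) \<le> e"
    if w: "Im w > 0" and e: "e > 0" for w e
  proof -
    obtain R where R: "\<And>n j. j \<le> k n \<Longrightarrow> (g n ^^ j) w \<in> K R w" using orb[OF w] by blast
    define C where "C = K R w"
    have C: "compact C" "C \<subseteq> upper_half_plane" "convex C"
      using Kc KU[OF w] Kconv by (simp_all add: C_def)
    have contq: "continuous_on C (\<lambda>z. inverse (A z))"
      using holomorphic_on_imp_continuous_on[OF holq] C(2) continuous_on_subset by blast
    obtain M where M: "\<And>z. z \<in> C \<Longrightarrow> cmod (inverse (A z)) \<le> M"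
      using compact_imp_bounded[OF compact_continuous_image[OF contq C(1)]] unfolding bounded_iff by auto
    have contA: "continuous_on C A"
      using holomorphic_on_imp_continuous_on[OF holA] C(2) continuous_on_subset by blast
    obtain B where B: "\<And>z. z \<in> C \<Longrightarrow> cmod (A z) \<le> B"
      using compact_imp_bounded[OF compact_continuous_image[OF contA C(1)]] unfolding bounded_iff by auto
    have "w \<in> C" using R[of 0 0] by (simp add: C_def)
    moreover have "0 < cmod (inverse (A w))" using nz[OF w] by simp
    ultimately have MB: "M > 0" "B \<ge> 0"
      using M[of w] B[of w] norm_ge_zero[of "A w"] by linarith+
    \<comment> \<open>\<open>e1\<close> pays for the variation of \<open>1 / A\<close> over a step
      of length at most \<open>(B + 1) / k n\<close>, \<open>e2\<close> for the difference of
      \<open>G n\<close> and \<open>A\<close>; each costs \<open>e / 2\<close> in total. The minimum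
      with \<open>1\<close> keeps \<open>|G n|\<close> below \<open>B + 1\<close>.\<close>
    define e1 where "e1 = e / (2 * (B + 1))"
    define e2 where "e2 = min 1 (e / (2 * M))"
    have e12: "e1 > 0" "e2 > 0" using e MB by (auto simp: e1_def e2_def)
    obtain \<delta> where \<delta>: "\<delta> > 0"
      "\<And>x y. x \<in> C \<Longrightarrow> y \<in> C \<Longrightarrow> dist y x < \<delta> \<Longrightarrow> dist (inverse (A y)) (inverse (A x)) < e1"
      using compact_uniformly_continuous[OF contq C(1)] e12(1) unfolding uniformly_continuous_on_def by blast
    have "\<forall>\<^sub>F n in sequentially. (\<forall>z\<in>C. dist (G n z) (A z) < e2) \<and> real (k n) > (B + 1) / \<delta>"
    proof (rule eventually_conj)
      show "\<forall>\<^sub>F n in sequentially. \<forall>z\<in>C. dist (G n z) (A z) < e2"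
        using unifG[OF C(1,2)] e12(2) unfolding uniform_limit_iff by blast
      show "\<forall>\<^sub>F n in sequentially. real (k n) > (B + 1) / \<delta>"
        using klim unfolding filterlim_at_top_dense by blast
    qed
    then obtain N where N: "\<And>n z. n \<ge> N \<Longrightarrow> z \<in> C \<Longrightarrow> dist (G n z) (A z) < e2"
      "\<And>n. n \<ge> N \<Longrightarrow> real (k n) > (B + 1) / \<delta>"
      unfolding eventually_sequentially by blast
    show ?thesis
    proof (intro exI[of _ N] allI impI)
      fix n j assume n: "n \<ge> N" and j: "j \<le> k n"
      define u where "u i = (g n ^^ i) w" for i
      have uC: "u i \<in> C" if "i \<le> k n" for i using R[OF that] by (simp add: u_def C_def)
      have step: "cmod (h (u (Suc i)) - h (u i) - of_real (1 / k n)) \<le> e / k n" if i: "i < k n" for i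
      proof -
        have ui: "u i \<in> C" "u (Suc i) \<in> C" using uC i by auto
        have d: "u (Suc i) - u i = G n (u i) / of_nat (k n)"
          using k1(2)[of n] by (simp add: G_def u_def)
        have Gd: "cmod (G n (u i) - A (u i)) < e2" using N(1)[OF n ui(1)] by (simp add: dist_norm)
        have "cmod (G n (u i)) \<le> B + 1"
          using norm_triangle_sub[of "G n (u i)" "A (u i)"] Gd B[OF ui(1)] by (simp add: e2_def)
        then have d1: "cmod (u (Suc i) - u i) \<le> (B + 1) / k n"
          using k1(2)[of n] by (simp add: d norm_divide divide_right_mono)
        have d2: "(B + 1) / k n < \<delta>"
          using N(2)[OF n] k1(2)[of n] \<delta>(1) by (simp add: field_simps)
        have seg: "x \<in> C" "cmod (x - u i) < \<delta>" if "x \<in> closed_segment (u i) (u (Suc i))" for x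
          using closed_segment_subset[OF ui C(3)] that segment_bound(1)[OF that] d1 d2 by auto
        have "cmod (h (u (Suc i)) - h (u i) - inverse (A (u i)) * (u (Suc i) - u i)) \<le> e1 * cmod (u (Suc i) - u i)"
        proof (rule segment_derivative_estimate)
          fix x assume x: "x \<in> closed_segment (u i) (u (Suc i))"
          show "(h has_field_derivative inverse (A x)) (at x)" using h seg(1)[OF x] C(2) by auto
          show "cmod (inverse (A x) - inverse (A (u i))) \<le> e1"
            using \<delta>(2)[OF ui(1) seg(1)[OF x]] seg(2)[OF x] by (simp add: dist_norm)
        qed
        also have "\<dots> \<le> e1 * ((B + 1) / k n)" using d1 e12 by (intro mult_left_mono) auto
        also have "\<dots> = e1 * (B + 1) / k n" by simp
        also have "e1 * (B + 1) = e / 2" unfolding e1_def using MB by (simp add: divide_simps)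
        finally have 1: "cmod (h (u (Suc i)) - h (u i) - inverse (A (u i)) * (u (Suc i) - u i)) \<le> e / 2 / k n" .
        have Az: "A (u i) \<noteq> 0" using nz ui C(2) by auto
        have "inverse (A (u i)) * (u (Suc i) - u i) - of_real (1 / k n) = inverse (A (u i)) * (G n (u i) - A (u i)) / of_nat (k n)"
          unfolding d using Az k1(2)[of n] by (simp add: field_simps)
        then have "cmod (inverse (A (u i)) * (u (Suc i) - u i) - of_real (1 / k n)) = cmod (inverse (A (u i))) * cmod (G n (u i) - A (u i)) / k n"
          by (simp add: norm_mult norm_divide)
        also have "\<dots> \<le> M * e2 / k n"
          using M[OF ui(1)] Gd MB k1(2)[of n] by (intro divide_right_mono mult_mono) auto
        also have "\<dots> \<le> M * (e / (2 * M)) / k n"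
          using MB k1(2)[of n] by (intro divide_right_mono mult_left_mono) (auto simp: e2_def)
        also have "\<dots> = e / 2 / k n" using MB by simp
        finally have 2: "cmod (inverse (A (u i)) * (u (Suc i) - u i) - of_real (1 / k n)) \<le> e / 2 / k n" .
        show ?thesis
          using norm_triangle_le[OF add_mono[OF 1 2]] by (simp add: add_diff_eq)
      qed
      have "h (u j) - h w - of_real (j / k n) = (\<Sum>i<j. h (u (Suc i)) - h (u i) - of_real (1 / k n))"
        unfolding sum_subtractf[of "\<lambda>i. h (u (Suc i)) - h (u i)"] sum_lessThan_telescope[of "\<lambda>i. h (u i)"] by (simp add: u_def)
      also have "cmod \<dots> \<le> (\<Sum>i<j. e / k n)"
        by (rule order_trans[OF norm_sum sum_mono]) (use step j in auto)
      also have "\<dots> = j / k n * e" by simp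
      also have "\<dots> \<le> 1 * e" using j e k1(2)[of n] by (intro mult_right_mono) auto
      finally show "cmod (h ((g n ^^ j) w) - h w - of_real (j / k n)) \<le> e" by (simp add: u_def)
    qed
  qed
  have hF: "h (F z) = h z + 1" if z: "Im z > 0" for z
  proof -
    have "cmod (h (F z) - h z - 1) \<le> 0 + e" if e: "e > 0" for e
    proof -
      obtain N where N: "\<And>n j. n \<ge> N \<Longrightarrow> j \<le> k n \<Longrightarrow> cmod (h ((g n ^^ j) z) - h z - of_real (j / k n)) \<le> e"
        using key[OF z e] by blast
      show ?thesis using N[of N "k N"] k1(2)[of N] by (simp add: gF[OF z])
    qed
    from field_le_epsilon[OF this] have "cmod (h (F z) - h z - 1) \<le> 0" by blast
    then show ?thesis by (simp add: algebra_simps)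
  qed
  \<comment> \<open>The point at time \<open>t\<close> is a subsequential limit of the points after
    \<open>j n\<close> steps, where \<open>j n / k n\<close> tends to \<open>t\<close>. The distance
    bound is inherited from the orbits; it later gives the normalisation of the fractional
    iterates.\<close>
  have range: "\<exists>\<zeta>. Im z \<le> Im \<zeta> \<and> h \<zeta> = h z + complex_of_real t \<and>
       (Im (F z) - Im z \<le> Im z / 2 \<longrightarrow> cmod (\<zeta> - z) \<le> 2 * cmod (F z - z))"
    if z: "Im z > 0" and t: "0 \<le> t" "t \<le> 1" for z t
  proof -
    obtain R where R: "\<And>n j. j \<le> k n \<Longrightarrow> (g n ^^ j) z \<in> K R z" using orb[OF z] by blast
    define j where "j n = nat \<lfloor>t * k n\<rfloor>" for n
    have jle: "j n \<le> k n" for n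
    proof -
      have "t * k n \<le> k n" using t by (simp add: mult_left_le_one_le)
      then show ?thesis unfolding j_def by linarith
    qed
    have jlim: "(\<lambda>n. real (j n) / k n) \<longlonglongrightarrow> t"
    proof (rule tendsto_sandwich[OF always_eventually always_eventually])
      have jt: "t * k n - 1 \<le> j n \<and> j n \<le> t * k n" for n
      proof -
        have "real (j n) = of_int \<lfloor>t * k n\<rfloor>" using t by (simp add: j_def)
        then show ?thesis by linarith
      qed
      have "t - 1 / k n \<le> j n / k n \<and> j n / k n \<le> t" for n
      proof -
        have "t - 1 / k n = (t * k n - 1) / k n" using k1(2)[of n] by (simp add: diff_divide_distrib)
        then show ?thesis using jt[of n] k1(2)[of n] by (simp add: divide_right_mono divide_le_eq)
      qed
      then show "\<forall>n. t - 1 / k n \<le> j n / k n" "\<forall>n. j n / k n \<le> t" by blast+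
      have "(\<lambda>n. t - 1 / real (k n)) \<longlonglongrightarrow> t - 0"
        by (intro tendsto_intros tendsto_divide_0[OF tendsto_const] filterlim_at_top_imp_at_infinity klim)
      then show "(\<lambda>n. t - 1 / real (k n)) \<longlonglongrightarrow> t" by simp
    qed simp
    define \<zeta> where "\<zeta> n = (g n ^^ j n) z" for n
    have "\<forall>n. \<zeta> n \<in> K R z" using R jle by (auto simp: \<zeta>_def)
    then obtain x s where x: "x \<in> K R z" and s: "strict_mono s" "(\<zeta> \<circ> s) \<longlonglongrightarrow> x"
      using Kc[of R z] unfolding compact_def by blast
    have xz: "Im z \<le> Im x" using x by (simp add: K_def)
    have "isCont h x" using h xz z by (intro DERIV_isCont[OF h]) simp
    then have hx: "(\<lambda>n. h (\<zeta> (s n))) \<longlonglongrightarrow> h x" using s(2) by (auto simp: o_def intro: isCont_tendsto_compose)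
    have "(\<lambda>n. h (\<zeta> n) - h z - of_real (j n / k n)) \<longlonglongrightarrow> 0"
      unfolding LIMSEQ_iff
    proof (intro allI impI)
      fix e :: real assume "e > 0"
      then obtain N where N: "\<And>n j. n \<ge> N \<Longrightarrow> j \<le> k n \<Longrightarrow> cmod (h ((g n ^^ j) z) - h z - of_real (j / k n)) \<le> e / 2"
        using key[OF z, of "e/2"] by auto
      show "\<exists>no. \<forall>n\<ge>no. norm (h (\<zeta> n) - h z - of_real (j n / k n) - 0) < e"
        using N jle \<open>e > 0\<close> unfolding \<zeta>_def by (intro exI[of _ N]) (smt (verit) diff_zero field_sum_of_halves)
    qed
    from LIMSEQ_subseq_LIMSEQ[OF tendsto_add[OF tendsto_add[OF this tendsto_of_real[OF jlim]] tendsto_const[of "h z"]] s(1)]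
    have "(\<lambda>n. h (\<zeta> (s n))) \<longlonglongrightarrow> of_real t + h z" by (simp add: o_def)
    with hx have "h x = h z + of_real t" by (metis LIMSEQ_unique add.commute)
    moreover have "cmod (x - z) \<le> 2 * cmod (F z - z)" if V: "Im (F z) - Im z \<le> Im z / 2"
    proof -
      have "cmod (\<zeta> n - z) \<le> 2 * cmod (F z - z)" for n
        using orbit_estimates(1)[OF ginc z k1(1), of n n "j n" 0] V jle[of n] by (simp add: gF[OF z] \<zeta>_def)
      then show ?thesis
        using tendsto_upperbound[OF tendsto_norm[OF tendsto_diff[OF s(2) tendsto_const[of z]]]] by (simp add: o_def)
    qed
    ultimately show ?thesis using xz by blast
  qed
  show thesis by (rule that[OF holA ImA nz h hF range estA estA'])
qed

section \<open>Roots in the Koenigs coordinate\<close>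

text \<open>Two orbits of \<open>F\<close> stay at bounded hyperbolic distance, so their heights are
  comparable. The normalisation provides a point \<open>w\<close> with so small a first hyperbolic
  step that heights on its orbit grow by a factor of at most \<open>1 + \<delta> / 2\<close> per
  step, which excludes growth by \<open>1 + \<delta>\<close> from \<open>z\<close>.\<close>

lemma F_not_hyperbolic:
  assumes F: "F_class F" and z: "Im z > 0" and \<delta>: "\<delta> > 0"
  shows "\<exists>m. Im (F ((F ^^ m) z)) - Im ((F ^^ m) z) \<le> \<delta> * Im ((F ^^ m) z)"
proof (rule ccontr)
  note Fi = F_classD[OF F]
  assume "\<not> ?thesis"
  then have gt: "Im (F ((F ^^ m) z)) - Im ((F ^^ m) z) > \<delta> * Im ((F ^^ m) z)" for m by (auto simp: not_le)
  have y: "Im ((F ^^ m) z) \<ge> (1 + \<delta>) ^ m * Im z" for m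
  proof (induction m)
    case (Suc m)
    have "(1 + \<delta>) * ((1 + \<delta>) ^ m * Im z) \<le> (1 + \<delta>) * Im ((F ^^ m) z)"
      using Suc \<delta> by (intro mult_left_mono) auto
    also have "\<dots> \<le> Im (F ((F ^^ m) z))" using gt[of m] by (simp add: algebra_simps)
    finally show ?case by (simp add: mult_ac)
  qed simp
  define e where "e = sqrt (1 + \<delta> / 2) - 1"
  have e: "e > 0" using \<delta> by (simp add: e_def)
  have e2: "(1 + e)\<^sup>2 = 1 + \<delta> / 2" using \<delta> by (simp add: e_def)
  obtain w where w: "Im w > 0" "cmod (F w - w) \<le> e * Im w"
    using F_class_base[OF F e] by blast
  note pos = funpow_Im_mono(2)[OF Fi _ order.refl]
  have growth: "Im ((F ^^ Suc m) w) \<le> (1 + \<delta> / 2) * Im ((F ^^ m) w)" for m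
  proof -
    have "(cmod (F w - w))\<^sup>2 \<le> (e * Im w)\<^sup>2" using w e by (intro power_mono) auto
    also have "\<dots> = e\<^sup>2 * (Im w * Im w)" by (simp add: power2_eq_square)
    also have "\<dots> \<le> e\<^sup>2 * (Im w * Im (F w))"
      using Im_increasingD(2)[OF Fi w(1)] w by (intro mult_left_mono) auto
    finally have 1: "(cmod (F w - w))\<^sup>2 \<le> e\<^sup>2 * (Im w * Im (F w))" .
    have "(cmod ((F ^^ m) w - (F ^^ m) (F w)))\<^sup>2 * (Im w * Im (F w))
        \<le> Im ((F ^^ m) w) * Im ((F ^^ m) (F w)) * (cmod (w - F w))\<^sup>2"
      using Im_increasing_contraction[OF Im_increasing_funpow[OF Fi] w(1), of "F w"] Im_increasingD(3)[OF Fi w(1)] by blast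
    also have "\<dots> \<le> Im ((F ^^ m) w) * Im ((F ^^ m) (F w)) * (e\<^sup>2 * (Im w * Im (F w)))"
      using 1 pos[OF w(1), of m] pos[OF Im_increasingD(3)[OF Fi w(1)], of m]
      by (intro mult_left_mono) (auto simp: norm_minus_commute)
    finally have "(cmod ((F ^^ m) w - (F ^^ m) (F w)))\<^sup>2 \<le> e\<^sup>2 * (Im ((F ^^ m) w) * Im ((F ^^ m) (F w)))"
      using mult_le_cancel_right_pos[of "Im w * Im (F w)"] Im_increasingD(3)[OF Fi w(1)] w(1)
      by (simp add: mult_ac)
    \<comment> \<open>The Harnack inequality for the identity map turns a bound on the hyperbolic
      step into a bound on the ratio of heights. The choice of \<open>e\<close> makes this ratio at
      most \<open>1 + \<delta> / 2\<close>.\<close>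
    then have "Im ((F ^^ m) (F w)) \<le> (1 + e)\<^sup>2 * Im ((F ^^ m) w)"
      using half_plane_Harnack(4)[of "\<lambda>z. z" "(F ^^ m) w" "(F ^^ m) (F w)" e]
        pos[OF w(1), of m] pos[OF Im_increasingD(3)[OF Fi w(1)], of m] e by simp
    then show ?thesis unfolding e2 by (simp add: funpow_commute)
  qed
  have w_le: "Im ((F ^^ m) w) \<le> (1 + \<delta> / 2) ^ m * Im w" for m
  proof (induction m)
    case (Suc m)
    have "Im ((F ^^ Suc m) w) \<le> (1 + \<delta> / 2) * Im ((F ^^ m) w)" by (rule growth)
    also have "\<dots> \<le> (1 + \<delta> / 2) * ((1 + \<delta> / 2) ^ m * Im w)"
      using Suc \<delta> by (intro mult_left_mono) auto
    finally show ?case by (simp add: mult_ac)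
  qed simp
  define \<kappa> where "\<kappa> = cmod (w - z) / sqrt (Im w * Im z)"
  have \<kappa>: "\<kappa> \<ge> 0" "(cmod (w - z))\<^sup>2 = \<kappa>\<^sup>2 * (Im w * Im z)"
    using w z by (auto simp: \<kappa>_def power_divide)
  have "Im ((F ^^ m) z) \<le> (1 + \<kappa>)\<^sup>2 * Im ((F ^^ m) w)" for m
  proof -
    have "(cmod ((F ^^ m) w - (F ^^ m) z))\<^sup>2 * (Im w * Im z)
        \<le> Im ((F ^^ m) w) * Im ((F ^^ m) z) * (\<kappa>\<^sup>2 * (Im w * Im z))"
      using Im_increasing_contraction[OF Im_increasing_funpow[OF Fi] w(1) z] \<kappa> by simp
    then have "(cmod ((F ^^ m) w - (F ^^ m) z))\<^sup>2 \<le> \<kappa>\<^sup>2 * (Im ((F ^^ m) w) * Im ((F ^^ m) z))"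
      using mult_le_cancel_right_pos[of "Im w * Im z"] w(1) z by (simp add: mult_ac)
    then show ?thesis
      using half_plane_Harnack(4)[of "\<lambda>z. z" "(F ^^ m) w" "(F ^^ m) z" \<kappa>]
        pos[OF w(1), of m] pos[OF z, of m] \<kappa> by simp
  qed
  then have le: "(1 + \<delta>) ^ m * Im z \<le> (1 + \<kappa>)\<^sup>2 * ((1 + \<delta> / 2) ^ m * Im w)" for m
    using y[of m] w_le[of m] mult_left_mono[OF w_le[of m], of "(1 + \<kappa>)\<^sup>2"] by (smt (verit) zero_le_power2)
  define q where "q = (1 + \<delta>) / (1 + \<delta> / 2)"
  have q: "q > 1" using \<delta> by (simp add: q_def field_simps)
  obtain m where "(1 + \<kappa>)\<^sup>2 * Im w / Im z < q ^ m" using real_arch_pow[OF q] by blast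
  then have "(1 + \<kappa>)\<^sup>2 * Im w < q ^ m * Im z" using z by (simp add: field_simps)
  also have "q ^ m = (1 + \<delta>) ^ m / (1 + \<delta> / 2) ^ m" by (simp add: q_def power_divide)
  finally have "(1 + \<kappa>)\<^sup>2 * Im w * (1 + \<delta> / 2) ^ m < (1 + \<delta>) ^ m * Im z"
    using \<delta> by (simp add: field_simps)
  with le[of m] show False by (simp add: mult_ac)
qed

text \<open>The function \<open>h \<circ> f - h\<close> is \<open>F\<close>-invariant, so it can be computed arbitrarily far along an
  \<open>F\<close>-orbit; at points of the orbit where \<open>F\<close> hardly changes the imaginary part,
  \<open>A\<close>, \<open>F - id\<close> and \<open>n (f - id)\<close> almost agree and are almost constant.\<close>

lemma root_in_koenigs_coordinate:
  assumes F: "F_class F" and holA: "A holomorphic_on upper_half_plane"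
    and ImA: "\<And>z. Im z > 0 \<Longrightarrow> Im (A z) \<ge> 0" and nz: "\<And>z. Im z > 0 \<Longrightarrow> A z \<noteq> 0"
    and h: "\<And>z. Im z > 0 \<Longrightarrow> (h has_field_derivative inverse (A z)) (at z)"
    and hF: "\<And>z. Im z > 0 \<Longrightarrow> h (F z) = h z + 1"
    and estA: "\<And>z. Im z > 0 \<Longrightarrow> Im (F z) - Im z \<le> Im z / 2 \<Longrightarrow>
       cmod (A z - (F z - z)) \<le> 2 * cmod (F z - z) / Im z * (1 + 2 * cmod (F z - z) / Im z) * (Im (F z) - Im z)"
    and estA': "\<And>z. Im z > 0 \<Longrightarrow> Im (F z) - Im z \<le> Im z / 2 \<Longrightarrow>
       Im (A z) \<le> (1 + 2 * cmod (F z - z) / Im z)\<^sup>2 * (Im (F z) - Im z)"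
    and root: "iter_root n F f" and z: "Im z > 0"
  shows "h (f z) = h z + of_real (1 / n)"
proof -
  note Fi = F_classD[OF F]
  have f: "Im_increasing f" and n: "n \<ge> 1" and fn: "\<And>z. Im z > 0 \<Longrightarrow> (f ^^ n) z = F z"
    using root by (auto simp: iter_root_def)
  note pos = funpow_Im_mono(2)[OF Fi _ order.refl]
  define D where "D w = h (f w) - h w" for w
  have "D (F w) = D w" if w: "Im w > 0" for w
  proof -
    have "f (F w) = F (f w)"
      using fn[OF w] fn[OF Im_increasingD(3)[OF f w]] funpow_commute[of n f w] by simp
    then show ?thesis using hF[OF w] hF[OF Im_increasingD(3)[OF f w]] by (simp add: D_def)
  qed
  then have Dm: "D ((F ^^ m) z) = D z" for m
    by (induction m) (use pos[OF z] in auto)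
  \<comment> \<open>The size of the hyperbolic step from \<open>z\<close> to \<open>F z\<close>.
    Schwarz--Pick does not let it grow along the orbit, so the ratio \<open>l / y\<close> below has
    a bound independent of \<open>m\<close>.\<close>
  define s where "s = cmod (z - F z) / sqrt (Im z * Im (F z))"
  have Fz: "Im (F z) > 0" using Im_increasingD(3)[OF Fi z] .
  have s: "s \<ge> 0" "(cmod (z - F z))\<^sup>2 = s\<^sup>2 * (Im z * Im (F z))"
    using Fz z by (auto simp: s_def power_divide)
  have inv: "(cmod (F ((F ^^ m) z) - (F ^^ m) z))\<^sup>2 \<le> s\<^sup>2 * (Im ((F ^^ m) z) * Im (F ((F ^^ m) z)))" for m
  proof -
    have "(cmod ((F ^^ m) z - (F ^^ m) (F z)))\<^sup>2 * (Im z * Im (F z))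
        \<le> Im ((F ^^ m) z) * Im ((F ^^ m) (F z)) * (s\<^sup>2 * (Im z * Im (F z)))"
      using Im_increasing_contraction[OF Im_increasing_funpow[OF Fi] z Fz] s by simp
    then have "(cmod ((F ^^ m) z - (F ^^ m) (F z)))\<^sup>2 \<le> s\<^sup>2 * (Im ((F ^^ m) z) * Im ((F ^^ m) (F z)))"
      using mult_le_cancel_right_pos[of "Im z * Im (F z)"] z Fz by (simp add: mult_ac)
    then show ?thesis by (simp add: funpow_commute norm_minus_commute)
  qed
  define P where "P = 1 + 4 * s"
  have P: "P \<ge> 1" using s by (simp add: P_def)
  have "cmod (D z - of_real (1 / n)) \<le> 0 + \<epsilon>" if \<epsilon>: "\<epsilon> > 0" for \<epsilon>
  proof -
    \<comment> \<open>Linearising \<open>h\<close> on the segment from \<open>w\<close> to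
      \<open>f w\<close> costs \<open>8 * \<eta>\<close>, replacing \<open>n (f w - w)\<close> by
      \<open>A w\<close> costs \<open>4 * \<eta>\<close>. The choice of \<open>\<delta>\<close>
      makes the errors \<open>\<kappa> * V * Q\<close> with \<open>Q \<le> P ^ 3\<close> at most
      \<open>\<eta> * l\<close>.\<close>
    define \<eta> where "\<eta> = min (1 / 4) (\<epsilon> / 12)"
    define \<delta> where "\<delta> = min (1 / 2) (\<eta> / (2 * P ^ 3))"
    have \<eta>: "\<eta> > 0" "\<eta> \<le> 1 / 4" "12 * \<eta> \<le> \<epsilon>" using \<epsilon> by (auto simp: \<eta>_def)
    have \<delta>: "\<delta> > 0" "\<delta> \<le> 1 / 2" using \<eta> P by (auto simp: \<delta>_def)
    have "\<delta> \<le> \<eta> / (2 * P ^ 3)" by (simp add: \<delta>_def)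
    then have \<delta>P: "2 * P ^ 3 * \<delta> \<le> \<eta>" using P by (simp add: field_simps)
    obtain m where m: "Im (F ((F ^^ m) z)) - Im ((F ^^ m) z) \<le> \<delta> * Im ((F ^^ m) z)"
      using F_not_hyperbolic[OF F z \<delta>(1)] by blast
    define w where "w = (F ^^ m) z"
    define y where "y = Im w"
    define V where "V = Im (F w) - Im w"
    define l where "l = cmod (F w - w)"
    define \<kappa> where "\<kappa> = 2 * l / y"
    have y: "y > 0" using pos[OF z] by (simp add: w_def y_def)
    then have w: "Im w > 0" by (simp add: y_def)
    have V: "V \<le> \<delta> * y" using m by (simp add: V_def w_def y_def)
    also have "\<dots> \<le> y / 2" using \<delta> y by (simp add: mult_right_mono)
    finally have V2: "V \<le> y / 2" .
    have V0: "V \<ge> 0" using Im_increasingD(2)[OF Fi w] by (simp add: V_def)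
    have Vh: "Im (F w) - Im w \<le> Im w / 2" using V2 by (simp add: V_def y_def)
    have l0: "l > 0" using hF[OF w] by (auto simp: l_def)
    have "l\<^sup>2 \<le> s\<^sup>2 * (y * Im (F w))" using inv[of m] by (simp add: l_def y_def w_def)
    also have "\<dots> \<le> s\<^sup>2 * (y * (2 * y))"
      using V2 y by (intro mult_left_mono) (auto simp: V_def y_def)
    also have "\<dots> \<le> (2 * s * y)\<^sup>2" using s y by (simp add: power2_eq_square)
    finally have "l \<le> 2 * s * y" by (rule power2_le_imp_le) (use s y in simp)
    then have \<kappa>: "0 \<le> \<kappa>" "1 + \<kappa> \<le> P"
      using y l0 by (auto simp: \<kappa>_def P_def field_simps)
    \<comment> \<open>Because \<open>\<kappa> = 2 * l / y\<close> and
      \<open>V \<le> \<delta> * y\<close>, these errors are small relative to \<open>l\<close>.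
      Relative smallness is what matters, as \<open>1 / A w\<close> is of order
      \<open>1 / l\<close>.\<close>
    have \<kappa>V: "\<kappa> * V * Q \<le> \<eta> * l" if Q: "Q \<le> P ^ 3" "Q \<ge> 0" for Q
    proof -
      have "\<kappa> * V * Q \<le> \<kappa> * (\<delta> * y) * P ^ 3"
        using V V0 Q \<kappa> P y \<delta> by (intro mult_mono) auto
      also have "\<dots> = l * (2 * P ^ 3 * \<delta>)" using y by (simp add: \<kappa>_def)
      also have "\<dots> \<le> l * \<eta>" using \<delta>P l0 by (intro mult_left_mono) auto
      finally show ?thesis by (simp add: mult_ac)
    qed
    have Ppow: "1 + \<kappa> \<le> P ^ 3" "(1 + \<kappa>) ^ 3 \<le> P ^ 3"
      using \<kappa> P power_mono[OF \<kappa>(2), of 3] self_le_power[of P 3] by auto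
    have a: "cmod (A w - (F w - w)) \<le> \<eta> * l"
      using estA[OF w Vh] \<kappa>V[OF Ppow(1)] \<kappa>(1) by (simp add: \<kappa>_def l_def y_def V_def mult_ac)
    have b: "cmod (of_nat n * (f w - w) - (F w - w)) \<le> \<eta> * l"
      using orbit_estimates(2)[OF f w n] Vh \<kappa>V[OF Ppow(1)] \<kappa>(1) unfolding fn[OF w]
      by (simp add: \<kappa>_def l_def y_def V_def mult_ac)
    have fw: "cmod (f w - w) \<le> 2 * l"
      using orbit_estimates(1)[OF f w n, of 1 0] Vh n unfolding fn[OF w] by (simp add: l_def)
    have Aw: "cmod (A w) \<ge> 3 / 4 * l"
    proof -
      have "l \<le> cmod (A w) + cmod (A w - (F w - w))"
        unfolding l_def by (metis norm_triangle_sub norm_minus_commute)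
      also have "\<dots> \<le> cmod (A w) + 1 / 4 * l" using a \<eta>(2) l0 mult_right_mono[OF \<eta>(2), of l] by linarith
      finally show ?thesis by simp
    qed
    \<comment> \<open>Harnack bounds the variation of \<open>A\<close> by a multiple of
      \<open>Im (A w)\<close>, which is controlled by the small quantity \<open>V\<close>.\<close>
    have c: "cmod (A x - A w) \<le> \<eta> * l" if x: "x \<in> closed_segment w (f w)" for x
    proof -
      have xw: "cmod (x - w) \<le> 2 * l" using segment_bound(1)[OF x] fw by simp
      have "closed_segment w (f w) \<subseteq> {v. y \<le> Im v}"
        using Im_increasingD(2)[OF f w] by (intro closed_segment_subset convex_halfspace_Im_ge) (auto simp: y_def)
      then have xy: "y \<le> Im x" using x by auto
      have "(cmod (w - x))\<^sup>2 \<le> (2 * l)\<^sup>2" using xw by (intro power_mono) (auto simp: norm_minus_commute)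
      also have "\<dots> = \<kappa>\<^sup>2 * (y * y)" using y by (simp add: \<kappa>_def power2_eq_square)
      also have "\<dots> \<le> \<kappa>\<^sup>2 * (Im w * Im x)" using xy y by (intro mult_left_mono) (auto simp: y_def)
      finally have "cmod (A x - A w) \<le> \<kappa> * (1 + \<kappa>) * Im (A w)"
        using xy y \<kappa>(1) by (intro half_plane_Harnack(3)[OF holA ImA w]) auto
      also have "\<dots> \<le> \<kappa> * (1 + \<kappa>) * ((1 + \<kappa>)\<^sup>2 * V)"
        using estA'[OF w Vh] \<kappa>(1) unfolding V_def[symmetric] l_def[symmetric] unfolding y_def[symmetric] unfolding \<kappa>_def[symmetric]
        by (intro mult_left_mono mult_nonneg_nonneg) auto
      also have "\<dots> = \<kappa> * V * (1 + \<kappa>) ^ 3" by (simp add: power2_eq_square power3_eq_cube)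
      also have "\<dots> \<le> \<eta> * l" using \<kappa>V[OF Ppow(2)] \<kappa>(1) by simp
      finally show ?thesis .
    qed
    have "cmod (h (f w) - h w - inverse (A w) * (f w - w)) \<le> 4 * \<eta> / l * cmod (f w - w)"
    proof (rule segment_derivative_estimate)
      fix x assume x: "x \<in> closed_segment w (f w)"
      then have x0: "Im x > 0"
        using closed_segment_subset[OF _ _ UHP_convex, of w "f w"] w Im_increasingD(3)[OF f w] by auto
      then show "(h has_field_derivative inverse (A x)) (at x)" by (rule h)
      have "cmod (A x) \<ge> 1 / 2 * l"
        using c[OF x] Aw norm_triangle_sub[of "A w" "A x"] mult_right_mono[OF \<eta>(2), of l] l0
        unfolding norm_minus_commute[of "A w"] by linarith
      then have Axw: "1 / 2 * l * (3 / 4 * l) \<le> cmod (A x) * cmod (A w)"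
        using Aw l0 by (intro mult_mono) auto
      have "inverse (A x) - inverse (A w) = (A w - A x) / (A x * A w)"
        using nz[OF x0] nz[OF w] by (simp add: field_simps)
      then have "cmod (inverse (A x) - inverse (A w)) = cmod (A x - A w) / (cmod (A x) * cmod (A w))"
        by (simp add: norm_divide norm_mult norm_minus_commute)
      also have "\<dots> \<le> \<eta> * l / (1 / 2 * l * (3 / 4 * l))"
        using c[OF x] Axw l0 \<eta> by (intro frac_le) auto
      also have "\<dots> \<le> 4 * \<eta> / l" using l0 \<eta> by (simp add: divide_simps)
      finally show "cmod (inverse (A x) - inverse (A w)) \<le> 4 * \<eta> / l" .
    qed
    also have "\<dots> \<le> 4 * \<eta> / l * (2 * l)" using fw \<eta> l0 by (intro mult_left_mono) auto
    also have "\<dots> = 8 * \<eta>" using l0 by simp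
    finally have 1: "cmod (D w - inverse (A w) * (f w - w)) \<le> 8 * \<eta>" by (simp add: D_def)
    have Aw0: "A w \<noteq> 0" using nz[OF w] .
    have n0: "real n > 0" "real n \<ge> 1" using n by auto
    have "of_nat n * (inverse (A w) * (f w - w) - of_real (1 / n)) = (of_nat n * (f w - w) - A w) / A w"
      using Aw0 n0 by (simp add: field_simps)
    then have "n * cmod (inverse (A w) * (f w - w) - of_real (1 / n)) = cmod (of_nat n * (f w - w) - A w) / cmod (A w)"
      by (metis norm_divide norm_mult norm_of_nat)
    also have "\<dots> \<le> (\<eta> * l + \<eta> * l) / (3 / 4 * l)"
    proof (rule frac_le)
      show "cmod (of_nat n * (f w - w) - A w) \<le> \<eta> * l + \<eta> * l"
        using norm_triangle_ineq4[of "of_nat n * (f w - w) - (F w - w)" "A w - (F w - w)"] a b by simp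
    qed (use Aw l0 \<eta> in auto)
    also have "\<dots> \<le> 4 * \<eta>" using l0 \<eta> by (simp add: field_simps)
    finally have "n * cmod (inverse (A w) * (f w - w) - of_real (1 / n)) \<le> 4 * \<eta>" .
    moreover have "1 * cmod (inverse (A w) * (f w - w) - of_real (1 / n)) \<le> n * cmod (inverse (A w) * (f w - w) - of_real (1 / n))"
      by (intro mult_right_mono n0) auto
    ultimately have 2: "cmod (inverse (A w) * (f w - w) - of_real (1 / n)) \<le> 4 * \<eta>" by simp
    have "cmod (D w - of_real (1 / n)) \<le> 12 * \<eta>"
      using norm_triangle_le[OF add_mono[OF 1 2]] by (simp add: add_diff_eq)
    then show ?thesis using \<eta> Dm[of m] by (simp add: w_def)
  qed
  from field_le_epsilon[OF this] have "cmod (D z - of_real (1 / n)) \<le> 0" by blast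
  then show ?thesis by (simp add: D_def algebra_simps)
qed

text \<open>The last conclusion covers every root of every order at once: it contains uniqueness,
  and it places independently chosen roots in a single family.\<close>

theorem fractional_iterates:
  assumes F: "F_class F" and roots: "\<And>n. n \<ge> 1 \<Longrightarrow> \<exists>f. iter_root n F f"
  obtains g :: "real \<Rightarrow> complex \<Rightarrow> complex" where
    "\<And>t. t \<ge> 0 \<Longrightarrow> F_class (g t)"
    "\<And>z. Im z > 0 \<Longrightarrow> g 0 z = z"
    "\<And>s t z. s \<ge> 0 \<Longrightarrow> t \<ge> 0 \<Longrightarrow> Im z > 0 \<Longrightarrow> g (s + t) z = g s (g t z)"
    "\<And>z. Im z > 0 \<Longrightarrow> continuous_on {0..} (\<lambda>t. g t z)"
    "\<And>n f z. iter_root n F f \<Longrightarrow> Im z > 0 \<Longrightarrow> f z = g (1 / n) z"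
proof (cases "\<exists>z. Im z > 0 \<and> F z \<noteq> z")
  case False
  \<comment> \<open>Here \<open>l = 0\<close>, so the orbit has diameter \<open>0\<close>.\<close>
  have "f z = z" if r: "iter_root n F f" and z: "Im z > 0" for n f z
    using orbit_estimates(1)[of f z n 1 0] r z False by (auto simp: iter_root_def)
  then show thesis
    by (intro that[of "\<lambda>t z. z"]) (use F_class_id False in auto)
next
  case True
  have "\<exists>f. \<forall>n. iter_root (Suc n) F (f n)" using roots by (intro choice) auto
  then obtain f where f: "\<And>n. iter_root (Suc n) F (f n)" by blast
  obtain A h where holA: "A holomorphic_on upper_half_plane"
    and ImA: "\<And>z. Im z > 0 \<Longrightarrow> Im (A z) \<ge> 0" and nz: "\<And>z. Im z > 0 \<Longrightarrow> A z \<noteq> 0"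
    and h: "\<And>z. Im z > 0 \<Longrightarrow> (h has_field_derivative inverse (A z)) (at z)"
    and hF: "\<And>z. Im z > 0 \<Longrightarrow> h (F z) = h z + 1"
    and range: "\<And>z t. Im z > 0 \<Longrightarrow> 0 \<le> t \<Longrightarrow> t \<le> 1 \<Longrightarrow> \<exists>\<zeta>. Im z \<le> Im \<zeta> \<and> h \<zeta> = h z + complex_of_real t \<and>
       (Im (F z) - Im z \<le> Im z / 2 \<longrightarrow> cmod (\<zeta> - z) \<le> 2 * cmod (F z - z))"
    and est: "\<And>z. Im z > 0 \<Longrightarrow> Im (F z) - Im z \<le> Im z / 2 \<Longrightarrow>
       cmod (A z - (F z - z)) \<le> 2 * cmod (F z - z) / Im z * (1 + 2 * cmod (F z - z) / Im z) * (Im (F z) - Im z)"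
    "\<And>z. Im z > 0 \<Longrightarrow> Im (F z) - Im z \<le> Im z / 2 \<Longrightarrow>
       Im (A z) \<le> (1 + 2 * cmod (F z - z) / Im z)\<^sup>2 * (Im (F z) - Im z)"
    using koenigs_function[OF F f True] by blast
  have hol: "h holomorphic_on upper_half_plane"
    unfolding holomorphic_on_open[OF UHP_open] by (intro ballI exI, rule h) simp
  obtain k where holk: "k holomorphic_on (h ` upper_half_plane)"
    and kh: "\<And>z. z \<in> upper_half_plane \<Longrightarrow> k (h z) = z"
    using holomorphic_has_inverse[OF hol UHP_open inj_on_reciprocal_primitive[OF holA ImA nz h]] by metis
  \<comment> \<open>Translation by \<open>t\<close> in the coordinate \<open>h\<close>. It is
    meaningful since the image of \<open>h\<close> is closed under adding nonnegative reals;
    \<open>range\<close> gives this for \<open>t \<le> 1\<close>, and unit shifts do the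
    rest.\<close>
  define g where "g t z = k (h z + complex_of_real t)" for t z
  have uniq: "g t z = \<zeta>" if "Im \<zeta> > 0" "h \<zeta> = h z + complex_of_real t" for t z \<zeta>
    using kh[of \<zeta>] that by (simp add: g_def)
  have shift1: "\<exists>\<zeta>. Im \<zeta> > 0 \<and> h \<zeta> = h z + complex_of_real t" if "Im z > 0" "0 \<le> t" "t \<le> 1" for z t
    using range[OF that] that(1) by (meson less_le_trans)
  have shift: "\<exists>\<zeta>. Im \<zeta> > 0 \<and> h \<zeta> = h z + complex_of_real t" if z: "Im z > 0" and t: "0 \<le> t" "t \<le> real m" for z t m
    using t
  proof (induction m arbitrary: t)
    case 0
    then show ?case using z by (intro exI[of _ z]) auto
  next
    case (Suc m)
    show ?case
    proof (cases "t \<le> 1")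
      case True
      then show ?thesis using shift1[OF z Suc.prems(1)] by blast
    next
      case False
      then obtain \<zeta> where \<zeta>: "Im \<zeta> > 0" "h \<zeta> = h z + complex_of_real (t - 1)"
        using Suc.IH[of "t - 1"] Suc.prems by auto
      obtain \<xi> where "Im \<xi> > 0" "h \<xi> = h \<zeta> + complex_of_real 1" using shift1[OF \<zeta>(1), of 1] by auto
      then show ?thesis using \<zeta> by (intro exI[of _ \<xi>]) auto
    qed
  qed
  have g: "Im (g t z) > 0" "h (g t z) = h z + complex_of_real t" if zt: "Im z > 0" "t \<ge> 0" for t z
  proof -
    obtain m where "t \<le> real m" using real_arch_simple by blast
    then obtain \<zeta> where "Im \<zeta> > 0" "h \<zeta> = h z + complex_of_real t" using shift[OF zt] by blast
    then show "Im (g t z) > 0" "h (g t z) = h z + complex_of_real t" using uniq by auto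
  qed
  have g0: "g 0 z = z" if "Im z > 0" for z
    using that by (intro uniq) auto
  have gadd: "g (s + t) z = g s (g t z)" if "s \<ge> 0" "t \<ge> 0" "Im z > 0" for s t z
    using g[OF that(3,2)] g[OF g(1)[OF that(3,2)] that(1)] by (intro uniq) auto
  have groot: "f z = g (1 / n) z" if r: "iter_root n F f" and z: "Im z > 0" for n f z
  proof (rule uniq[symmetric])
    show "Im (f z) > 0" using r z Im_increasingD(3) by (auto simp: iter_root_def)
    show "h (f z) = h z + complex_of_real (1 / n)"
      by (rule root_in_koenigs_coordinate[OF F holA ImA nz h hF est r z])
  qed
  have sub: "h z + complex_of_real t \<in> h ` upper_half_plane" if "Im z > 0" "t \<ge> 0" for z t
    using g[OF that] by (intro image_eqI[of _ _ "g t z"]) auto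
  have cont: "continuous_on {0..} (\<lambda>t. g t z)" if "Im z > 0" for z
    unfolding g_def
    by (rule continuous_on_compose2[OF holomorphic_on_imp_continuous_on[OF holk]])
       (use sub[OF that] in \<open>auto intro!: continuous_intros\<close>)
  \<comment> \<open>For \<open>t \<le> 1\<close> the normalisation comes from
    \<open>|g t z - z| \<le> 2 |F z - z|\<close> high on the imaginary axis; larger times are
    reached by composing with \<open>g 1\<close>.\<close>
  have cls1: "F_class (g t)" if t: "0 \<le> t" "t \<le> 1" for t
  proof (rule F_classI)
    have "(k \<circ> (\<lambda>z. h z + complex_of_real t)) holomorphic_on upper_half_plane"
      by (rule holomorphic_on_compose_gen[OF _ holk]) (use sub t in \<open>auto intro!: holomorphic_intros hol\<close>)
    then have "g t holomorphic_on upper_half_plane" unfolding g_def o_def .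
    moreover have "Im z \<le> Im (g t z)" if "Im z > 0" for z
      using range[OF that t] uniq that by (metis less_le_trans)
    ultimately show "Im_increasing (g t)" by (auto simp: Im_increasing_def)
    fix e :: real assume e: "e > 0"
    obtain Y where Y: "Y > 0"
      "\<And>y. y \<ge> Y \<Longrightarrow> cmod (F (\<i> * complex_of_real y) - \<i> * complex_of_real y) \<le> min (1 / 2) (e / 2) * y"
      using F_class_small[OF F, of "min (1 / 2) (e / 2)"] e by auto
    show "\<exists>Y>0. \<forall>y\<ge>Y. cmod (g t (\<i> * complex_of_real y) - \<i> * complex_of_real y) \<le> e * y"
    proof (intro exI[of _ Y] conjI allI impI Y(1))
      fix y assume y: "Y \<le> y"
      define z where "z = \<i> * complex_of_real y"
      have z: "Im z = y" "y > 0" using y Y(1) by (simp_all add: z_def)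
      have Fz: "cmod (F z - z) \<le> 1 / 2 * y" "cmod (F z - z) \<le> e / 2 * y"
        using Y(2)[OF y] mult_right_mono[of "min (1 / 2) (e / 2)" "1 / 2" y] mult_right_mono[of "min (1 / 2) (e / 2)" "e / 2" y] z(2)
        unfolding z_def by linarith+
      have "Im (F z) - Im z \<le> Im z / 2"
        using abs_Im_le_cmod[of "F z - z"] Fz(1) z by simp
      then obtain \<zeta> where "Im z \<le> Im \<zeta>" "h \<zeta> = h z + complex_of_real t" "cmod (\<zeta> - z) \<le> 2 * cmod (F z - z)"
        using range[of z t] z t by auto
      moreover from this have "g t z = \<zeta>" using z by (intro uniq) auto
      ultimately show "cmod (g t (\<i> * complex_of_real y) - \<i> * complex_of_real y) \<le> e * y"
        using Fz(2) by (simp flip: z_def)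
    qed
  qed
  have cls: "F_class (g t)" if "0 \<le> t" "t \<le> real m" for t m
    using that
  proof (induction m arbitrary: t)
    case 0
    then show ?case using cls1 by auto
  next
    case (Suc m)
    show ?case
    proof (cases "t \<le> 1")
      case True
      then show ?thesis using cls1 Suc.prems by blast
    next
      case False
      then have "F_class (\<lambda>z. g 1 (g (t - 1) z))"
        using Suc.IH[of "t - 1"] Suc.prems cls1[of 1] by (intro F_class_comp[of "g 1" "g (t - 1)"]) auto
      then show ?thesis
        by (rule F_class_cong) (use gadd[of 1 "t - 1"] False in auto)
    qed
  qed
  show thesis
  proof (rule that[of g])
    show "F_class (g t)" if "t \<ge> 0" for t
      using cls[OF that] real_arch_simple[of t] by blast
  qed (use g0 gadd cont groot in auto)
qed

section \<open>Cauchy transforms of probability measures\<close>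

definition cauchy_transform :: "real measure \<Rightarrow> complex \<Rightarrow> complex" where
  "cauchy_transform \<mu> z = (\<integral>t. 1 / (z - complex_of_real t) \<partial>\<mu>)"

lemma F_transform_eq: "F_transform \<mu> z = inverse (cauchy_transform \<mu> z)"
  by (simp add: F_transform_def cauchy_transform_def)

lemma Im_le_cmod_diff_real: "Im z \<le> cmod (z - complex_of_real t)"
  using abs_Im_le_cmod[of "z - complex_of_real t"] by simp

lemma diff_of_real_nonzero: "Im z > 0 \<Longrightarrow> z - complex_of_real t \<noteq> 0"
  using Im_le_cmod_diff_real[of z t] by auto

lemma cauchy_kernel_le:
  assumes "Im z > 0" shows "cmod (1 / (z - complex_of_real t)) \<le> 1 / Im z"
  using assms Im_le_cmod_diff_real[of z t] by (simp add: norm_divide frac_le)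

lemma Im_cauchy_kernel: "Im (1 / (z - complex_of_real t)) = - (Im z / (cmod (z - complex_of_real t))\<^sup>2)"
  unfolding Im_divide cmod_power2 by simp

lemma (in real_distribution) prob_UNIV: "prob UNIV = 1"
  using prob_space by simp

lemma (in real_distribution) integrable_bounded:
  fixes f :: "real \<Rightarrow> 'b :: {banach, second_countable_topology}"
  assumes "f \<in> borel_measurable borel" "\<And>t. norm (f t) \<le> B"
  shows "integrable M f"
  by (rule integrable_const_bound[of _ B]) (use assms in auto)

lemma (in real_distribution) integrable_cauchy_kernel:
  "Im z > 0 \<Longrightarrow> integrable M (\<lambda>t. 1 / (z - complex_of_real t))"
  using cauchy_kernel_le by (intro integrable_bounded) auto

lemma (in real_distribution) Im_cauchy_transform:
  assumes "Im z > 0"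
  shows "Im (cauchy_transform M z) = - (\<integral>t. Im z / (cmod (z - complex_of_real t))\<^sup>2 \<partial>M)"
  unfolding cauchy_transform_def integral_Im[OF integrable_cauchy_kernel[OF assms], symmetric] Im_cauchy_kernel
  by simp

text \<open>Nonnegativity of the variance bounds \<open>|G|^2\<close> by the integral of the squared
  modulus of the kernel, which is \<open>- Im G / Im z\<close>. Since
  \<open>Im (1 / G) = - Im G / |G|^2\<close>, this is the height estimate.\<close>

lemma (in real_distribution) F_transform_Im_ge:
  assumes z: "Im z > 0"
  shows "Im z \<le> Im (F_transform M z)" "cauchy_transform M z \<noteq> 0"
proof -
  let ?G = "cauchy_transform M z" and ?k = "\<lambda>t. cmod (1 / (z - complex_of_real t))"
  have k: "?k t \<le> 1 / Im z" for t using cauchy_kernel_le[OF z] .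
  have int: "integrable M ?k" by (intro integrable_norm integrable_cauchy_kernel z)
  have "(?k t)\<^sup>2 \<le> (1 / Im z)\<^sup>2" for t by (intro power_mono k) auto
  then have int2: "integrable M (\<lambda>t. (?k t)\<^sup>2)" by (intro integrable_bounded) auto
  have Im: "Im ?G = - Im z * (\<integral>t. (?k t)\<^sup>2 \<partial>M)"
    unfolding Im_cauchy_transform[OF z] by (simp add: norm_inverse power_inverse divide_inverse)
  have "cmod ?G \<le> (\<integral>t. ?k t \<partial>M)"
    unfolding cauchy_transform_def by (rule integral_norm_bound)
  then have "(cmod ?G)\<^sup>2 \<le> (\<integral>t. ?k t \<partial>M)\<^sup>2" by (intro power_mono) auto
  also have "\<dots> \<le> (\<integral>t. (?k t)\<^sup>2 \<partial>M)"
    using variance_eq[OF int int2] variance_positive[of ?k] by simp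
  finally have G2: "Im z * (cmod ?G)\<^sup>2 \<le> - Im ?G" unfolding Im using z by simp
  have "(\<integral>t. (?k t)\<^sup>2 \<partial>M) \<noteq> 0"
  proof
    assume "(\<integral>t. (?k t)\<^sup>2 \<partial>M) = 0"
    then have "AE t in M. (?k t)\<^sup>2 = 0"
      using integral_nonneg_eq_0_iff_AE[OF int2] by auto
    then have "AE t in M. False" using diff_of_real_nonzero[OF z] by (auto elim!: eventually_mono)
    then show False by simp
  qed
  then show G0: "?G \<noteq> 0" using Im z by auto
  have "Im (F_transform M z) = - Im ?G / (cmod ?G)\<^sup>2"
    by (simp add: F_transform_eq cmod_power2)
  then show "Im z \<le> Im (F_transform M z)"
    using G2 pos_le_divide_eq[of "(cmod ?G)\<^sup>2" "Im z" "- Im ?G"] G0 by simp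
qed

text \<open>Differentiation under the integral with an explicit remainder: for each \<open>t\<close>
  it is \<open>(w - z) / ((w - t) (z - t)^2)\<close>, which is \<open>O(|w - z|)\<close> uniformly
  in \<open>t\<close> while \<open>w\<close> keeps at least half the height of
  \<open>z\<close>.\<close>

lemma (in real_distribution) cauchy_transform_holomorphic:
  "cauchy_transform M holomorphic_on upper_half_plane"
  unfolding holomorphic_on_open[OF UHP_open]
proof (intro ballI exI)
  fix z assume "z \<in> upper_half_plane"
  then have z: "Im z > 0" by simp
  let ?G = "cauchy_transform M"
  let ?D = "- (\<integral>t. (1 / (z - complex_of_real t))\<^sup>2 \<partial>M)"
  have int2: "integrable M (\<lambda>t. (1 / (z - complex_of_real t))\<^sup>2)"
  proof (rule integrable_bounded)
    show "norm ((1 / (z - complex_of_real t))\<^sup>2) \<le> (1 / Im z)\<^sup>2" for t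
      unfolding norm_power by (intro power_mono cauchy_kernel_le z) auto
  qed measurable
  show "(?G has_field_derivative ?D) (at z)"
    unfolding has_field_derivative_iff
  proof (rule LIM_zero_cancel, rule Lim_null_comparison)
    show "\<forall>\<^sub>F w in at z. norm ((?G w - ?G z) / (w - z) - ?D) \<le> cmod (w - z) * (2 / Im z * (1 / Im z)\<^sup>2)"
      unfolding eventually_at
    proof (intro exI[of _ "Im z / 2"] conjI ballI impI)
      show "0 < Im z / 2" using z by simp
      fix w assume w: "w \<noteq> z \<and> dist w z < Im z / 2"
      then have wz: "w - z \<noteq> 0" by simp
      have "\<bar>Im w - Im z\<bar> < Im z / 2" using w abs_Im_le_cmod[of "w - z"] by (simp add: dist_norm)
      then have Imw: "Im w \<ge> Im z / 2" "Im w > 0" using z by linarith+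
      note kz = diff_of_real_nonzero[OF z] and kw = diff_of_real_nonzero[OF Imw(2)]
      have eq: "(1 / (w - complex_of_real t) - 1 / (z - complex_of_real t)) / (w - z) + (1 / (z - complex_of_real t))\<^sup>2
          = (w - z) * (1 / (w - complex_of_real t) * (1 / (z - complex_of_real t))\<^sup>2)" for t
      proof -
        have "\<And>a b :: complex. a \<noteq> 0 \<Longrightarrow> b \<noteq> 0 \<Longrightarrow> a - b \<noteq> 0 \<Longrightarrow>
            (1 / a - 1 / b) / (a - b) + (1 / b)\<^sup>2 = (a - b) * (1 / a * (1 / b)\<^sup>2)"
          by (simp add: divide_simps power2_eq_square) (simp add: algebra_simps)
        from this[OF kw kz, of t t] wz show ?thesis by simp
      qed
      have "(?G w - ?G z) / (w - z) - ?D =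
          (\<integral>t. (1 / (w - complex_of_real t) - 1 / (z - complex_of_real t)) / (w - z) + (1 / (z - complex_of_real t))\<^sup>2 \<partial>M)"
        unfolding cauchy_transform_def
        using integrable_cauchy_kernel[OF z] integrable_cauchy_kernel[OF Imw(2)] int2 by simp
      also have "cmod \<dots> \<le> (\<integral>t. cmod (w - z) * (2 / Im z * (1 / Im z)\<^sup>2) \<partial>M)"
        unfolding eq
      proof (rule order_trans[OF integral_norm_bound], rule integral_mono')
        fix t
        have "cmod (1 / (w - complex_of_real t)) \<le> 2 / Im z"
        proof (rule order_trans[OF cauchy_kernel_le[OF Imw(2)]])
          show "1 / Im w \<le> 2 / Im z" using Imw z by (simp add: field_simps)
        qed
        then show "cmod ((w - z) * (1 / (w - complex_of_real t) * (1 / (z - complex_of_real t))\<^sup>2))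
            \<le> cmod (w - z) * (2 / Im z * (1 / Im z)\<^sup>2)"
          unfolding norm_mult norm_power
          by (intro mult_left_mono mult_mono power_mono cauchy_kernel_le z) (use z in auto)
      next
        show "0 \<le> cmod (w - z) * (2 / Im z * (1 / Im z)\<^sup>2)" using z by simp
      qed simp
      finally show "norm ((?G w - ?G z) / (w - z) - ?D) \<le> cmod (w - z) * (2 / Im z * (1 / Im z)\<^sup>2)"
        using z by (simp add: prob_UNIV)
    qed
    show "((\<lambda>w. cmod (w - z) * (2 / Im z * (1 / Im z)\<^sup>2)) \<longlongrightarrow> 0) (at z)"
      using z by (auto intro!: tendsto_eq_intros)
  qed
qed

lemma (in real_distribution) cauchy_transform_at_infinity:
  "((\<lambda>y. \<i> * complex_of_real y * cauchy_transform M (\<i> * complex_of_real y)) \<longlongrightarrow> 1) at_top"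
proof -
  have "((\<lambda>y. \<integral>t. \<i> * complex_of_real y * (1 / (\<i> * complex_of_real y - complex_of_real t)) \<partial>M) \<longlongrightarrow> (\<integral>t. 1 \<partial>M)) at_top"
  proof (rule integral_dominated_convergence_at_top[where w = "\<lambda>_. 1"])
    show "\<forall>\<^sub>F y in at_top. AE t in M. norm (\<i> * complex_of_real y * (1 / (\<i> * complex_of_real y - complex_of_real t))) \<le> 1"
      using eventually_gt_at_top[of 0]
    proof eventually_elim
      case (elim y)
      have "norm (\<i> * complex_of_real y * (1 / (\<i> * complex_of_real y - complex_of_real t))) \<le> 1" for t
        using elim mult_left_mono[OF cauchy_kernel_le[of "\<i> * complex_of_real y" t], of y] by (simp add: norm_mult norm_divide)
      then show ?case by simp
    qed
    show "AE t in M. ((\<lambda>y. \<i> * complex_of_real y * (1 / (\<i> * complex_of_real y - complex_of_real t))) \<longlongrightarrow> 1) at_top"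
    proof (rule AE_I2)
      fix t
      have "((\<lambda>y. 1 / (1 + \<i> * complex_of_real (t / y))) \<longlongrightarrow> 1 / (1 + \<i> * complex_of_real 0)) at_top"
        by (intro tendsto_intros tendsto_of_real tendsto_divide_0[OF tendsto_const] filterlim_at_top_imp_at_infinity filterlim_ident) auto
      moreover have "\<forall>\<^sub>F y in at_top. 1 / (1 + \<i> * complex_of_real (t / y)) = \<i> * complex_of_real y * (1 / (\<i> * complex_of_real y - complex_of_real t))"
        using eventually_gt_at_top[of 0]
      proof eventually_elim
        case (elim y)
        then have y: "\<i> * complex_of_real y \<noteq> 0" by simp
        have "\<i> * complex_of_real y - complex_of_real t = \<i> * complex_of_real y * (1 + \<i> * complex_of_real (t / y))"
          using y by (simp add: distrib_left)
        then show ?case using y by simp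
      qed
      ultimately show "((\<lambda>y. \<i> * complex_of_real y * (1 / (\<i> * complex_of_real y - complex_of_real t))) \<longlongrightarrow> 1) at_top"
        using Lim_transform_eventually by fastforce
    qed
  qed auto
  then show ?thesis
    unfolding cauchy_transform_def integral_mult_right_zero by (simp add: prob_UNIV)
qed

text \<open>The two quotients determine each other by a Moebius map: one is natural for Cauchy
  transforms, the other for displacement estimates.\<close>

lemma F_class_iff_reciprocal:
  assumes "Im_increasing f"
  shows "F_class f \<longleftrightarrow> ((\<lambda>y. \<i> * complex_of_real y * inverse (f (\<i> * complex_of_real y))) \<longlongrightarrow> 1) at_top"
    (is "_ \<longleftrightarrow> (?g \<longlongrightarrow> 1) at_top")
proof -
  let ?h = "\<lambda>y. (f (\<i> * complex_of_real y) - \<i> * complex_of_real y) / complex_of_real y"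
  have f0: "f (\<i> * complex_of_real y) \<noteq> 0" if "y > 0" for y
    using Im_increasingD(3)[OF assms, of "\<i> * complex_of_real y"] that by auto
  have gh: "\<forall>\<^sub>F y in at_top. \<i> / (?h y + \<i>) = ?g y"
    using eventually_gt_at_top[of 0] by eventually_elim (use f0 in \<open>simp add: field_simps\<close>)
  have hg: "\<forall>\<^sub>F y in at_top. \<i> / ?g y - \<i> = ?h y"
    using eventually_gt_at_top[of 0] by eventually_elim (use f0 in \<open>simp add: field_simps\<close>)
  have "(?h \<longlongrightarrow> 0) at_top \<longleftrightarrow> (?g \<longlongrightarrow> 1) at_top"
  proof
    assume "(?h \<longlongrightarrow> 0) at_top"
    then have "((\<lambda>y. \<i> / (?h y + \<i>)) \<longlongrightarrow> \<i> / (0 + \<i>)) at_top" by (intro tendsto_intros) auto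
    then show "(?g \<longlongrightarrow> 1) at_top" using Lim_transform_eventually[OF _ gh] by simp
  next
    assume "(?g \<longlongrightarrow> 1) at_top"
    then have "((\<lambda>y. \<i> / ?g y - \<i>) \<longlongrightarrow> \<i> / 1 - \<i>) at_top" by (intro tendsto_intros) auto
    then show "(?h \<longlongrightarrow> 0) at_top" using Lim_transform_eventually[OF _ hg] by simp
  qed
  then show ?thesis by (simp add: F_class_def assms)
qed

lemma (in real_distribution) F_class_F_transform: "F_class (F_transform M)"
proof -
  have eq: "F_transform M = (\<lambda>z. inverse (cauchy_transform M z))" by (simp add: fun_eq_iff F_transform_eq)
  have "Im_increasing (F_transform M)"
    unfolding Im_increasing_def
  proof (intro conjI allI impI F_transform_Im_ge(1))
    show "F_transform M holomorphic_on upper_half_plane"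
      unfolding eq using F_transform_Im_ge(2) by (intro holomorphic_intros cauchy_transform_holomorphic) auto
  qed
  then show ?thesis
    using F_class_iff_reciprocal cauchy_transform_at_infinity by (simp add: eq)
qed

section \<open>Stieltjes inversion and weak convergence\<close>

lemma arctan_scaled_limit:
  "(\<lambda>n. arctan (c * real (Suc n))) \<longlonglongrightarrow> pi / 2 * sgn c"
proof -
  have lim: "LIM n sequentially. real (Suc n) :> at_top"
    by (rule filterlim_compose[OF filterlim_real_sequentially filterlim_Suc])
  consider "c > 0" | "c = 0" | "c < 0" by linarith
  then show ?thesis
  proof cases
    case 1
    have "LIM n sequentially. c * real (Suc n) :> at_top"
      by (rule filterlim_tendsto_pos_mult_at_top[OF tendsto_const 1 lim])
    from filterlim_compose[OF tendsto_arctan_at_top this] show ?thesis using 1 by simp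
  next
    case 3
    have "LIM n sequentially. c * real (Suc n) :> at_bot"
      by (rule filterlim_tendsto_neg_mult_at_bot[OF tendsto_const 3 lim])
    from filterlim_compose[OF tendsto_arctan_at_bot this] show ?thesis using 3 by simp
  qed simp
qed

lemma poisson_kernel_FTC:
  assumes "a \<le> b" and y: "y > 0"
  shows "(\<integral>\<^sup>+x. ennreal (y / (cmod (Complex x y - complex_of_real t))\<^sup>2) * indicator {a..b} x \<partial>lborel)
      = ennreal (arctan ((b - t) / y) - arctan ((a - t) / y))"
proof (rule nn_integral_FTC_Icc)
  fix x
  have "((\<lambda>x. arctan ((x - t) / y)) has_real_derivative inverse (1 + ((x - t) / y)\<^sup>2) * (1 / y)) (at x)"
    using y by (auto intro!: derivative_eq_intros)
  moreover have "inverse (1 + ((x - t) / y)\<^sup>2) * (1 / y) = y / (cmod (Complex x y - complex_of_real t))\<^sup>2"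
  proof -
    have "1 + ((x - t) / y)\<^sup>2 = ((x - t)\<^sup>2 + y\<^sup>2) / y\<^sup>2" using y by (simp add: power_divide add_divide_distrib)
    then show ?thesis using y unfolding cmod_power2 by (simp add: power2_eq_square)
  qed
  ultimately show "DERIV (\<lambda>x. arctan ((x - t) / y)) x :> y / (cmod (Complex x y - complex_of_real t))\<^sup>2" by simp
qed (use assms in \<open>auto intro!: borel_measurable_continuous_onI continuous_intros simp: complex_eq_iff\<close>)

text \<open>Stieltjes inversion: \<open>G\<close> determines the integrals of \<open>sgn (b - t) - sgn (a - t)\<close>, which are
  limits of integrals of \<open>- Im G\<close> along horizontal segments.\<close>

lemma stieltjes_inversion:
  assumes M: "real_distribution M" and N: "real_distribution N"
    and eq: "\<And>z. Im z > 0 \<Longrightarrow> cauchy_transform M z = cauchy_transform N z"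
    and ab: "a \<le> b"
  shows "(\<integral>t. sgn (b - t) - sgn (a - t) \<partial>M) = (\<integral>t. sgn (b - t) - sgn (a - t) \<partial>N)"
proof -
  define \<phi> where "\<phi> y t = arctan ((b - t) / y) - arctan ((a - t) / y)" for y t :: real
  have \<phi>0: "\<phi> y t \<ge> 0" if "y > 0" for y t
    using that ab unfolding \<phi>_def by (simp add: arctan_le_iff divide_right_mono)
  have \<phi>b: "norm (\<phi> y t) \<le> 2 * pi" for y t
    using arctan_bounded[of "(b - t) / y"] arctan_bounded[of "(a - t) / y"] unfolding \<phi>_def by (simp add: abs_le_iff)
  have [measurable]: "\<phi> y \<in> borel_measurable borel" for y
    unfolding \<phi>_def by measurable
  \<comment> \<open>The Poisson kernel is nonnegative, so Tonelli's theorem applies in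
    \<open>ennreal\<close>.\<close>
  have integral: "ennreal (\<integral>t. \<phi> y t \<partial>P)
      = (\<integral>\<^sup>+x. ennreal (- Im (cauchy_transform P (Complex x y))) * indicator {a..b} x \<partial>lborel)"
    if P: "real_distribution P" and y: "y > 0" for P y
  proof -
    interpret real_distribution P by (rule P)
    interpret pair_sigma_finite lborel P ..
    have k: "integrable P (\<lambda>t. y / (cmod (Complex x y - complex_of_real t))\<^sup>2)" for x
      using integrable_Im[OF integrable_cauchy_kernel[of "Complex x y"]] y unfolding Im_cauchy_kernel by simp
    have "ennreal (\<integral>t. \<phi> y t \<partial>P) = (\<integral>\<^sup>+t. ennreal (\<phi> y t) \<partial>P)"
      using \<phi>0[OF y] by (intro nn_integral_eq_integral[symmetric] integrable_bounded[OF _ \<phi>b]) auto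
    also have "\<dots> = (\<integral>\<^sup>+t. (\<integral>\<^sup>+x. ennreal (y / (cmod (Complex x y - complex_of_real t))\<^sup>2) * indicator {a..b} x \<partial>lborel) \<partial>P)"
      unfolding poisson_kernel_FTC[OF ab y] \<phi>_def ..
    also have "\<dots> = (\<integral>\<^sup>+x. (\<integral>\<^sup>+t. ennreal (y / (cmod (Complex x y - complex_of_real t))\<^sup>2) * indicator {a..b} x \<partial>P) \<partial>lborel)"
      by (rule Fubini') (simp add: complex_eq_iff[symmetric] Complex_eq, measurable)
    also have "\<dots> = (\<integral>\<^sup>+x. ennreal (- Im (cauchy_transform P (Complex x y))) * indicator {a..b} x \<partial>lborel)"
    proof (intro nn_integral_cong)
      fix x
      have "(\<integral>\<^sup>+t. ennreal (y / (cmod (Complex x y - complex_of_real t))\<^sup>2) \<partial>P) = ennreal (- Im (cauchy_transform P (Complex x y)))"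
        using y by (subst nn_integral_eq_integral[OF k]) (auto simp: Im_cauchy_transform)
      then show "(\<integral>\<^sup>+t. ennreal (y / (cmod (Complex x y - complex_of_real t))\<^sup>2) * indicator {a..b} x \<partial>P)
          = ennreal (- Im (cauchy_transform P (Complex x y))) * indicator {a..b} x"
        by (cases "x \<in> {a..b}") auto
    qed
    finally show ?thesis .
  qed
  have eq\<phi>: "(\<integral>t. \<phi> y t \<partial>M) = (\<integral>t. \<phi> y t \<partial>N)" if y: "y > 0" for y
  proof -
    have "ennreal (\<integral>t. \<phi> y t \<partial>M) = ennreal (\<integral>t. \<phi> y t \<partial>N)"
      unfolding integral[OF M y] integral[OF N y] using eq y by simp
    then show ?thesis using \<phi>0[OF y] by (subst (asm) ennreal_inj) auto
  qed
  have lim: "(\<lambda>n. \<integral>t. \<phi> (1 / real (Suc n)) t \<partial>P) \<longlonglongrightarrow> pi / 2 * (\<integral>t. sgn (b - t) - sgn (a - t) \<partial>P)"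
    if P: "real_distribution P" for P
  proof -
    interpret real_distribution P by (rule P)
    have "(\<lambda>n. \<integral>t. \<phi> (1 / real (Suc n)) t \<partial>P) \<longlonglongrightarrow> (\<integral>t. pi / 2 * (sgn (b - t) - sgn (a - t)) \<partial>P)"
    proof (rule integral_dominated_convergence[where w = "\<lambda>_. 2 * pi"])
      show "AE t in P. (\<lambda>n. \<phi> (1 / real (Suc n)) t) \<longlonglongrightarrow> pi / 2 * (sgn (b - t) - sgn (a - t))"
      proof (rule AE_I2)
        fix t
        show "(\<lambda>n. \<phi> (1 / real (Suc n)) t) \<longlonglongrightarrow> pi / 2 * (sgn (b - t) - sgn (a - t))"
          using tendsto_diff[OF arctan_scaled_limit[of "b - t"] arctan_scaled_limit[of "a - t"]]
          unfolding \<phi>_def by (simp add: right_diff_distrib del: of_nat_Suc)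
      qed
      show "AE t in P. norm (\<phi> (1 / real (Suc n)) t) \<le> 2 * pi" for n using \<phi>b by (intro AE_I2)
    qed auto
    then show ?thesis by simp
  qed
  have "pi / 2 * (\<integral>t. sgn (b - t) - sgn (a - t) \<partial>M) = pi / 2 * (\<integral>t. sgn (b - t) - sgn (a - t) \<partial>N)"
    using lim[OF M] lim[OF N] eq\<phi> by (intro LIMSEQ_unique[of "\<lambda>n. \<integral>t. \<phi> (1 / real (Suc n)) t \<partial>M"]) auto
  then show ?thesis by simp
qed

text \<open>Inversion yields only differences of \<open>S P b\<close>, the mass left of
  \<open>b\<close> minus the mass right of \<open>b\<close>. The limit \<open>-1\<close> at minus
  infinity fixes \<open>S\<close>. Approaching \<open>b\<close> from the right counts the atom at
  \<open>b\<close> as lying on the left, which gives \<open>2 * cdf P b - 1\<close>.\<close>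

theorem cauchy_transform_inject:
  assumes M: "real_distribution M" and N: "real_distribution N"
    and eq: "\<And>z. Im z > 0 \<Longrightarrow> cauchy_transform M z = cauchy_transform N z"
  shows "M = N"
proof (rule cdf_unique[OF M N], rule ext)
  fix b
  define S where "S P b = (\<integral>t. sgn (b - t) \<partial>P)" for P and b :: real
  have int: "integrable P (\<lambda>t. sgn (b - t))" if "real_distribution P" for P b
  proof -
    interpret real_distribution P by (rule that)
    show ?thesis by (rule integrable_bounded[of _ 1]) (auto simp: sgn_if)
  qed
  have diff: "S M b - S M a = S N b - S N a" if "a \<le> b" for a b
    using stieltjes_inversion[OF M N eq that] int[OF M] int[OF N] by (simp add: S_def)
  have bot: "(\<lambda>n. S P (- real n)) \<longlonglongrightarrow> -1" if P: "real_distribution P" for P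
  proof -
    interpret real_distribution P by (rule P)
    have "(\<lambda>n. S P (- real n)) \<longlonglongrightarrow> (\<integral>t. -1 \<partial>P)"
      unfolding S_def
    proof (rule integral_dominated_convergence[where w = "\<lambda>_. 1"])
      show "AE t in P. (\<lambda>n. sgn (- real n - t)) \<longlonglongrightarrow> - 1"
      proof (rule AE_I2, rule tendsto_eventually)
        fix t
        obtain m where "- t < real m" using reals_Archimedean2 by blast
        then show "\<forall>\<^sub>F n in sequentially. sgn (- real n - t) = - 1"
          unfolding eventually_sequentially by (intro exI[of _ m]) (auto simp: sgn_if)
      qed
    qed (auto simp: sgn_if)
    then show ?thesis by (simp add: prob_UNIV)
  qed
  have S: "S M b = S N b" for b
  proof -
    have "(\<lambda>n. S M b - S M (- real n)) \<longlonglongrightarrow> S M b - (-1)" by (intro tendsto_intros bot M)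
    moreover have "(\<lambda>n. S N b - S N (- real n)) \<longlonglongrightarrow> S N b - (-1)" by (intro tendsto_intros bot N)
    moreover have "\<forall>\<^sub>F n in sequentially. S N b - S N (- real n) = S M b - S M (- real n)"
    proof -
      obtain m where "- b \<le> real m" using real_arch_simple by blast
      then show ?thesis unfolding eventually_sequentially by (intro exI[of _ m] allI impI diff[symmetric]) auto
    qed
    ultimately show ?thesis
      using LIMSEQ_unique[OF _ Lim_transform_eventually] by fastforce
  qed
  have cdf: "(\<lambda>n. S P (b + 1 / real (Suc n))) \<longlonglongrightarrow> 2 * cdf P b - 1" if P: "real_distribution P" for P
  proof -
    interpret real_distribution P by (rule P)
    have "(\<lambda>n. S P (b + 1 / real (Suc n))) \<longlonglongrightarrow> (\<integral>t. 2 * indicator {..b} t - 1 \<partial>P)"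
      unfolding S_def
    proof (rule integral_dominated_convergence[where w = "\<lambda>_. 1"])
      show "AE t in P. (\<lambda>n. sgn (b + 1 / real (Suc n) - t)) \<longlonglongrightarrow> 2 * indicator {..b} t - 1"
      proof (rule AE_I2, rule tendsto_eventually)
        fix t
        show "\<forall>\<^sub>F n in sequentially. sgn (b + 1 / real (Suc n) - t) = 2 * indicator {..b} t - 1"
        proof (cases "t \<le> b")
          case True
          have "sgn (b + 1 / real (Suc n) - t) = 1" for n
          proof -
            have "1 / real (Suc n) > 0" by simp
            then have "b + 1 / real (Suc n) - t > 0" using True by linarith
            then show ?thesis by (rule sgn_pos)
          qed
          then show ?thesis using True by simp
        next
          case False
          then have "\<forall>\<^sub>F n in sequentially. 1 / real (Suc n) < t - b"
            using order_tendstoD(2)[OF LIMSEQ_inverse_real_of_nat, of "t - b"] by (simp add: divide_inverse)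
          then show ?thesis by eventually_elim (use False in \<open>simp add: sgn_if\<close>)
        qed
      qed
    qed (auto simp: sgn_if)
    also have "(\<integral>t. 2 * indicator {..b} t - 1 \<partial>P) = 2 * cdf P b - (1 :: real)"
      by (subst Bochner_Integration.integral_diff) (auto simp: cdf_def prob_UNIV emeasure_eq_measure intro!: integrable_real_indicator)
    finally show ?thesis .
  qed
  have "2 * cdf M b - 1 = 2 * cdf N b - 1"
    using LIMSEQ_unique[OF cdf[OF M] cdf[OF N, folded S]] .
  then show "cdf M b = cdf N b" by simp
qed

text \<open>The real part of \<open>\<i> y / (\<i> y - t)\<close> is
  \<open>y^2 / (y^2 + t^2)\<close>, at most \<open>1\<close> everywhere and at most
  \<open>1/2\<close> for \<open>|t| \<ge> y\<close>, so twice it minus one lies below the indicator.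
  Values on the imaginary axis thus control the mass near the origin.\<close>

lemma (in real_distribution) prob_Ioc_ge:
  assumes y: "y > 0"
  shows "2 * Re (\<i> * complex_of_real y * cauchy_transform M (\<i> * complex_of_real y)) - 1 \<le> prob {- y<..y}"
proof -
  let ?k = "\<lambda>t. \<i> * complex_of_real y * (1 / (\<i> * complex_of_real y - complex_of_real t))"
  have int: "integrable M ?k" using y by (intro integrable_mult_right integrable_cauchy_kernel) auto
  have Re: "Re (?k t) = y\<^sup>2 / (y\<^sup>2 + t\<^sup>2)" for t
    by (simp add: Re_divide power2_eq_square add.commute)
  have "2 * Re (\<i> * complex_of_real y * cauchy_transform M (\<i> * complex_of_real y)) - 1 = (\<integral>t. 2 * Re (?k t) - 1 \<partial>M)"
    unfolding cauchy_transform_def integral_mult_right_zero[symmetric] integral_Re[OF int, symmetric]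
    using integrable_Re[OF int] by (subst Bochner_Integration.integral_diff) (auto simp: prob_UNIV)
  also have "\<dots> \<le> (\<integral>t. indicator {- y<..y} t \<partial>M)"
  proof (rule integral_mono)
    show "2 * Re (?k t) - 1 \<le> indicator {- y<..y} t" for t
    proof (cases "t \<in> {- y<..y}")
      case True
      have "y\<^sup>2 / (y\<^sup>2 + t\<^sup>2) \<le> 1" using y by (simp add: pos_divide_le_eq add_pos_nonneg)
      then show ?thesis using True unfolding Re by simp
    next
      case False
      then have "y\<^sup>2 \<le> t\<^sup>2" using y by (auto simp: abs_le_square_iff[symmetric])
      then have "y\<^sup>2 / (y\<^sup>2 + t\<^sup>2) \<le> 1 / 2" using y by (simp add: pos_divide_le_eq add_pos_nonneg)
      then show ?thesis using False unfolding Re by (auto simp: indicator_def mult.commute[of 2])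
    qed
  qed (use int in \<open>auto simp: emeasure_eq_measure intro!: integrable_real_indicator\<close>)
  finally show ?thesis by simp
qed

text \<open>At one height \<open>y\<close>, chosen by the normalisation of \<open>G\<close>,
  convergence gives the mass bound for all large \<open>n\<close>; the finitely many other measures
  get heights of their own. The margin \<open>\<epsilon> / 2\<close> becomes
  \<open>\<epsilon>\<close> through the factor \<open>2\<close> in
  \<open>prob_Ioc_ge\<close>.\<close>

lemma tight_if_cauchy_transform_converges:
  assumes \<mu>: "\<And>n. real_distribution (\<mu> n)"
    and lim: "\<And>z. Im z > 0 \<Longrightarrow> (\<lambda>n. cauchy_transform (\<mu> n) z) \<longlonglongrightarrow> G z"
    and G: "((\<lambda>y. \<i> * complex_of_real y * G (\<i> * complex_of_real y)) \<longlongrightarrow> 1) at_top"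
  shows "tight \<mu>"
  unfolding tight_def
proof (intro conjI allI impI \<mu>)
  fix \<epsilon> :: real assume \<epsilon>: "\<epsilon> > 0"
  have *: "\<exists>y>0. Re (\<i> * complex_of_real y * H (\<i> * complex_of_real y)) > 1 - \<epsilon> / 2"
    if "((\<lambda>y. \<i> * complex_of_real y * H (\<i> * complex_of_real y)) \<longlongrightarrow> 1) at_top" for H
  proof -
    have "\<forall>\<^sub>F y in at_top. Re (\<i> * complex_of_real y * H (\<i> * complex_of_real y)) > 1 - \<epsilon> / 2"
      using order_tendstoD(1)[OF tendsto_Re[OF that], of "1 - \<epsilon> / 2"] \<epsilon> by simp
    from eventually_happens[OF eventually_conj[OF this eventually_gt_at_top[of 0]]] show ?thesis by auto
  qed
  have "\<forall>n. \<exists>y>0. Re (\<i> * complex_of_real y * cauchy_transform (\<mu> n) (\<i> * complex_of_real y)) > 1 - \<epsilon> / 2"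
    using *[OF real_distribution.cauchy_transform_at_infinity[OF \<mu>]] by blast
  then obtain Y where Y: "\<And>n. Y n > 0"
    "\<And>n. Re (\<i> * complex_of_real (Y n) * cauchy_transform (\<mu> n) (\<i> * complex_of_real (Y n))) > 1 - \<epsilon> / 2"
    by metis
  obtain y where y: "y > 0" "Re (\<i> * complex_of_real y * G (\<i> * complex_of_real y)) > 1 - \<epsilon> / 2"
    using *[OF G] by blast
  have "(\<lambda>n. Re (\<i> * complex_of_real y * cauchy_transform (\<mu> n) (\<i> * complex_of_real y)))
      \<longlonglongrightarrow> Re (\<i> * complex_of_real y * G (\<i> * complex_of_real y))"
    using y by (intro tendsto_intros lim) auto
  from order_tendstoD(1)[OF this y(2)] obtain N where
    N: "\<And>n. n \<ge> N \<Longrightarrow> Re (\<i> * complex_of_real y * cauchy_transform (\<mu> n) (\<i> * complex_of_real y)) > 1 - \<epsilon> / 2"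
    unfolding eventually_sequentially by blast
  define Z where "Z = Max (insert y (Y ` {..<N}))"
  have Z: "y \<le> Z" "\<And>n. n < N \<Longrightarrow> Y n \<le> Z" by (auto simp: Z_def)
  have big: "measure (\<mu> n) {- Z<..Z} > 1 - \<epsilon>"
    if "0 < x" "x \<le> Z" "Re (\<i> * complex_of_real x * cauchy_transform (\<mu> n) (\<i> * complex_of_real x)) > 1 - \<epsilon> / 2" for x n
  proof -
    interpret real_distribution "\<mu> n" by (rule \<mu>)
    have "1 - \<epsilon> < prob {- x<..x}" using prob_Ioc_ge[OF that(1)] that(3) by simp
    also have "\<dots> \<le> prob {- Z<..Z}" using that by (intro finite_measure_mono) auto
    finally show ?thesis .
  qed
  show "\<exists>a b. a < b \<and> (\<forall>n. 1 - \<epsilon> < measure (\<mu> n) {a<..b})"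
  proof (rule exI[of _ "- Z"], rule exI[of _ Z], intro conjI allI)
    show "- Z < Z" using y Z by simp
    show "1 - \<epsilon> < measure (\<mu> n) {- Z<..Z}" for n
      using big[OF y(1) Z(1) N] big[OF Y(1) Z(2) Y(2)] by (cases "n < N") auto
  qed
qed

lemma cauchy_transform_weak_limit:
  assumes \<mu>: "\<And>n. real_distribution (\<mu> n)" and "real_distribution \<nu>" and "weak_conv_m \<mu> \<nu>" and z: "Im z > 0"
  shows "(\<lambda>n. cauchy_transform (\<mu> n) z) \<longlonglongrightarrow> cauchy_transform \<nu> z"
  unfolding cauchy_transform_def
proof (rule weak_conv_imp_integral_bdd_continuous_conv[OF assms(1-3)])
  show "isCont (\<lambda>t. 1 / (z - complex_of_real t)) x" for x
    using diff_of_real_nonzero[OF z] by (intro continuous_intros) auto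
qed (rule cauchy_kernel_le[OF z])

text \<open>Tightness, which comes from the normalisation of \<open>G\<close>, yields a weakly
  convergent subsequence without loss of mass; the Cauchy kernel is a bounded continuous test
  function, so the limit has transform \<open>G\<close>.\<close>

lemma cauchy_transform_limit:
  assumes \<mu>: "\<And>n. real_distribution (\<mu> n)"
    and lim: "\<And>z. Im z > 0 \<Longrightarrow> (\<lambda>n. cauchy_transform (\<mu> n) z) \<longlonglongrightarrow> G z"
    and G: "((\<lambda>y. \<i> * complex_of_real y * G (\<i> * complex_of_real y)) \<longlongrightarrow> 1) at_top"
  obtains \<nu> where "real_distribution \<nu>" "\<And>z. Im z > 0 \<Longrightarrow> cauchy_transform \<nu> z = G z"
proof -
  obtain r \<nu> where r: "strict_mono r" and \<nu>: "real_distribution \<nu>" and conv: "weak_conv_m (\<mu> \<circ> id \<circ> r) \<nu>"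
    using tight_imp_convergent_subsubsequence[OF tight_if_cauchy_transform_converges[OF assms] strict_mono_id] by blast
  have "cauchy_transform \<nu> z = G z" if z: "Im z > 0" for z
  proof (rule LIMSEQ_unique)
    show "(\<lambda>n. cauchy_transform ((\<mu> \<circ> id \<circ> r) n) z) \<longlonglongrightarrow> cauchy_transform \<nu> z"
      by (rule cauchy_transform_weak_limit[OF _ \<nu> conv z]) (simp add: \<mu>)
    show "(\<lambda>n. cauchy_transform ((\<mu> \<circ> id \<circ> r) n) z) \<longlonglongrightarrow> G z"
      using LIMSEQ_subseq_LIMSEQ[OF lim[OF z] r] by (simp add: o_def)
  qed
  then show thesis using that \<nu> by blast
qed

text \<open>By tightness it is enough to identify the limits of weakly convergent subsequences,
  which injectivity of the Cauchy transform does.\<close>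

lemma weak_conv_if_cauchy_transform_converges:
  assumes \<mu>: "\<And>n. real_distribution (\<mu> n)" and \<nu>: "real_distribution \<nu>"
    and lim: "\<And>z. Im z > 0 \<Longrightarrow> (\<lambda>n. cauchy_transform (\<mu> n) z) \<longlonglongrightarrow> cauchy_transform \<nu> z"
  shows "weak_conv_m \<mu> \<nu>"
proof (rule tight_subseq_weak_converge[OF \<mu> \<nu>])
  show "tight \<mu>"
    by (rule tight_if_cauchy_transform_converges[OF \<mu> lim real_distribution.cauchy_transform_at_infinity[OF \<nu>]])
  fix s \<nu>' assume s: "strict_mono s" and \<nu>': "real_distribution \<nu>'" and conv: "weak_conv_m (\<mu> \<circ> s) \<nu>'"
  have "cauchy_transform \<nu>' z = cauchy_transform \<nu> z" if z: "Im z > 0" for z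
  proof (rule LIMSEQ_unique)
    show "(\<lambda>n. cauchy_transform ((\<mu> \<circ> s) n) z) \<longlonglongrightarrow> cauchy_transform \<nu>' z"
      by (rule cauchy_transform_weak_limit[OF _ \<nu>' conv z]) (simp add: \<mu>)
    show "(\<lambda>n. cauchy_transform ((\<mu> \<circ> s) n) z) \<longlonglongrightarrow> cauchy_transform \<nu> z"
      using LIMSEQ_subseq_LIMSEQ[OF lim[OF z] s] by (simp add: o_def)
  qed
  then have "\<nu>' = \<nu>" by (rule cauchy_transform_inject[OF \<nu>' \<nu>])
  then show "weak_conv_m (\<mu> \<circ> s) \<nu>" using conv by simp
qed

section \<open>Existence of the representing measure\<close>

text \<open>The Poisson integral is obtained from Cauchy's theorem for
  \<open>Q \<zeta> = (g \<zeta> - g z) * (1 / (\<zeta> - z) - 1 / (\<zeta> - cnj z))\<close>, which decays like \<open>1 / \<bar>\<zeta>\<bar>\<^sup>2\<close>, so that its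
  primitive takes almost the same values at \<open>R\<close> and \<open>- R\<close>.\<close>

lemma poisson_primitive:
  fixes g :: "complex \<Rightarrow> complex"
  assumes e: "e > 0" and hol: "g holomorphic_on {\<zeta>. Im \<zeta> > - e}"
    and bound: "\<And>\<zeta>. Im \<zeta> \<ge> 0 \<Longrightarrow> cmod (g \<zeta>) \<le> B" and z: "Im z > 0"
  obtains \<Psi> :: "complex \<Rightarrow> complex" where
    "\<And>x. (\<Psi> has_field_derivative (g (complex_of_real x) - g z) * (2 * \<i> * Im z / (cmod (complex_of_real x - z))\<^sup>2)) (at (complex_of_real x))"
    "(\<lambda>n. \<Psi> (complex_of_real (real n)) - \<Psi> (complex_of_real (- real n))) \<longlonglongrightarrow> 0"
proof -
  \<comment> \<open>On \<open>Im \<zeta> > - \<delta>\<close> the function \<open>g\<close> is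
    holomorphic and the pole \<open>cnj z\<close> is avoided.\<close>
  define \<delta> where "\<delta> = min e (Im z)"
  define S where "S = {\<zeta>. Im \<zeta> > - \<delta>}"
  have \<delta>: "\<delta> > 0" "\<delta> \<le> e" "\<delta> \<le> Im z" using e z by (auto simp: \<delta>_def)
  have S: "open S" "convex S" unfolding S_def by (auto intro: open_halfspace_Im_gt convex_halfspace_Im_gt)
  have zS: "z \<in> S" using z \<delta> by (simp add: S_def)
  have cS: "\<zeta> - cnj z \<noteq> 0" if "\<zeta> \<in> S" for \<zeta> using that \<delta> by (auto simp: S_def complex_eq_iff)
  \<comment> \<open>The pole at \<open>z\<close> is removed by the zero of
    \<open>g \<zeta> - g z\<close>; the numerator \<open>2 \<i> Im z\<close> in \<open>Q\<close> is
    \<open>z - cnj z\<close>.\<close>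
  define q where "q \<zeta> = (if \<zeta> = z then deriv g z else (g \<zeta> - g z) / (\<zeta> - z))" for \<zeta>
  define Q where "Q \<zeta> = q \<zeta> * (2 * \<i> * Im z / (\<zeta> - cnj z))" for \<zeta>
  have "g holomorphic_on S" using hol \<delta> by (rule_tac holomorphic_on_subset) (auto simp: S_def)
  then have "q holomorphic_on S"
    unfolding q_def using zS S by (intro pole_lemma) (auto simp: interior_open)
  then have "Q holomorphic_on S"
    unfolding Q_def using cS by (intro holomorphic_intros) auto
  then obtain \<Psi> where "\<And>\<zeta>. \<zeta> \<in> S \<Longrightarrow> (\<Psi> has_field_derivative Q \<zeta>) (at \<zeta> within S)"
    using holomorphic_convex_primitive'[OF S(2,1)] by blast
  then have \<Psi>: "(\<Psi> has_field_derivative Q \<zeta>) (at \<zeta>)" if "\<zeta> \<in> S" for \<zeta>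
    using that at_within_open[OF that S(1)] by metis
  have B: "B \<ge> 0" using order_trans[OF norm_ge_zero bound[of 0]] by simp
  have Qb: "cmod (Q \<zeta>) \<le> 16 * B * Im z / R\<^sup>2" if R: "R > 2 * cmod z" "R > 0" "cmod \<zeta> \<ge> R" "Im \<zeta> \<ge> 0" for \<zeta> R
  proof -
    have 1: "cmod (\<zeta> - z) \<ge> R / 2" using norm_triangle_ineq2[of \<zeta> z] R by simp
    have 2: "cmod (\<zeta> - cnj z) \<ge> R / 2" using norm_triangle_ineq2[of \<zeta> "cnj z"] R by simp
    have "\<zeta> \<noteq> z" using 1 R by auto
    then have "cmod (Q \<zeta>) = cmod (g \<zeta> - g z) * (2 * Im z) / (cmod (\<zeta> - z) * cmod (\<zeta> - cnj z))"
      using z by (simp add: Q_def q_def norm_mult norm_divide)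
    also have "\<dots> \<le> (B + B) * (2 * Im z) / (R / 2 * (R / 2))"
    proof (intro frac_le mult_mono)
      show "cmod (g \<zeta> - g z) \<le> B + B"
        using norm_triangle_ineq4[of "g \<zeta>" "g z"] bound[OF R(4)] bound[of z] z by simp
    qed (use z B R 1 2 in auto)
    also have "\<dots> = 16 * B * Im z / R\<^sup>2" by (simp add: power2_eq_square)
    finally show ?thesis .
  qed
  have seg: "cmod (\<Psi> b - \<Psi> a) \<le> 16 * B * Im z / R\<^sup>2 * (2 * R)"
    if R: "R > 2 * cmod z" "R > 0" and ab: "cmod (b - a) \<le> 2 * R"
      and far: "\<And>\<zeta>. \<zeta> \<in> closed_segment a b \<Longrightarrow> cmod \<zeta> \<ge> R \<and> Im \<zeta> \<ge> 0" for a b R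
  proof -
    have "cmod (\<Psi> b - \<Psi> a - 0 * (b - a)) \<le> 16 * B * Im z / R\<^sup>2 * cmod (b - a)"
    proof (rule segment_derivative_estimate)
      fix \<zeta> assume "\<zeta> \<in> closed_segment a b"
      note f = far[OF this]
      then show "(\<Psi> has_field_derivative Q \<zeta>) (at \<zeta>)" using \<delta> by (intro \<Psi>) (auto simp: S_def)
      show "cmod (Q \<zeta> - 0) \<le> 16 * B * Im z / R\<^sup>2" using Qb[OF R] f by simp
    qed
    also have "\<dots> \<le> 16 * B * Im z / R\<^sup>2 * (2 * R)"
      using ab B z by (intro mult_left_mono) auto
    finally show ?thesis by simp
  qed
  \<comment> \<open>From \<open>R\<close> to \<open>- R\<close> along three sides of a rectangle at
    distance at least \<open>R\<close> from the origin. Each has length at most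
    \<open>2 * R\<close>, so the decay \<open>1 / R^2\<close> of \<open>Q\<close> leaves
    \<open>1 / R\<close>.\<close>
  have main: "cmod (\<Psi> (complex_of_real R) - \<Psi> (complex_of_real (- R))) \<le> 96 * B * Im z / R"
    if R: "R > 2 * cmod z" "R > 0" for R
  proof -
    have "closed_segment (Complex R 0) (Complex R R) \<subseteq> {\<zeta>. R \<le> Re \<zeta>} \<inter> {\<zeta>. 0 \<le> Im \<zeta>}"
      using R by (intro closed_segment_subset convex_Int convex_halfspace_Re_ge convex_halfspace_Im_ge) auto
    then have far: "R \<le> cmod \<zeta> \<and> 0 \<le> Im \<zeta>" if "\<zeta> \<in> closed_segment (Complex R 0) (Complex R R)" for \<zeta>
      using that R abs_Re_le_cmod[of \<zeta>] by force
    have 1: "cmod (\<Psi> (Complex R R) - \<Psi> (Complex R 0)) \<le> 16 * B * Im z / R\<^sup>2 * (2 * R)"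
      by (rule seg[OF R _ far], rule order_trans[OF cmod_le]) (use R in auto)
    have "closed_segment (Complex R R) (Complex (- R) R) \<subseteq> {\<zeta>. R \<le> Im \<zeta>}"
      using R by (intro closed_segment_subset convex_halfspace_Im_ge) auto
    then have far: "R \<le> cmod \<zeta> \<and> 0 \<le> Im \<zeta>" if "\<zeta> \<in> closed_segment (Complex R R) (Complex (- R) R)" for \<zeta>
      using that R abs_Im_le_cmod[of \<zeta>] by force
    have 2: "cmod (\<Psi> (Complex (- R) R) - \<Psi> (Complex R R)) \<le> 16 * B * Im z / R\<^sup>2 * (2 * R)"
      by (rule seg[OF R _ far], rule order_trans[OF cmod_le]) (use R in auto)
    have "closed_segment (Complex (- R) R) (Complex (- R) 0) \<subseteq> {\<zeta>. Re \<zeta> \<le> - R} \<inter> {\<zeta>. 0 \<le> Im \<zeta>}"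
      using R by (intro closed_segment_subset convex_Int convex_halfspace_Re_le convex_halfspace_Im_ge) auto
    then have far: "R \<le> cmod \<zeta> \<and> 0 \<le> Im \<zeta>" if "\<zeta> \<in> closed_segment (Complex (- R) R) (Complex (- R) 0)" for \<zeta>
      using that R abs_Re_le_cmod[of \<zeta>] by force
    have 3: "cmod (\<Psi> (Complex (- R) 0) - \<Psi> (Complex (- R) R)) \<le> 16 * B * Im z / R\<^sup>2 * (2 * R)"
      by (rule seg[OF R _ far], rule order_trans[OF cmod_le]) (use R in auto)
    have tri: "cmod (p - s) \<le> cmod (q - p) + cmod (r - q) + cmod (s - r)" for p q r s :: complex
      using dist_triangle[of p s q] dist_triangle[of q s r] by (simp add: dist_norm norm_minus_commute)
    have "cmod (\<Psi> (Complex R 0) - \<Psi> (Complex (- R) 0)) \<le> 3 * (16 * B * Im z / R\<^sup>2 * (2 * R))"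
      using order_trans[OF tri add_mono[OF add_mono[OF 1 2] 3]] by (simp add: mult_ac)
    also have "\<dots> = 96 * B * Im z / R" using R by (simp add: power2_eq_square)
    finally show ?thesis by (simp add: complex_of_real_def)
  qed
  show thesis
  proof (rule that[of \<Psi>])
    fix x
    have "(complex_of_real x - z) * (complex_of_real x - cnj z) = complex_of_real ((cmod (complex_of_real x - z))\<^sup>2)"
      by (subst complex_norm_square) simp
    moreover have "complex_of_real x \<noteq> z" using z by auto
    ultimately have "Q (complex_of_real x) = (g (complex_of_real x) - g z) * (2 * \<i> * Im z / (cmod (complex_of_real x - z))\<^sup>2)"
      by (simp add: Q_def q_def)
    then show "(\<Psi> has_field_derivative (g (complex_of_real x) - g z) * (2 * \<i> * Im z / (cmod (complex_of_real x - z))\<^sup>2)) (at (complex_of_real x))"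
      using \<Psi>[of "complex_of_real x"] \<delta> by (simp add: S_def)
  next
    have "(\<lambda>n. 96 * B * Im z / real n) \<longlonglongrightarrow> 0"
      by (intro tendsto_divide_0[OF tendsto_const] filterlim_at_top_imp_at_infinity filterlim_real_sequentially)
    moreover obtain m where m: "2 * cmod z + 1 < real m" using reals_Archimedean2 by blast
    have "\<forall>\<^sub>F n in sequentially. norm (\<Psi> (complex_of_real (real n)) - \<Psi> (complex_of_real (- real n))) \<le> 96 * B * Im z / real n"
      unfolding eventually_sequentially
    proof (intro exI[of _ m] allI impI main)
      fix n assume "m \<le> n"
      then have "2 * cmod z + 1 < real n" using m by linarith
      then show "2 * cmod z < real n" "0 < real n" using norm_ge_zero[of z] by linarith+
    qed
    ultimately show "(\<lambda>n. \<Psi> (complex_of_real (real n)) - \<Psi> (complex_of_real (- real n))) \<longlonglongrightarrow> 0"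
      by (rule Lim_null_comparison[rotated])
  qed
qed

text \<open>On the real axis half the real part of the primitive has derivative
  \<open>- (Im (g x) - Im (g z)) * k x\<close>, and the arctangent term in \<open>W\<close> removes
  the contribution of \<open>g z\<close>; so \<open>W\<close> is a primitive of the integrand. In
  the limit only the arctangent contributes, with total variation \<open>pi\<close>.\<close>

lemma poisson_integral:
  fixes g :: "complex \<Rightarrow> complex"
  assumes e: "e > 0" and hol: "g holomorphic_on {\<zeta>. Im \<zeta> > - e}"
    and bound: "\<And>\<zeta>. Im \<zeta> \<ge> 0 \<Longrightarrow> cmod (g \<zeta>) \<le> B"
    and neg: "\<And>\<zeta>. Im \<zeta> \<ge> 0 \<Longrightarrow> Im (g \<zeta>) \<le> 0" and z: "Im z > 0"
  shows "(\<integral>\<^sup>+x. ennreal (- Im (g (complex_of_real x)) * (Im z / (cmod (z - complex_of_real x))\<^sup>2)) \<partial>lborel)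
    = ennreal (- pi * Im (g z))"
proof -
  define y where "y = Im z"
  have y: "y > 0" using z by (simp add: y_def)
  define k where "k x = Im z / (cmod (z - complex_of_real x))\<^sup>2" for x
  define u where "u x = - Im (g (complex_of_real x)) * k x" for x
  have k0: "k x \<ge> 0" for x using z by (simp add: k_def)
  have u0: "u x \<ge> 0" for x using neg[of "complex_of_real x"] k0[of x] by (simp add: u_def mult_nonpos_nonneg)
  obtain \<Psi> where \<Psi>: "\<And>x. (\<Psi> has_field_derivative (g (complex_of_real x) - g z) * (2 * \<i> * Im z / (cmod (complex_of_real x - z))\<^sup>2)) (at (complex_of_real x))"
    and lim: "(\<lambda>n. \<Psi> (complex_of_real (real n)) - \<Psi> (complex_of_real (- real n))) \<longlonglongrightarrow> 0"
    using poisson_primitive[OF e hol bound z] by blast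
  define W where "W x = Re (\<Psi> (complex_of_real x)) / 2 - Im (g z) * arctan ((x - Re z) / y)" for x
  have W: "(W has_real_derivative u x) (at x)" for x
  proof -
    have "((\<lambda>x. \<Psi> (complex_of_real x)) has_vector_derivative ((g (complex_of_real x) - g z) * (2 * \<i> * Im z / (cmod (complex_of_real x - z))\<^sup>2))) (at x)"
      by (rule has_vector_derivative_real_field[OF \<Psi>])
    from bounded_linear.has_vector_derivative[OF bounded_linear_Re this]
    have 1: "((\<lambda>x. Re (\<Psi> (complex_of_real x))) has_real_derivative - 2 * (Im (g (complex_of_real x)) - Im (g z)) * k x) (at x)"
      unfolding k_def norm_minus_commute[of z] has_real_derivative_iff_has_vector_derivative
      by (simp add: mult_ac diff_divide_distrib left_diff_distrib right_diff_distrib)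
    have 2: "((\<lambda>x. arctan ((x - Re z) / y)) has_real_derivative k x) (at x)"
    proof -
      have "((\<lambda>x. arctan ((x - Re z) / y)) has_real_derivative inverse (1 + ((x - Re z) / y)\<^sup>2) * (1 / y)) (at x)"
        using y by (auto intro!: derivative_eq_intros)
      moreover have "1 + ((x - Re z) / y)\<^sup>2 = ((x - Re z)\<^sup>2 + y\<^sup>2) / y\<^sup>2"
        using y by (simp add: power_divide add_divide_distrib)
      ultimately show ?thesis
        using y unfolding k_def norm_minus_commute[of z] cmod_power2 by (simp add: power2_eq_square y_def)
    qed
    show ?thesis
      using DERIV_diff[OF DERIV_cdivide[OF 1, of 2] DERIV_cmult[OF 2, of "Im (g z)"]]
      unfolding W_def u_def by (simp add: left_diff_distrib diff_divide_distrib)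
  qed
  have um: "u \<in> borel_measurable borel"
  proof -
    have "continuous_on UNIV (\<lambda>x. g (complex_of_real x))"
      by (rule continuous_on_compose2[OF holomorphic_on_imp_continuous_on[OF hol]])
        (use e in \<open>auto intro!: continuous_intros\<close>)
    moreover have "continuous_on UNIV k"
      unfolding k_def using diff_of_real_nonzero[OF z] by (intro continuous_intros) auto
    ultimately show ?thesis
      unfolding u_def by (intro borel_measurable_continuous_onI continuous_intros)
  qed
  have FTC: "(\<integral>\<^sup>+x. ennreal (u x) * indicator {- real n..real n} x \<partial>lborel) = ennreal (W (real n) - W (- real n))" for n
    by (rule nn_integral_FTC_Icc[OF um W u0]) simp
  have "(\<lambda>n. \<integral>\<^sup>+x. ennreal (u x) * indicator {- real n..real n} x \<partial>lborel) \<longlonglongrightarrow> (\<integral>\<^sup>+x. ennreal (u x) \<partial>lborel)"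
  proof (rule nn_integral_LIMSEQ)
    show "incseq (\<lambda>n x. ennreal (u x) * indicator {- real n..real n} x)"
      by (auto simp: incseq_def le_fun_def intro!: mult_left_mono split: split_indicator)
    show "(\<lambda>n. ennreal (u x) * indicator {- real n..real n} x) \<longlonglongrightarrow> ennreal (u x)" for x
    proof (rule tendsto_eventually)
      obtain m where "\<bar>x\<bar> \<le> real m" using real_arch_simple by blast
      then show "\<forall>\<^sub>F n in sequentially. ennreal (u x) * indicator {- real n..real n} x = ennreal (u x)"
        unfolding eventually_sequentially by (intro exI[of _ m]) (auto split: split_indicator)
    qed
  qed (use um in measurable)
  moreover have "(\<lambda>n. \<integral>\<^sup>+x. ennreal (u x) * indicator {- real n..real n} x \<partial>lborel) \<longlonglongrightarrow> ennreal (- pi * Im (g z))"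
    unfolding FTC
  proof (rule tendsto_ennrealI)
    have top: "LIM n sequentially. (real n - Re z) / y :> at_top"
      and bot: "LIM n sequentially. (- real n - Re z) / y :> at_bot"
      using y by real_asymp+
    have "(\<lambda>n. Re (\<Psi> (complex_of_real (real n)) - \<Psi> (complex_of_real (- real n))) / 2
        - Im (g z) * (arctan ((real n - Re z) / y) - arctan ((- real n - Re z) / y)))
      \<longlonglongrightarrow> Re 0 / 2 - Im (g z) * (pi / 2 - (- (pi / 2)))"
      by (intro tendsto_intros lim filterlim_compose[OF tendsto_arctan_at_top top] filterlim_compose[OF tendsto_arctan_at_bot bot]) simp
    then show "(\<lambda>n. W (real n) - W (- real n)) \<longlonglongrightarrow> - pi * Im (g z)"
      by (simp add: W_def algebra_simps diff_divide_distrib)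
  qed
  ultimately have "(\<integral>\<^sup>+x. ennreal (u x) \<partial>lborel) = ennreal (- pi * Im (g z))"
    by (rule LIMSEQ_unique)
  then show ?thesis by (simp add: u_def k_def)
qed

text \<open>With density \<open>- Im g / pi\<close> the Poisson integral matches the imaginary parts
  of \<open>g\<close> and of the Cauchy transform. Their difference is then constant by
  Schwarz--Pick, and it vanishes since both behave like \<open>1 / z\<close> along the imaginary
  axis.\<close>

lemma cauchy_transform_regular:
  fixes g :: "complex \<Rightarrow> complex"
  assumes e: "e > 0" and hol: "g holomorphic_on {\<zeta>. Im \<zeta> > - e}"
    and bound: "\<And>\<zeta>. Im \<zeta> \<ge> 0 \<Longrightarrow> cmod (g \<zeta>) \<le> B"
    and neg: "\<And>\<zeta>. Im \<zeta> \<ge> 0 \<Longrightarrow> Im (g \<zeta>) \<le> 0"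
    and lim: "((\<lambda>y. \<i> * complex_of_real y * g (\<i> * complex_of_real y)) \<longlongrightarrow> 1) at_top"
  obtains \<nu> where "real_distribution \<nu>" "\<And>z. Im z > 0 \<Longrightarrow> cauchy_transform \<nu> z = g z"
proof -
  define u where "u x = - Im (g (complex_of_real x)) / pi" for x
  have u0: "u x \<ge> 0" for x using neg[of "complex_of_real x"] by (simp add: u_def divide_nonpos_pos)
  have "continuous_on UNIV (\<lambda>x. g (complex_of_real x))"
    by (rule continuous_on_compose2[OF holomorphic_on_imp_continuous_on[OF hol]])
      (use e in \<open>auto intro!: continuous_intros\<close>)
  then have um [measurable]: "u \<in> borel_measurable borel"
    unfolding u_def by (intro borel_measurable_continuous_onI continuous_intros) auto
  have P: "(\<integral>\<^sup>+x. ennreal (u x * (Im z / (cmod (z - complex_of_real x))\<^sup>2)) \<partial>lborel) = ennreal (- Im (g z))"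
    if z: "Im z > 0" for z
  proof -
    have "(\<integral>\<^sup>+x. ennreal (u x * (Im z / (cmod (z - complex_of_real x))\<^sup>2)) \<partial>lborel)
        = (\<integral>\<^sup>+x. ennreal (1 / pi) * ennreal (- Im (g (complex_of_real x)) * (Im z / (cmod (z - complex_of_real x))\<^sup>2)) \<partial>lborel)"
      by (intro nn_integral_cong, subst ennreal_mult'[symmetric]) (simp_all add: u_def)
    also have "\<dots> = ennreal (1 / pi) * ennreal (- pi * Im (g z))"
    proof (subst nn_integral_cmult)
      have "(\<lambda>x. ennreal (pi * u x * (Im z / (cmod (z - complex_of_real x))\<^sup>2))) \<in> borel_measurable lborel" by measurable
      then show "(\<lambda>x. ennreal (- Im (g (complex_of_real x)) * (Im z / (cmod (z - complex_of_real x))\<^sup>2))) \<in> borel_measurable lborel"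
        by (simp add: u_def)
    qed (simp only: poisson_integral[OF e hol bound neg z])
    also have "\<dots> = ennreal (- Im (g z))"
      using neg[of z] z by (simp add: ennreal_mult[symmetric] mult_nonneg_nonpos)
    finally show ?thesis .
  qed
  have mass: "(\<integral>\<^sup>+x. ennreal (u x) \<partial>lborel) = 1"
  proof -
    \<comment> \<open>The weight is \<open>n\<close> times the kernel
      \<open>Im z / |z - x|^2\<close> at \<open>z = \<i> n\<close>. It increases to
      \<open>1\<close>, so monotone convergence turns the asymptotics of \<open>g\<close> into total
      mass \<open>1\<close>.\<close>
    define f where "f n x = ennreal (u x * ((real n)\<^sup>2 / ((real n)\<^sup>2 + x\<^sup>2)))" for n x
    have inc: "incseq f"
      unfolding incseq_def le_fun_def f_def
    proof (intro allI impI ennreal_leI mult_left_mono u0)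
      fix m n :: nat and x :: real assume mn: "m \<le> n"
      show "(real m)\<^sup>2 / ((real m)\<^sup>2 + x\<^sup>2) \<le> (real n)\<^sup>2 / ((real n)\<^sup>2 + x\<^sup>2)"
      proof (cases "m = 0")
        case False
        have "(real m)\<^sup>2 \<le> (real n)\<^sup>2" using mn by simp
        moreover have "(real m)\<^sup>2 + x\<^sup>2 > 0" "(real n)\<^sup>2 + x\<^sup>2 > 0"
          using False mn by (auto intro!: add_pos_nonneg)
        ultimately show ?thesis
          using mult_right_mono[of "(real m)\<^sup>2" "(real n)\<^sup>2" "x\<^sup>2"] by (simp add: divide_simps algebra_simps)
      qed simp
    qed
    have f_lim: "(\<lambda>n. f n x) \<longlonglongrightarrow> ennreal (u x)" for x
    proof -
      have "(\<lambda>n. u x * (1 / (1 + (x / real n)\<^sup>2))) \<longlonglongrightarrow> u x * (1 / (1 + 0\<^sup>2))"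
        by (intro tendsto_intros tendsto_divide_0[OF tendsto_const] filterlim_at_top_imp_at_infinity filterlim_real_sequentially) auto
      moreover have "\<forall>\<^sub>F n in sequentially. u x * (1 / (1 + (x / real n)\<^sup>2)) = u x * ((real n)\<^sup>2 / ((real n)\<^sup>2 + x\<^sup>2))"
        using eventually_gt_at_top[of 0]
      proof eventually_elim
        case (elim n)
        then have "1 + (x / real n)\<^sup>2 = ((real n)\<^sup>2 + x\<^sup>2) / (real n)\<^sup>2" by (simp add: power_divide add_divide_distrib)
        then show ?case by simp
      qed
      ultimately have "(\<lambda>n. u x * ((real n)\<^sup>2 / ((real n)\<^sup>2 + x\<^sup>2))) \<longlonglongrightarrow> u x"
        using Lim_transform_eventually by fastforce
      then show ?thesis unfolding f_def by (rule tendsto_ennrealI)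
    qed
    have int: "(\<integral>\<^sup>+x. f n x \<partial>lborel) = ennreal (real n * (- Im (g (\<i> * complex_of_real (real n)))))" if n: "n > 0" for n
    proof -
      have eq: "f n x = ennreal (real n) * ennreal (u x * (Im (\<i> * complex_of_real (real n)) / (cmod (\<i> * complex_of_real (real n) - complex_of_real x))\<^sup>2))" for x
      proof -
        have "(cmod (\<i> * complex_of_real (real n) - complex_of_real x))\<^sup>2 = (real n)\<^sup>2 + x\<^sup>2"
          unfolding cmod_power2 by simp
        then show ?thesis using u0[of x] by (simp add: f_def ennreal_mult[symmetric] power2_eq_square mult_ac)
      qed
      have "(\<integral>\<^sup>+x. f n x \<partial>lborel) = ennreal (real n) * ennreal (- Im (g (\<i> * complex_of_real (real n))))"
        unfolding eq by (subst nn_integral_cmult, measurable) (use n in \<open>subst P; simp\<close>)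
      also have "\<dots> = ennreal (real n * (- Im (g (\<i> * complex_of_real (real n)))))"
        using neg[of "\<i> * complex_of_real (real n)"] by (intro ennreal_mult[symmetric]) auto
      finally show ?thesis .
    qed
    have "(\<lambda>n. \<integral>\<^sup>+x. f n x \<partial>lborel) \<longlonglongrightarrow> (\<integral>\<^sup>+x. ennreal (u x) \<partial>lborel)"
      by (rule nn_integral_LIMSEQ[OF inc _ f_lim]) (simp add: f_def)
    moreover have "(\<lambda>n. \<integral>\<^sup>+x. f n x \<partial>lborel) \<longlonglongrightarrow> 1"
    proof -
      have "(\<lambda>n. Re (\<i> * complex_of_real (real n) * g (\<i> * complex_of_real (real n)))) \<longlonglongrightarrow> Re 1"
        by (intro tendsto_Re filterlim_compose[OF lim filterlim_real_sequentially])
      then have "(\<lambda>n. ennreal (real n * (- Im (g (\<i> * complex_of_real (real n)))))) \<longlonglongrightarrow> ennreal 1"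
        by (intro tendsto_ennrealI) simp
      moreover have "\<forall>\<^sub>F n in sequentially. ennreal (real n * (- Im (g (\<i> * complex_of_real (real n))))) = (\<integral>\<^sup>+x. f n x \<partial>lborel)"
        using eventually_gt_at_top[of 0] by eventually_elim (simp add: int)
      ultimately show ?thesis
        using Lim_transform_eventually by fastforce
    qed
    ultimately show ?thesis by (rule LIMSEQ_unique)
  qed
  define \<nu> where "\<nu> = density lborel (\<lambda>x. ennreal (u x))"
  have "prob_space \<nu>" unfolding \<nu>_def by (intro prob_spaceI) (simp add: emeasure_density mass)
  then have \<nu>: "real_distribution \<nu>"
    by (simp add: real_distribution_def real_distribution_axioms_def \<nu>_def)
  interpret real_distribution \<nu> by (rule \<nu>)
  have Im: "Im (cauchy_transform \<nu> z) = Im (g z)" if z: "Im z > 0" for z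
  proof -
    have "(\<integral>t. Im z / (cmod (z - complex_of_real t))\<^sup>2 \<partial>\<nu>) = enn2real (\<integral>\<^sup>+t. ennreal (Im z / (cmod (z - complex_of_real t))\<^sup>2) \<partial>\<nu>)"
      using z by (intro integral_eq_nn_integral) auto
    also have "(\<integral>\<^sup>+t. ennreal (Im z / (cmod (z - complex_of_real t))\<^sup>2) \<partial>\<nu>) = ennreal (- Im (g z))"
      unfolding \<nu>_def using P[OF z] u0 z by (subst nn_integral_density) (auto simp: ennreal_mult'[symmetric])
    finally show ?thesis using neg[of z] z by (simp add: Im_cauchy_transform)
  qed
  define D where "D z = cauchy_transform \<nu> z - g z" for z
  have "g holomorphic_on upper_half_plane" using e by (intro holomorphic_on_subset[OF hol]) auto
  then have holD: "D holomorphic_on upper_half_plane"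
    unfolding D_def by (intro holomorphic_intros cauchy_transform_holomorphic)
  have const: "D z = D w" if "Im z > 0" "Im w > 0" for z w
    using Schwarz_Pick_half_plane[OF holD _ that] that Im by (simp add: D_def mult_le_0_iff)
  have "cauchy_transform \<nu> z = g z" if z: "Im z > 0" for z
  proof -
    have "((\<lambda>y::real. 1 / y) \<longlongrightarrow> 0) at_top" by real_asymp
    from tendsto_mult[OF tendsto_diff[OF cauchy_transform_at_infinity lim] tendsto_of_real[OF this]]
    have "((\<lambda>y. (\<i> * complex_of_real y * cauchy_transform \<nu> (\<i> * complex_of_real y) - \<i> * complex_of_real y * g (\<i> * complex_of_real y)) * complex_of_real (1 / y)) \<longlongrightarrow> 0) at_top"
      by simp
    moreover have "\<forall>\<^sub>F y in at_top. (\<i> * complex_of_real y * cauchy_transform \<nu> (\<i> * complex_of_real y) - \<i> * complex_of_real y * g (\<i> * complex_of_real y)) * complex_of_real (1 / y) = \<i> * D z"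
      using eventually_gt_at_top[of 0]
    proof eventually_elim
      case (elim y)
      then have "D z = D (\<i> * complex_of_real y)" by (intro const z) simp
      moreover have "(\<i> * complex_of_real y * a - \<i> * complex_of_real y * b) * complex_of_real (1 / y) = \<i> * (a - b)" for a b
        using elim by (simp add: field_simps)
      ultimately show ?case unfolding D_def by metis
    qed
    ultimately have "((\<lambda>y::real. \<i> * D z) \<longlongrightarrow> 0) at_top"
      using Lim_transform_eventually by fastforce
    then have "\<i> * D z = 0" by (simp add: tendsto_const_iff)
    then show ?thesis by (simp add: D_def)
  qed
  then show thesis using that \<nu> by blast
qed

text \<open>The reciprocal \<open>G\<close> of \<open>f\<close> may lack boundary values on the real
  line. Its translate \<open>G (z + \<i> e)\<close> is holomorphic across the line and bounded by
  \<open>1 / e\<close>, hence a Cauchy transform; letting \<open>e\<close> tend to \<open>0\<close>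
  recovers \<open>G\<close>.\<close>

theorem F_class_imp_F_transform:
  assumes f: "F_class f"
  obtains \<mu> where "real_distribution \<mu>" "\<And>z. Im z > 0 \<Longrightarrow> F_transform \<mu> z = f z"
proof -
  note fi = Im_increasingD[OF F_classD[OF f]]
  define G where "G z = inverse (f z)" for z
  have f0: "f z \<noteq> 0" if "Im z > 0" for z using fi(3)[OF that] by auto
  have holG: "G holomorphic_on upper_half_plane"
    unfolding G_def using f0 by (intro holomorphic_intros fi(1)) auto
  have ImG: "Im (G z) \<le> 0" if "Im z > 0" for z
    using fi(3)[OF that] by (simp add: G_def divide_le_0_iff)
  have G_le: "cmod (G z) \<le> 1 / Im z" if "Im z > 0" for z
  proof -
    have "Im z \<le> cmod (f z)" using fi(2)[OF that] abs_Im_le_cmod[of "f z"] by linarith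
    then show ?thesis using that by (simp add: G_def norm_inverse divide_inverse le_imp_inverse_le)
  qed
  have limG: "((\<lambda>y. \<i> * complex_of_real y * G (\<i> * complex_of_real y)) \<longlongrightarrow> 1) at_top"
    using f F_class_iff_reciprocal[OF F_classD[OF f]] by (simp add: G_def)
  have regular: "\<exists>\<nu>. real_distribution \<nu> \<and> (\<forall>z. Im z > 0 \<longrightarrow> cauchy_transform \<nu> z = G (z + \<i> * complex_of_real e))" if e: "e > 0" for e
  proof -
    define g where "g \<zeta> = G (\<zeta> + \<i> * complex_of_real e)" for \<zeta>
    have g_eq: "g = G \<circ> (\<lambda>\<zeta>. \<zeta> + \<i> * complex_of_real e)" by (simp add: g_def fun_eq_iff)
    have hol: "g holomorphic_on {\<zeta>. Im \<zeta> > - e}"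
      unfolding g_eq by (rule holomorphic_on_compose_gen[OF _ holG]) (auto intro!: holomorphic_intros)
    have bd: "cmod (g \<zeta>) \<le> 1 / e" if "Im \<zeta> \<ge> 0" for \<zeta>
    proof -
      have "cmod (g \<zeta>) \<le> 1 / (Im \<zeta> + e)" using G_le[of "\<zeta> + \<i> * complex_of_real e"] e that by (simp add: g_def)
      also have "\<dots> \<le> 1 / e" using e that by (intro frac_le) auto
      finally show ?thesis .
    qed
    have neg: "Im (g \<zeta>) \<le> 0" if "Im \<zeta> \<ge> 0" for \<zeta> using ImG[of "\<zeta> + \<i> * complex_of_real e"] e that by (simp add: g_def)
    have "((\<lambda>y. complex_of_real (y / (y + e)) * (\<i> * complex_of_real (y + e) * G (\<i> * complex_of_real (y + e)))) \<longlongrightarrow> complex_of_real 1 * 1) at_top"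
    proof (intro tendsto_mult tendsto_of_real)
      show "((\<lambda>y. y / (y + e)) \<longlongrightarrow> 1) at_top" by real_asymp
      have "filterlim (\<lambda>y. y + e) at_top at_top" by real_asymp
      then show "((\<lambda>y. \<i> * complex_of_real (y + e) * G (\<i> * complex_of_real (y + e))) \<longlongrightarrow> 1) at_top"
        by (rule filterlim_compose[OF limG])
    qed
    moreover have "\<forall>\<^sub>F y in at_top. complex_of_real (y / (y + e)) * (\<i> * complex_of_real (y + e) * G (\<i> * complex_of_real (y + e))) = \<i> * complex_of_real y * g (\<i> * complex_of_real y)"
      using eventually_gt_at_top[of 0]
    proof eventually_elim
      case (elim y)
      then have "y / (y + e) * (y + e) = y" using e by simp
      then have ab: "complex_of_real (y / (y + e)) * complex_of_real (y + e) = complex_of_real y"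
        by (metis of_real_mult)
      have arg: "\<i> * complex_of_real (y + e) = \<i> * complex_of_real y + \<i> * complex_of_real e"
        by (simp add: distrib_left)
      have "complex_of_real (y / (y + e)) * (\<i> * complex_of_real (y + e) * G (\<i> * complex_of_real (y + e)))
          = \<i> * (complex_of_real (y / (y + e)) * complex_of_real (y + e)) * G (\<i> * complex_of_real (y + e))"
        by (simp only: mult_ac)
      then show ?case unfolding ab by (simp only: g_def arg)
    qed
    ultimately have "((\<lambda>y. \<i> * complex_of_real y * g (\<i> * complex_of_real y)) \<longlongrightarrow> 1) at_top"
      using Lim_transform_eventually by fastforce
    from cauchy_transform_regular[OF e hol bd neg this] show ?thesis unfolding g_def by metis
  qed
  have "\<forall>n. \<exists>\<nu>. real_distribution \<nu> \<and> (\<forall>z. Im z > 0 \<longrightarrow> cauchy_transform \<nu> z = G (z + \<i> * complex_of_real (1 / real (Suc n))))"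
    by (intro allI regular) simp
  then obtain \<nu> where \<nu>: "\<And>n. real_distribution (\<nu> n)"
    "\<And>n z. Im z > 0 \<Longrightarrow> cauchy_transform (\<nu> n) z = G (z + \<i> * complex_of_real (1 / real (Suc n)))"
    by metis
  have "(\<lambda>n. cauchy_transform (\<nu> n) z) \<longlonglongrightarrow> G z" if z: "Im z > 0" for z
  proof -
    have "isCont G z"
      using holG z UHP_open by (metis UHP_iff continuous_on_eq_continuous_at holomorphic_on_imp_continuous_on)
    moreover have "(\<lambda>n. z + \<i> * complex_of_real (1 / real (Suc n))) \<longlonglongrightarrow> z + \<i> * complex_of_real 0"
      by (intro tendsto_intros tendsto_of_real LIMSEQ_Suc[OF lim_1_over_n]) 
    ultimately show ?thesis unfolding \<nu>(2)[OF z] by (auto intro: isCont_tendsto_compose)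
  qed
  from cauchy_transform_limit[OF \<nu>(1) this limG]
  obtain \<mu> where "real_distribution \<mu>" "\<And>z. Im z > 0 \<Longrightarrow> cauchy_transform \<mu> z = G z" by blast
  then show thesis by (intro that[of \<mu>]) (auto simp: F_transform_eq G_def)
qed

section \<open>Monotonic convolution\<close>

lemma F_transform_inject:
  assumes M: "real_distribution M" and N: "real_distribution N"
    and eq: "\<And>z. Im z > 0 \<Longrightarrow> F_transform M z = F_transform N z"
  shows "M = N"
  by (rule cauchy_transform_inject[OF M N]) (use eq in \<open>simp add: F_transform_eq\<close>)

text \<open>Discharges the definite description: existence is closure of \<open>F_class\<close>
  under composition with the representation theorem, uniqueness is injectivity of the
  transform.\<close>

lemma mono_conv:
  assumes \<mu>: "real_distribution \<mu>" and \<nu>: "real_distribution \<nu>"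
  shows "real_distribution (\<mu> \<rhd> \<nu>)"
    and "Im z > 0 \<Longrightarrow> F_transform (\<mu> \<rhd> \<nu>) z = F_transform \<mu> (F_transform \<nu> z)"
proof -
  let ?P = "\<lambda>\<rho>. real_distribution \<rho> \<and>
      (\<forall>z\<in>upper_half_plane. F_transform \<rho> z = F_transform \<mu> (F_transform \<nu> z))"
  have "F_class (\<lambda>z. F_transform \<mu> (F_transform \<nu> z))"
    by (rule F_class_comp[OF real_distribution.F_class_F_transform[OF \<mu>] real_distribution.F_class_F_transform[OF \<nu>]])
  from F_class_imp_F_transform[OF this] obtain \<rho> where \<rho>: "?P \<rho>" by (metis UHP_iff)
  have "?P (THE \<rho>. ?P \<rho>)"
  proof (rule theI[of ?P, OF \<rho>])
    fix \<rho>' assume "?P \<rho>'"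
    with \<rho> show "\<rho>' = \<rho>" by (intro F_transform_inject) auto
  qed
  then show "real_distribution (\<mu> \<rhd> \<nu>)"
    and "Im z > 0 \<Longrightarrow> F_transform (\<mu> \<rhd> \<nu>) z = F_transform \<mu> (F_transform \<nu> z)"
    unfolding mono_conv_def by auto
qed

lemma F_transform_Im_pos: "real_distribution M \<Longrightarrow> Im z > 0 \<Longrightarrow> Im (F_transform M z) > 0"
  using real_distribution.F_transform_Im_ge(1) by (metis less_le_trans)

text \<open>\<open>k\<close> convolutions applied to \<open>\<nu>\<close> have \<open>k + 1\<close>
  factors, matching the exponent \<open>n - 1\<close> in \<open>mono_root\<close>.\<close>

lemma mono_conv_iterate:
  assumes \<nu>: "real_distribution \<nu>"
  shows "real_distribution ((((\<rhd>) \<nu>) ^^ k) \<nu>) \<and>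
    (\<forall>z. Im z > 0 \<longrightarrow> F_transform ((((\<rhd>) \<nu>) ^^ k) \<nu>) z = (F_transform \<nu> ^^ Suc k) z)"
proof (induction k)
  case 0
  then show ?case using \<nu> by simp
next
  case (Suc k)
  then show ?case using mono_conv[OF \<nu>, of "(((\<rhd>) \<nu>) ^^ k) \<nu>"] by simp
qed

lemma mono_root_iff_iter_root:
  assumes \<mu>: "real_distribution \<mu>"
  shows "mono_root n \<mu> \<nu> \<longleftrightarrow> real_distribution \<nu> \<and> iter_root n (F_transform \<mu>) (F_transform \<nu>)"
proof (cases "n \<ge> 1 \<and> real_distribution \<nu>")
  case True
  then have n: "Suc (n - 1) = n" and \<nu>: "real_distribution \<nu>" by auto
  let ?I = "(((\<rhd>) \<nu>) ^^ (n - 1)) \<nu>"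
  have I: "real_distribution ?I" "\<And>z. Im z > 0 \<Longrightarrow> F_transform ?I z = (F_transform \<nu> ^^ n) z"
    using mono_conv_iterate[OF \<nu>, of "n - 1"] unfolding n by auto
  have "\<mu> = ?I \<longleftrightarrow> (\<forall>z. Im z > 0 \<longrightarrow> (F_transform \<nu> ^^ n) z = F_transform \<mu> z)"
    using F_transform_inject[OF \<mu> I(1)] I(2) by metis
  then show ?thesis
    using True F_classD[OF real_distribution.F_class_F_transform[OF \<nu>]]
    by (simp add: mono_root_def iter_root_def)
qed (auto simp: mono_root_def iter_root_def)

section \<open>Semigroups of measures and their continuity\<close>

lemma real_distribution_return: "real_distribution (return borel (x :: real))"
  by (simp add: real_distribution_def real_distribution_axioms_def prob_space_return)

lemma F_transform_return: "F_transform (return borel 0) z = z"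
  unfolding F_transform_def by (subst integral_return) auto

text \<open>Real and imaginary parts of the Cauchy kernel are themselves test functions, so the
  integrals determine the Cauchy transform and with it the measure.\<close>

lemma real_distribution_eqI_bounded_continuous:
  assumes M: "real_distribution M" and N: "real_distribution N"
    and eq: "\<And>f :: real \<Rightarrow> real. continuous_on UNIV f \<Longrightarrow> bounded (range f) \<Longrightarrow> (\<integral>x. f x \<partial>M) = (\<integral>x. f x \<partial>N)"
  shows "M = N"
proof (rule cauchy_transform_inject[OF M N])
  fix z assume z: "Im z > 0"
  let ?k = "\<lambda>t. 1 / (z - complex_of_real t)"
  have cont: "continuous_on UNIV ?k"
    using diff_of_real_nonzero[OF z] by (intro continuous_intros) auto
  have bd: "\<bar>Re (?k t)\<bar> \<le> 1 / Im z" "\<bar>Im (?k t)\<bar> \<le> 1 / Im z" for t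
    using order_trans[OF abs_Re_le_cmod cauchy_kernel_le[OF z]] order_trans[OF abs_Im_le_cmod cauchy_kernel_le[OF z]] by blast+
  have Re: "(\<integral>t. Re (?k t) \<partial>M) = (\<integral>t. Re (?k t) \<partial>N)"
    by (intro eq continuous_on_Re cont) (use bd in \<open>auto simp: bounded_iff\<close>)
  have Im: "(\<integral>t. Im (?k t) \<partial>M) = (\<integral>t. Im (?k t) \<partial>N)"
    by (intro eq continuous_on_Im cont) (use bd in \<open>auto simp: bounded_iff\<close>)
  note int = real_distribution.integrable_cauchy_kernel[OF M z] real_distribution.integrable_cauchy_kernel[OF N z]
  show "cauchy_transform M z = cauchy_transform N z"
    unfolding cauchy_transform_def
    using Re Im by (intro complex_eqI) (simp_all only: integral_Re[OF int(1), symmetric] integral_Re[OF int(2), symmetric]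
        integral_Im[OF int(1), symmetric] integral_Im[OF int(2), symmetric])
qed

lemma dyadic_approximation:
  assumes "t \<ge> 0"
  shows "(\<lambda>n. real (nat \<lfloor>t * 2 ^ n\<rfloor>) / 2 ^ n) \<longlonglongrightarrow> t"
proof (rule tendsto_sandwich[OF always_eventually always_eventually])
  have "t - (1 / 2) ^ n \<le> real (nat \<lfloor>t * 2 ^ n\<rfloor>) / 2 ^ n \<and> real (nat \<lfloor>t * 2 ^ n\<rfloor>) / 2 ^ n \<le> t" for n
  proof -
    have "real (nat \<lfloor>t * 2 ^ n\<rfloor>) = of_int \<lfloor>t * 2 ^ n\<rfloor>" using assms by simp
    then have "t * 2 ^ n - 1 \<le> real (nat \<lfloor>t * 2 ^ n\<rfloor>)" "real (nat \<lfloor>t * 2 ^ n\<rfloor>) \<le> t * 2 ^ n" by linarith+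
    moreover have "t - (1 / 2) ^ n = (t * 2 ^ n - 1) / 2 ^ n" by (simp add: diff_divide_distrib power_divide)
    ultimately show ?thesis by (simp add: divide_right_mono divide_le_eq)
  qed
  then show "\<forall>n. t - (1 / 2) ^ n \<le> real (nat \<lfloor>t * 2 ^ n\<rfloor>) / 2 ^ n" "\<forall>n. real (nat \<lfloor>t * 2 ^ n\<rfloor>) / 2 ^ n \<le> t"
    by blast+
  have "(\<lambda>n. t - (1 / 2) ^ n) \<longlonglongrightarrow> t - 0"
    by (intro tendsto_intros LIMSEQ_realpow_zero) auto
  then show "(\<lambda>n. t - (1 / 2) ^ n) \<longlonglongrightarrow> t" by simp
qed simp

text \<open>Agreement at \<open>1 / 2 ^ n\<close> spreads to all \<open>k / 2 ^ n\<close> by the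
  semigroup law. Rounding \<open>t * 2 ^ n\<close> down approximates \<open>t\<close> by such times,
  and continuity passes to the limit.\<close>

lemma mono_semigroup_unique:
  assumes M: "mono_semigroup M" "weak_star_continuous M"
    and N: "mono_semigroup N" "weak_star_continuous N"
    and dyadic: "\<And>n::nat. M (1 / 2 ^ n) = N (1 / 2 ^ n)" and t: "t \<ge> 0"
  shows "M t = N t"
proof (rule real_distribution_eqI_bounded_continuous)
  show "real_distribution (M t)" "real_distribution (N t)"
    using M N t by (auto simp: mono_semigroup_def)
  have eq: "M (real k / 2 ^ n) = N (real k / 2 ^ n)" for k n
  proof (induction k)
    case 0
    then show ?case using M N by (simp add: mono_semigroup_def)
  next
    case (Suc k)
    have split: "real (Suc k) / 2 ^ n = 1 / 2 ^ n + real k / 2 ^ n" by (simp add: add_divide_distrib)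
    have add: "P (1 / 2 ^ n + real k / 2 ^ n) = P (1 / 2 ^ n) \<rhd> P (real k / 2 ^ n)" if "mono_semigroup P" for P
      using that by (simp add: mono_semigroup_def)
    show ?case unfolding split add[OF M(1)] add[OF N(1)] dyadic Suc ..
  qed
  fix f :: "real \<Rightarrow> real" assume f: "continuous_on UNIV f" "bounded (range f)"
  define x where "x n = real (nat \<lfloor>t * 2 ^ n\<rfloor>) / 2 ^ n" for n
  have x: "\<forall>n. x n \<in> {0..}" "x \<longlonglongrightarrow> t"
    using dyadic_approximation[OF t] unfolding x_def[abs_def] by auto
  have lim: "(\<lambda>n. \<integral>s. f s \<partial>P (x n)) \<longlonglongrightarrow> (\<integral>s. f s \<partial>P t)" if "weak_star_continuous P" for P
    using that f x t unfolding weak_star_continuous_def continuous_on_sequentially o_def by auto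
  have "(\<lambda>n. \<integral>s. f s \<partial>M (x n)) = (\<lambda>n. \<integral>s. f s \<partial>N (x n))" by (simp add: x_def eq)
  with lim[OF M(2)] lim[OF N(2)] show "(\<integral>s. f s \<partial>M t) = (\<integral>s. f s \<partial>N t)"
    by (simp add: LIMSEQ_unique)
qed

theorem proposition3p8:
  fixes \<mu> :: "real measure" and \<rho> :: "nat \<Rightarrow> real measure"
  assumes "mono_infinitely_divisible \<mu>"
    and "\<And>n. n \<ge> 1 \<Longrightarrow> mono_root n \<mu> (\<rho> n)"
  shows "(\<exists>M. (mono_semigroup M \<and> weak_star_continuous M \<and> (\<forall>n::nat. M (1 / 2 ^ n) = \<rho> (2 ^ n))) \<and>
           (\<forall>M'. mono_semigroup M' \<and> weak_star_continuous M' \<and> (\<forall>n::nat. M' (1 / 2 ^ n) = \<rho> (2 ^ n))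
             \<longrightarrow> (\<forall>t\<ge>0. M' t = M t))) \<and>
         (\<forall>n\<ge>1. \<exists>!\<nu>. mono_root n \<mu> \<nu>)"
proof -
  have \<mu>: "real_distribution \<mu>" using assms(1) by (simp add: mono_infinitely_divisible_def)
  let ?F = "F_transform \<mu>"
  note root = mono_root_iff_iter_root[OF \<mu>]
  have \<rho>: "real_distribution (\<rho> n)" "iter_root n ?F (F_transform (\<rho> n))" if "n \<ge> 1" for n
    using assms(2)[OF that] by (auto simp: root)
  have ex: "\<exists>f. iter_root n ?F f" if "n \<ge> 1" for n using \<rho>(2)[OF that] by blast
  obtain g :: "real \<Rightarrow> complex \<Rightarrow> complex" where g: "\<And>t. t \<ge> 0 \<Longrightarrow> F_class (g t)"
    and g0: "\<And>z. Im z > 0 \<Longrightarrow> g 0 z = z"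
    and gadd: "\<And>s t z. s \<ge> 0 \<Longrightarrow> t \<ge> 0 \<Longrightarrow> Im z > 0 \<Longrightarrow> g (s + t) z = g s (g t z)"
    and gcont: "\<And>z. Im z > 0 \<Longrightarrow> continuous_on {0..} (\<lambda>t. g t z)"
    and groot: "\<And>n f z. iter_root n ?F f \<Longrightarrow> Im z > 0 \<Longrightarrow> f z = g (1 / n) z"
    by (rule fractional_iterates[OF real_distribution.F_class_F_transform[OF \<mu>]]) (erule ex, rule that)
  have "\<forall>t\<in>{0..}. \<exists>m. real_distribution m \<and> (\<forall>z. Im z > 0 \<longrightarrow> F_transform m z = g t z)"
    using F_class_imp_F_transform[OF g] by (metis atLeast_iff)
  from bchoice[OF this] obtain M where M: "\<And>t. t \<ge> 0 \<Longrightarrow> real_distribution (M t)"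
    and FM: "\<And>t z. t \<ge> 0 \<Longrightarrow> Im z > 0 \<Longrightarrow> F_transform (M t) z = g t z"
    by auto
  have M0: "M 0 = return borel 0"
    by (rule F_transform_inject[OF M real_distribution_return]) (auto simp: FM g0 F_transform_return)
  have Madd: "M (s + t) = M s \<rhd> M t" if st: "s \<ge> 0" "t \<ge> 0" for s t
  proof (rule F_transform_inject)
    show "real_distribution (M (s + t))" "real_distribution (M s \<rhd> M t)"
      using st by (auto intro!: M mono_conv(1))
    show "F_transform (M (s + t)) z = F_transform (M s \<rhd> M t) z" if z: "Im z > 0" for z
    proof -
      have "F_transform (M s \<rhd> M t) z = F_transform (M s) (F_transform (M t) z)"
        by (rule mono_conv(2)[OF M[OF st(1)] M[OF st(2)] z])
      also have "\<dots> = g s (g t z)"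
        using FM[OF st(2) z] FM[OF st(1) F_transform_Im_pos[OF M[OF st(2)] z]] by simp
      finally show ?thesis using gadd[OF st z] FM[OF _ z, of "s + t"] st by simp
    qed
  qed
  have semi: "mono_semigroup M" using M M0 Madd by (simp add: mono_semigroup_def)
  \<comment> \<open>Tested on sequences of times: continuity of \<open>g t z\<close> in
    \<open>t\<close> gives pointwise convergence of the Cauchy transforms, hence weak convergence of
    the measures.\<close>
  have cont: "weak_star_continuous M"
    unfolding weak_star_continuous_def
  proof (intro allI impI, subst continuous_on_sequentially, intro allI ballI impI)
    fix f :: "real \<Rightarrow> real" and x :: "nat \<Rightarrow> real" and a :: real
    assume f: "continuous_on UNIV f" "bounded (range f)" and a: "a \<in> {0..}"
      and x: "(\<forall>n. x n \<in> {0..}) \<and> x \<longlonglongrightarrow> a"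
    have x0: "x n \<ge> 0" and a0: "a \<ge> 0" for n using x a by auto
    have "weak_conv_m (\<lambda>n. M (x n)) (M a)"
    proof (rule weak_conv_if_cauchy_transform_converges[OF M[OF x0] M[OF a0]])
      fix z assume z: "Im z > 0"
      have G: "cauchy_transform (M t) z = inverse (g t z)" if "t \<ge> 0" for t
        using FM[OF that z] by (metis F_transform_eq inverse_inverse_eq)
      have "(\<lambda>n. g (x n) z) \<longlonglongrightarrow> g a z"
        using gcont[OF z] x a unfolding continuous_on_sequentially o_def by auto
      moreover have "g a z \<noteq> 0"
        using Im_increasingD(3)[OF F_classD[OF g[OF a0]] z] by auto
      ultimately show "(\<lambda>n. cauchy_transform (M (x n)) z) \<longlonglongrightarrow> cauchy_transform (M a) z"
        unfolding G[OF x0] G[OF a0] by (rule tendsto_inverse)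
    qed
    moreover obtain B where "\<And>s. norm (f s) \<le> B" using f(2) by (auto simp: bounded_iff)
    moreover have "isCont f s" for s using f(1) by (simp add: continuous_on_eq_continuous_at)
    ultimately show "((\<lambda>t. \<integral>s. f s \<partial>M t) \<circ> x) \<longlonglongrightarrow> (\<integral>s. f s \<partial>M a)"
      using weak_conv_imp_integral_bdd_continuous_conv[of "\<lambda>n. M (x n)" "M a" f B] M x0 a0 by (simp add: o_def)
  qed
  \<comment> \<open>The prescribed root of order \<open>2 ^ n\<close> is one of the roots covered by
    \<open>groot\<close>, so its transform is \<open>g (1 / 2 ^ n)\<close>.\<close>
  have dyadic: "M (1 / 2 ^ n) = \<rho> (2 ^ n)" for n :: nat
  proof (rule F_transform_inject)
    show "real_distribution (M (1 / 2 ^ n))" "real_distribution (\<rho> (2 ^ n))" by (auto intro!: M \<rho>)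
    show "F_transform (M (1 / 2 ^ n)) z = F_transform (\<rho> (2 ^ n)) z" if z: "Im z > 0" for z
      using groot[OF \<rho>(2)[of "2 ^ n"] z] FM[OF _ z, of "1 / 2 ^ n"] by simp
  qed
  have "\<exists>!\<nu>. mono_root n \<mu> \<nu>" if n: "n \<ge> 1" for n
  proof (rule ex1I[of _ "\<rho> n"])
    fix \<nu> assume "mono_root n \<mu> \<nu>"
    then have \<nu>: "real_distribution \<nu>" "iter_root n ?F (F_transform \<nu>)" by (auto simp: root)
    show "\<nu> = \<rho> n"
      by (rule F_transform_inject[OF \<nu>(1) \<rho>(1)[OF n]]) (simp add: groot[OF \<nu>(2)] groot[OF \<rho>(2)[OF n]])
  qed (rule assms(2)[OF n])
  moreover have "\<forall>M'. mono_semigroup M' \<and> weak_star_continuous M' \<and> (\<forall>n::nat. M' (1 / 2 ^ n) = \<rho> (2 ^ n))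
             \<longrightarrow> (\<forall>t\<ge>0. M' t = M t)"
    using mono_semigroup_unique[OF _ _ semi cont] dyadic by simp
  ultimately show ?thesis using semi cont dyadic by blast
qed

end
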